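(* Let $\mathfrak{g}$ be a complex semisimple Lie algebra and let $\mathfrak{g}_{\mathbb{Z}}$ be a corresponding integral Lie algebra (which always exists, by a Cartan–Serre basis); for a ring of definition $\mathbf{k}$ (a PID) let $\mathfrak{g}_{\mathbf{k}}=\mathfrak{g}_{\mathbb{Z}}\otimes\mathbf{k}$. The root decomposition of $\mathfrak{g}$ induces a weight decomposition of spectral sequences $$E_r^{*,*}[\mathfrak{g}_{\mathbf{k}}]=\bigoplus_{\alpha\in\Lambda(R)}E_r^{*,*}[\alpha],$$ where $\Lambda(R)$ is the root lattice of $\mathfrak{g}$, a free abelian group of rank equal to the rank of $\mathfrak{g}$, i.e. the dimension of a Cartan subalgebra of $\mathfrak{g}$. In addition, if $\mathbf{k}$ is a field of characteristic zero, then the $E_1$-page and beyond only have contributions from the weight $0$ term, while for $\mathbf{k}$ a field of characteristic $p$, the "polynomial line" $E_1^{*,0}$ has contributions only from weights which are zero modulo $p$.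
   Context: For a PID $\mathbf{k}$ and a $\mathbf{k}$-Lie algebra $\mathfrak{L}$ free of finite rank with basis $e_1,\dots,e_m$ and structure constants $[e_i,e_j]=\sum_k c_{ij}^k e_k$, let $x_i$ be the dual basis in $\Lambda^1(\mathfrak{L}^* )$ and $y_i$ the same dual basis in $Poly^1(\mathfrak{L}^* )$. Put $E_0^{*,*}[\mathfrak{L}]=\Lambda^*(x_1,\dots,x_m)\otimes\mathbf{k}[y_1,\dots,y_m]$ with $x_i\in E_0^{0,1}$, $y_i\in E_0^{1,0}$; $E_0^{s,t}$ has total degree $2s+t$. It carries two anticommuting derivations (signs by total degree): $d_0(x_i)=-\sum_{j<k}c_{jk}^i x_jx_k$, $d_0(y_i)=\sum_{j,k}c_{jk}^i y_jx_k$, and $d_1(x_i)=y_i$, $d_1(y_i)=0$. $E_r^{*,*}[\mathfrak{L}]$ is the spectral sequence of the resulting double complex obtained by first taking $d_0$-cohomology; $d_r:E_r^{s,t}\to E_r^{s+r,t-(2r-1)}$, and $E_1^{s,t}=H^t(\mathfrak{L},Poly^s(\mathfrak{L}^* ))$ (dual adjoint action on homogeneous degree $s$ polynomials). Weights: let $\mathfrak{h}$ be a Cartan subalgebra, $R$ the set of roots, $\mathfrak{g}=\mathfrak{h}\oplus\bigoplus_{\alpha\in R}\mathfrak{g}_\alpha$; elements of $\mathfrak{h}$ have weight $0$ and elements of $\mathfrak{g}_\alpha$ weight $\alpha$. The basis of $\mathfrak{g}_{\mathbb{Z}}$ is adapted to this decomposition, and includes a basis $h_1,\dots,h_n$ of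 $\mathfrak{h}$ on which all roots take integer values; $\alpha$ is identified with $(\alpha(h_1),\dots,\alpha(h_n))\in\mathbb{Z}^n$, and "zero modulo $p$" means all these integers are divisible by $p$. The generators $x_i,y_i$ dual to a basis element of weight $\alpha$ are given weight $-\alpha$, and the weight of a product is the sum of the weights of the factors. $E_r^{*,*}[\alpha]$ is the part of the spectral sequence coming from elements of $E_0$ of weight $\alpha$. $p$ denotes an odd prime. *)

theory Defs
  imports
    Complex_Main
    "HOL-Library.Poly_Mapping"
    "HOL-Library.FuncSet"
    "HOL-Library.Set_Algebras"
    "HOL-Library.Function_Algebras"
    "HOL-Computational_Algebra.Primes"
begin

section \<open>Lie algebras\<close>

locale lie_algebra = module scale
  for scale :: "'k::comm_ring_1 \<Rightarrow> 'g::ab_group_add \<Rightarrow> 'g" +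
  fixes bracket :: "'g \<Rightarrow> 'g \<Rightarrow> 'g"
  assumes bracket_add_left: "bracket (x + y) z = bracket x z + bracket y z"
    and bracket_add_right: "bracket x (y + z) = bracket x y + bracket x z"
    and bracket_scale_left: "bracket (scale a x) y = scale a (bracket x y)"
    and bracket_scale_right: "bracket x (scale a y) = scale a (bracket x y)"
    and bracket_self: "bracket x x = 0"
    and jacobi: "bracket x (bracket y z) + bracket y (bracket z x) + bracket z (bracket x y) = 0"
begin

definition brackets :: "'g set \<Rightarrow> 'g set \<Rightarrow> 'g set"
  where "brackets A B = span {bracket x y | x y. x \<in> A \<and> y \<in> B}"

definition subalgebra :: "'g set \<Rightarrow> bool"
  where "subalgebra A \<longleftrightarrow> subspace A \<and> (\<forall>x\<in>A. \<forall>y\<in>A. bracket x y \<in> A)"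

definition lie_ideal :: "'g set \<Rightarrow> bool"
  where "lie_ideal A \<longleftrightarrow> subspace A \<and> (\<forall>x. \<forall>y\<in>A. bracket x y \<in> A)"

definition solvable :: "'g set \<Rightarrow> bool"
  where "solvable A \<longleftrightarrow> (\<exists>n. ((\<lambda>B. brackets B B) ^^ n) A = {0})"

definition nilpotent :: "'g set \<Rightarrow> bool"
  where "nilpotent A \<longleftrightarrow> (\<exists>n. ((\<lambda>B. brackets A B) ^^ n) A = {0})"

text \<open>Finite-dimensional with vanishing radical.\<close>

definition semisimple :: bool
  where "semisimple \<longleftrightarrow> (\<exists>B. finite B \<and> span B = UNIV) \<and>
    (\<forall>I. lie_ideal I \<and> solvable I \<longrightarrow> I = {0})"

definition cartan_subalgebra :: "'g set \<Rightarrow> bool"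
  where "cartan_subalgebra H \<longleftrightarrow> subalgebra H \<and> nilpotent H \<and>
    {x. \<forall>y\<in>H. bracket x y \<in> H} = H"

text \<open>
  Linear forms on the subspace \<open>H\<close>.  They are represented by functions on the whole
  algebra which vanish outside \<open>H\<close>, so that equality and pointwise addition of
  functions are equality and addition in the dual space of \<open>H\<close>.
\<close>

definition dual_space :: "'g set \<Rightarrow> ('g \<Rightarrow> 'k) set"
  where "dual_space H = {\<alpha>. (\<forall>x\<in>H. \<forall>y\<in>H. \<alpha> (x + y) = \<alpha> x + \<alpha> y) \<and>
    (\<forall>a. \<forall>x\<in>H. \<alpha> (scale a x) = a * \<alpha> x) \<and> (\<forall>x. x \<notin> H \<longrightarrow> \<alpha> x = 0)}"

definition root_space :: "'g set \<Rightarrow> ('g \<Rightarrow> 'k) \<Rightarrow> 'g set"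
  where "root_space H \<alpha> = {x. \<forall>y\<in>H. bracket y x = scale (\<alpha> y) x}"

definition roots :: "'g set \<Rightarrow> ('g \<Rightarrow> 'k) set"
  where "roots H = {\<alpha> \<in> dual_space H. \<alpha> \<noteq> 0 \<and> root_space H \<alpha> \<noteq> {0}}"

text \<open>The family \<open>e 0, \<dots>, e (m - 1)\<close> is a basis of the underlying module.\<close>

definition lie_basis :: "nat \<Rightarrow> (nat \<Rightarrow> 'g) \<Rightarrow> bool"
  where "lie_basis m e \<longleftrightarrow>
    inj_on e {..<m} \<and> independent (e ` {..<m}) \<and> span (e ` {..<m}) = UNIV"

text \<open>\<open>structure_constants m e i j k\<close> is the coefficient of \<open>e k\<close> in \<open>[e i, e j]\<close>.\<close>

definition structure_constants :: "nat \<Rightarrow> (nat \<Rightarrow> 'g) \<Rightarrow> nat \<Rightarrow> nat \<Rightarrow> nat \<Rightarrow> 'k"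
  where "structure_constants m e i j k =
    representation (e ` {..<m}) (bracket (e i) (e j)) (e k)"

end

abbreviation int_span :: "('k::comm_ring_1 \<Rightarrow> 'a::ab_group_add \<Rightarrow> 'a) \<Rightarrow> 'a set \<Rightarrow> 'a set"
  where "int_span scale \<equiv> module.span (\<lambda>n::int. scale (of_int n))"

definition fun_scale :: "'k::comm_ring_1 \<Rightarrow> ('g \<Rightarrow> 'k) \<Rightarrow> 'g \<Rightarrow> 'k"
  where "fun_scale a \<alpha> = (\<lambda>x. a * \<alpha> x)"

definition root_lattice ::
    "(complex \<Rightarrow> 'g::ab_group_add \<Rightarrow> 'g) \<Rightarrow> ('g \<Rightarrow> 'g \<Rightarrow> 'g) \<Rightarrow> 'g set \<Rightarrow> ('g \<Rightarrow> complex) set"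
  where "root_lattice scale bracket H =
    int_span fun_scale (lie_algebra.roots scale bracket H)"

definition free_abelian_of_rank ::
    "('k::comm_ring_1 \<Rightarrow> 'a::ab_group_add \<Rightarrow> 'a) \<Rightarrow> 'a set \<Rightarrow> nat \<Rightarrow> bool"
  where "free_abelian_of_rank scale L n \<longleftrightarrow>
    (\<exists>B. finite B \<and> card B = n \<and>
      \<not> module.dependent (\<lambda>n::int. scale (of_int n)) B \<and> int_span scale B = L)"

text \<open>
  The integral span of \<open>e 0, \<dots>, e (m - 1)\<close> is an integral form of the complex Lie algebra,
  with basis adapted to the root decomposition for \<open>H\<close>: every \<open>e i\<close> is either an element
  of \<open>H\<close>, with \<open>w i = 0\<close>, or a root vector for the root \<open>w i\<close>.  The elements \<open>e i\<close> in \<open>H\<close>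
  are the \<open>h\<^sub>1, \<dots>, h\<^sub>n\<close>.
\<close>

definition integral_form ::
    "(complex \<Rightarrow> 'g::ab_group_add \<Rightarrow> 'g) \<Rightarrow> ('g \<Rightarrow> 'g \<Rightarrow> 'g) \<Rightarrow> 'g set \<Rightarrow>
      nat \<Rightarrow> (nat \<Rightarrow> 'g) \<Rightarrow> (nat \<Rightarrow> 'g \<Rightarrow> complex) \<Rightarrow> bool"
  where "integral_form scale bracket H m e w \<longleftrightarrow>
    lie_algebra.lie_basis scale m e \<and>
    (\<forall>x \<in> int_span scale (e ` {..<m}). \<forall>y \<in> int_span scale (e ` {..<m}).
      bracket x y \<in> int_span scale (e ` {..<m})) \<and>
    (\<forall>i<m. e i \<in> H \<and> w i = 0 \<or>
      w i \<in> lie_algebra.roots scale bracket H \<and>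
      e i \<in> lie_algebra.root_space scale bracket H (w i)) \<and>
    module.span scale {e i | i. i < m \<and> e i \<in> H} = H \<and>
    (\<forall>\<alpha> \<in> lie_algebra.roots scale bracket H. \<forall>i<m. e i \<in> H \<longrightarrow> \<alpha> (e i) \<in> \<int>)"

text \<open>
  The \<open>k\<close>-Lie algebra given by \<open>kscale\<close>, \<open>kbracket\<close>, together with the map \<open>\<iota>\<close> from the
  integral span \<open>gZ\<close> of \<open>e 0, \<dots>, e (m - 1)\<close>, is the extension of scalars
  \<open>\<iota> : gZ \<rightarrow> gZ \<otimes> k\<close>, \<open>\<iota> x = x \<otimes> 1\<close>.  As \<open>gZ\<close> is free, this means that \<open>\<iota>\<close> is a
  homomorphism of Lie rings which maps the given integral basis to a basis over \<open>k\<close>.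
\<close>

definition scalar_extension ::
    "(complex \<Rightarrow> 'g::ab_group_add \<Rightarrow> 'g) \<Rightarrow> ('g \<Rightarrow> 'g \<Rightarrow> 'g) \<Rightarrow> nat \<Rightarrow> (nat \<Rightarrow> 'g) \<Rightarrow>
      ('k::comm_ring_1 \<Rightarrow> 'l::ab_group_add \<Rightarrow> 'l) \<Rightarrow> ('l \<Rightarrow> 'l \<Rightarrow> 'l) \<Rightarrow> ('g \<Rightarrow> 'l) \<Rightarrow> bool"
  where "scalar_extension scale bracket m e kscale kbracket \<iota> \<longleftrightarrow>
    lie_algebra kscale kbracket \<and>
    (\<forall>x \<in> int_span scale (e ` {..<m}). \<forall>y \<in> int_span scale (e ` {..<m}).
      \<iota> (x + y) = \<iota> x + \<iota> y \<and> \<iota> (bracket x y) = kbracket (\<iota> x) (\<iota> y)) \<and>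
    lie_algebra.lie_basis kscale m (\<lambda>i. \<iota> (e i))"

definition principal_ideal_domain :: "'k::idom itself \<Rightarrow> bool"
  where "principal_ideal_domain _ \<longleftrightarrow>
    (\<forall>I::'k set. module.subspace (*) I \<longrightarrow> (\<exists>a. I = module.span (*) {a}))"

definition is_field :: "'k::idom itself \<Rightarrow> bool"
  where "is_field _ \<longleftrightarrow> (\<forall>x::'k. x \<noteq> 0 \<longrightarrow> x dvd 1)"


section \<open>The spectral sequence of a double complex\<close>

text \<open>
  A double complex consisting of subsets \<open>dc_part s t\<close> of a fixed module, with differentials
  \<open>dc_d0\<close> of bidegree \<open>(0, 1)\<close> and \<open>dc_d1\<close> of bidegree \<open>(1, -1)\<close>; bidegree \<open>(s, t)\<close> has total
  degree \<open>2 * s + t\<close>.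
\<close>

record ('k, 'a) double_complex =
  dc_smult :: "'k \<Rightarrow> 'a \<Rightarrow> 'a"
  dc_part :: "int \<Rightarrow> int \<Rightarrow> 'a set"
  dc_d0 :: "'a \<Rightarrow> 'a"
  dc_d1 :: "'a \<Rightarrow> 'a"

definition total_d :: "('k, 'a::ab_group_add) double_complex \<Rightarrow> 'a \<Rightarrow> 'a"
  where "total_d K x = dc_d0 K x + dc_d1 K x"

text \<open>The part of total degree \<open>n\<close> of the \<open>s\<close>-th step of the filtration by the first degree.\<close>

definition filt :: "('k::comm_ring_1, 'a::ab_group_add) double_complex \<Rightarrow> int \<Rightarrow> int \<Rightarrow> 'a set"
  where "filt K s n = module.span (dc_smult K) (\<Union>s'\<in>{s..}. dc_part K s' (n - 2 * s'))"

text \<open>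
  The page \<open>E\<^sub>r\<close> of the filtered total complex is \<open>Z\<^sub>r / B\<^sub>r\<close>, where \<open>Z\<^sub>r\<close> consists of the
  \<open>x\<close> in \<open>F\<^sup>s\<close> with \<open>d x\<close> in \<open>F\<^sup>s\<^sup>+\<^sup>r\<close>, and \<open>B\<^sub>r\<close> is the sum of \<open>Z\<^sub>r\<^sub>-\<^sub>1\<close> in filtration \<open>s + 1\<close> and
  the image under \<open>d\<close> of \<open>Z\<^sub>r\<^sub>-\<^sub>1\<close> in filtration \<open>s - r + 1\<close>.  Thus \<open>E\<^sub>0\<close> is the associated
  graded object, with differential \<open>dc_d0\<close>, and \<open>E\<^sub>1\<close> is its \<open>dc_d0\<close>-cohomology.
\<close>

definition ss_Z ::
    "('k::comm_ring_1, 'a::ab_group_add) double_complex \<Rightarrow> int \<Rightarrow> int \<Rightarrow> int \<Rightarrow> 'a set"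
  where "ss_Z K r s t =
    {x \<in> filt K s (2 * s + t). total_d K x \<in> filt K (s + r) (2 * s + t + 1)}"

definition ss_B ::
    "('k::comm_ring_1, 'a::ab_group_add) double_complex \<Rightarrow> nat \<Rightarrow> int \<Rightarrow> int \<Rightarrow> 'a set"
  where "ss_B K r s t =
    ss_Z K (int r - 1) (s + 1) (t - 2) +
    total_d K ` ss_Z K (int r - 1) (s - int r + 1) (t + 2 * int r - 3)"

definition ss_page ::
    "('k::comm_ring_1, 'a::ab_group_add) double_complex \<Rightarrow> nat \<Rightarrow> int \<Rightarrow> int \<Rightarrow> 'a set set"
  where "ss_page K r s t = (\<lambda>x. x +o ss_B K r s t) ` ss_Z K (int r) s t"

text \<open>
  Sums of cosets are sums of sets, and the zero element of \<open>ss_page K r s t\<close> is \<open>ss_B K r s t\<close>.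
  Adding the submodule \<open>ss_B\<close> to a set makes it a union of cosets; this turns the image of a
  coset under a scalar or under the total differential into a coset.
\<close>

definition ss_smult ::
    "('k::comm_ring_1, 'a::ab_group_add) double_complex \<Rightarrow> nat \<Rightarrow> int \<Rightarrow> int \<Rightarrow>
      'k \<Rightarrow> 'a set \<Rightarrow> 'a set"
  where "ss_smult K r s t a X = dc_smult K a ` X + ss_B K r s t"

definition ss_d ::
    "('k::comm_ring_1, 'a::ab_group_add) double_complex \<Rightarrow> nat \<Rightarrow> int \<Rightarrow> int \<Rightarrow>
      'a set \<Rightarrow> 'a set"
  where "ss_d K r s t X = total_d K ` X + ss_B K r (s + int r) (t - (2 * int r - 1))"

definition double_subcomplex ::
    "('k::comm_ring_1, 'a::ab_group_add) double_complex \<Rightarrow> ('k, 'a) double_complex \<Rightarrow> bool"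
  where "double_subcomplex K' K \<longleftrightarrow>
    dc_smult K' = dc_smult K \<and> dc_d0 K' = dc_d0 K \<and> dc_d1 K' = dc_d1 K \<and>
    (\<forall>s t. dc_part K' s t \<subseteq> dc_part K s t \<and> module.subspace (dc_smult K) (dc_part K' s t) \<and>
      dc_d0 K ` dc_part K' s t \<subseteq> dc_part K' s (t + 1) \<and>
      dc_d1 K ` dc_part K' s t \<subseteq> dc_part K' (s + 1) (t - 1))"

text \<open>
  The external direct sum of the pages of a family of double complexes, and, for a family of
  subcomplexes of \<open>K\<close>, the map from it to the page of \<open>K\<close> induced by the inclusions: it sends
  the family of the cosets of \<open>x \<alpha>\<close> to the coset of the sum of the \<open>x \<alpha>\<close>.
\<close>

definition ss_direct_sum ::
    "'i set \<Rightarrow> ('i \<Rightarrow> ('k::comm_ring_1, 'a::ab_group_add) double_complex) \<Rightarrow>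
      nat \<Rightarrow> int \<Rightarrow> int \<Rightarrow> ('i \<Rightarrow> 'a set) set"
  where "ss_direct_sum I K' r s t =
    {f \<in> (\<Pi>\<^sub>E \<alpha>\<in>I. ss_page (K' \<alpha>) r s t). finite {\<alpha> \<in> I. f \<alpha> \<noteq> ss_B (K' \<alpha>) r s t}}"

definition ss_sum_map ::
    "('k::comm_ring_1, 'a::ab_group_add) double_complex \<Rightarrow> 'i set \<Rightarrow>
      ('i \<Rightarrow> ('k, 'a) double_complex) \<Rightarrow> nat \<Rightarrow> int \<Rightarrow> int \<Rightarrow> ('i \<Rightarrow> 'a set) \<Rightarrow> 'a set"
  where "ss_sum_map K I K' r s t f =
    (\<Sum>\<alpha> \<in> {\<alpha> \<in> I. f \<alpha> \<noteq> ss_B (K' \<alpha>) r s t}. f \<alpha>) + ss_B K r s t"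

text \<open>
  The spectral sequence of \<open>K\<close> is the direct sum of those of the subcomplexes \<open>K' \<alpha>\<close>: on every
  page the inclusions induce an isomorphism of modules which is compatible with the differentials.
\<close>

definition ss_decomposition ::
    "('k::comm_ring_1, 'a::ab_group_add) double_complex \<Rightarrow> 'i set \<Rightarrow>
      ('i \<Rightarrow> ('k, 'a) double_complex) \<Rightarrow> bool"
  where "ss_decomposition K I K' \<longleftrightarrow>
    (\<forall>\<alpha>\<in>I. double_subcomplex (K' \<alpha>) K) \<and>
    (\<forall>r s t.
      bij_betw (ss_sum_map K I K' r s t) (ss_direct_sum I K' r s t) (ss_page K r s t) \<and>
      (\<forall>f \<in> ss_direct_sum I K' r s t. \<forall>g \<in> ss_direct_sum I K' r s t.
        ss_sum_map K I K' r s t (\<lambda>\<alpha>\<in>I. f \<alpha> + g \<alpha>) =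
        ss_sum_map K I K' r s t f + ss_sum_map K I K' r s t g) \<and>
      (\<forall>a. \<forall>f \<in> ss_direct_sum I K' r s t.
        ss_sum_map K I K' r s t (\<lambda>\<alpha>\<in>I. ss_smult (K' \<alpha>) r s t a (f \<alpha>)) =
        ss_smult K r s t a (ss_sum_map K I K' r s t f)) \<and>
      (\<forall>f \<in> ss_direct_sum I K' r s t.
        ss_sum_map K I K' r (s + int r) (t - (2 * int r - 1))
          (\<lambda>\<alpha>\<in>I. ss_d (K' \<alpha>) r s t (f \<alpha>)) =
        ss_d K r s t (ss_sum_map K I K' r s t f)))"


section \<open>The double complex of a Lie algebra with basis\<close>

text \<open>
  The pair \<open>(S, a)\<close> with \<open>S = {i\<^sub>1 < \<dots> < i\<^sub>q}\<close> stands for the monomial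
  \<open>x\<^sub>i\<^sub>1 \<dots> x\<^sub>i\<^sub>q \<otimes> \<Prod>\<^sub>i y\<^sub>i ^ a i\<close>.
\<close>

type_synonym monom = "nat set \<times> (nat \<Rightarrow>\<^sub>0 nat)"
type_synonym 'k ext_poly = "monom \<Rightarrow>\<^sub>0 'k"

definition ep_scale :: "'k::comm_ring_1 \<Rightarrow> 'k ext_poly \<Rightarrow> 'k ext_poly"
  where "ep_scale c p = Poly_Mapping.map ((*) c) p"

definition shuffle_sign :: "nat set \<Rightarrow> nat set \<Rightarrow> 'k::comm_ring_1"
  where "shuffle_sign S T = (-1) ^ card {(i, j). i \<in> S \<and> j \<in> T \<and> j < i}"

definition ep_mult :: "'k::comm_ring_1 ext_poly \<Rightarrow> 'k ext_poly \<Rightarrow> 'k ext_poly"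
    (infixl \<open>\<diamondop>\<close> 70)
  where "p \<diamondop> q = (\<Sum>(S, a) \<in> Poly_Mapping.keys p. \<Sum>(T, b) \<in> Poly_Mapping.keys q.
    if S \<inter> T = {}
    then Poly_Mapping.single (S \<union> T, a + b)
      (shuffle_sign S T * Poly_Mapping.lookup p (S, a) * Poly_Mapping.lookup q (T, b))
    else 0)"

definition ep_x :: "nat \<Rightarrow> 'k::comm_ring_1 ext_poly"
  where "ep_x i = Poly_Mapping.single ({i}, 0) 1"

definition ep_y :: "nat \<Rightarrow> 'k::comm_ring_1 ext_poly"
  where "ep_y i = Poly_Mapping.single ({}, Poly_Mapping.single i 1) 1"

definition mon_degree :: "(nat \<Rightarrow>\<^sub>0 nat) \<Rightarrow> nat"
  where "mon_degree a = (\<Sum>i \<in> Poly_Mapping.keys a. Poly_Mapping.lookup a i)"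

definition ep_part :: "nat \<Rightarrow> int \<Rightarrow> int \<Rightarrow> 'k::comm_ring_1 ext_poly set"
  where "ep_part m s t = {p. \<forall>(S, a) \<in> Poly_Mapping.keys p.
    S \<subseteq> {..<m} \<and> Poly_Mapping.keys a \<subseteq> {..<m} \<and> int (mon_degree a) = s \<and> int (card S) = t}"

text \<open>Partial derivatives with respect to the generators: \<open>\<partial>/\<partial>x i\<close> is an antiderivation.\<close>

definition ep_dx :: "nat \<Rightarrow> 'k::comm_ring_1 ext_poly \<Rightarrow> 'k ext_poly"
  where "ep_dx i p = (\<Sum>(S, a) \<in> Poly_Mapping.keys p.
    if i \<in> S
    then Poly_Mapping.single (S - {i}, a)
      ((-1) ^ card {j \<in> S. j < i} * Poly_Mapping.lookup p (S, a))
    else 0)"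

definition ep_dy :: "nat \<Rightarrow> 'k::comm_ring_1 ext_poly \<Rightarrow> 'k ext_poly"
  where "ep_dy i p = (\<Sum>(S, a) \<in> Poly_Mapping.keys p.
    Poly_Mapping.single (S, a - Poly_Mapping.single i 1)
      (of_nat (Poly_Mapping.lookup a i) * Poly_Mapping.lookup p (S, a)))"

text \<open>
  The derivation of odd total degree with value \<open>u i\<close> on \<open>x i\<close> and \<open>v i\<close> on \<open>y i\<close>;
  see \<open>lie_complex_generators\<close> and \<open>lie_complex_leibniz\<close> below.
\<close>

definition ep_deriv ::
    "nat \<Rightarrow> (nat \<Rightarrow> 'k::comm_ring_1 ext_poly) \<Rightarrow> (nat \<Rightarrow> 'k ext_poly) \<Rightarrow> 'k ext_poly \<Rightarrow> 'k ext_poly"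
  where "ep_deriv m u v p = (\<Sum>i<m. u i \<diamondop> ep_dx i p + v i \<diamondop> ep_dy i p)"

definition lie_complex ::
    "nat \<Rightarrow> (nat \<Rightarrow> nat \<Rightarrow> nat \<Rightarrow> 'k::comm_ring_1) \<Rightarrow> ('k, 'k ext_poly) double_complex"
  where "lie_complex m c = \<lparr>
    dc_smult = ep_scale,
    dc_part = ep_part m,
    dc_d0 = ep_deriv m
      (\<lambda>i. - (\<Sum>k<m. \<Sum>j<k. ep_scale (c j k i) (ep_x j \<diamondop> ep_x k)))
      (\<lambda>i. \<Sum>j<m. \<Sum>k<m. ep_scale (c j k i) (ep_y j \<diamondop> ep_x k)),
    dc_d1 = ep_deriv m ep_y (\<lambda>i. 0) \<rparr>"

lemma poly_mapping_expand: "p = (\<Sum>\<mu> \<in> Poly_Mapping.keys p. Poly_Mapping.single \<mu> (Poly_Mapping.lookup p \<mu>))"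
  by (rule poly_mapping_eqI)
    (auto simp: lookup_sum lookup_single when_def sum.delta' in_keys_iff)

lemma keys_sum_add:
  fixes F :: "'i \<Rightarrow> 'k::comm_ring_1 \<Rightarrow> 'b::comm_monoid_add"
  assumes F0: "\<And>\<mu>. F \<mu> 0 = 0" and FA: "\<And>\<mu> a b. F \<mu> (a + b) = F \<mu> a + F \<mu> b"
  shows "(\<Sum>\<mu> \<in> Poly_Mapping.keys (p + q). F \<mu> (Poly_Mapping.lookup (p + q) \<mu>)) =
    (\<Sum>\<mu> \<in> Poly_Mapping.keys p. F \<mu> (Poly_Mapping.lookup p \<mu>)) +
    (\<Sum>\<mu> \<in> Poly_Mapping.keys q. F \<mu> (Poly_Mapping.lookup q \<mu>))"
proof -
  let ?U = "Poly_Mapping.keys p \<union> Poly_Mapping.keys q"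
  have *: "(\<Sum>\<mu> \<in> Poly_Mapping.keys r. F \<mu> (Poly_Mapping.lookup r \<mu>)) =
      (\<Sum>\<mu> \<in> ?U. F \<mu> (Poly_Mapping.lookup r \<mu>))" if "Poly_Mapping.keys r \<subseteq> ?U" for r
    by (rule sum.mono_neutral_left) (use that in \<open>auto simp: in_keys_iff F0\<close>)
  show ?thesis
    using *[of "p + q"] *[of p] *[of q] Poly_Mapping.keys_add[of p q]
    by (simp add: lookup_add FA sum.distrib)
qed

lemma ep_mult_add_left: "(p + q) \<diamondop> r = p \<diamondop> r + q \<diamondop> r"
proof -
  have "ep_mult p r = (\<Sum>\<mu> \<in> Poly_Mapping.keys p. (\<lambda>\<mu> c. \<Sum>(T, b) \<in> Poly_Mapping.keys r.
    if fst \<mu> \<inter> T = {} then Poly_Mapping.single (fst \<mu> \<union> T, snd \<mu> + b)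
      (shuffle_sign (fst \<mu>) T * c * Poly_Mapping.lookup r (T, b)) else 0) \<mu> (Poly_Mapping.lookup p \<mu>))" for p
    by (simp add: ep_mult_def case_prod_beta cong: if_cong)
  then show ?thesis
    by (simp only:) (rule keys_sum_add;
      auto simp: sum.distrib[symmetric] distrib_left distrib_right single_add case_prod_beta intro!: sum.cong sum.neutral cong: if_cong)
qed

lemma ep_mult_add_right: "r \<diamondop> (p + q) = r \<diamondop> p + r \<diamondop> q"
proof -
  have "ep_mult r p = (\<Sum>\<mu> \<in> Poly_Mapping.keys p. (\<lambda>\<mu> c. \<Sum>(S, a) \<in> Poly_Mapping.keys r.
    if S \<inter> fst \<mu> = {} then Poly_Mapping.single (S \<union> fst \<mu>, a + snd \<mu>)
      (shuffle_sign S (fst \<mu>) * Poly_Mapping.lookup r (S, a) * c) else 0) \<mu> (Poly_Mapping.lookup p \<mu>))" for p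
    unfolding ep_mult_def case_prod_beta by (subst sum.swap) (simp cong: if_cong)
  then show ?thesis
    by (simp only:) (rule keys_sum_add;
      auto simp: sum.distrib[symmetric] distrib_left distrib_right single_add case_prod_beta intro!: sum.cong sum.neutral cong: if_cong)
qed

lemma ep_dx_add: "ep_dx i (p + q) = ep_dx i p + ep_dx i q"
proof -
  have "ep_dx i p = (\<Sum>\<mu> \<in> Poly_Mapping.keys p. (\<lambda>\<mu> c. 
    if i \<in> fst \<mu> then Poly_Mapping.single (fst \<mu> - {i}, snd \<mu>)
      ((-1) ^ card {j \<in> fst \<mu>. j < i} * c) else 0) \<mu> (Poly_Mapping.lookup p \<mu>))" for p :: "'a ext_poly"
    by (simp add: ep_dx_def case_prod_beta cong: if_cong)
  then show ?thesis
    by (simp only:) (rule keys_sum_add; auto simp: distrib_left single_add)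
qed

lemma ep_dy_add: "ep_dy i (p + q) = ep_dy i p + ep_dy i q"
proof -
  have "ep_dy i p = (\<Sum>\<mu> \<in> Poly_Mapping.keys p. (\<lambda>\<mu> c. 
    Poly_Mapping.single (fst \<mu>, snd \<mu> - Poly_Mapping.single i 1)
      (of_nat (Poly_Mapping.lookup (snd \<mu>) i) * c)) \<mu> (Poly_Mapping.lookup p \<mu>))" for p :: "'a ext_poly"
    by (simp add: ep_dy_def case_prod_beta cong: if_cong)
  then show ?thesis
    by (simp only:) (rule keys_sum_add; auto simp: distrib_left single_add)
qed

lemma ep_mult_zero [simp]: "p \<diamondop> 0 = 0" "0 \<diamondop> p = 0"
  by (simp_all add: ep_mult_def)

lemma ep_mult_single:
  "Poly_Mapping.single (S, a) c \<diamondop> Poly_Mapping.single (T, b) d =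
    (if S \<inter> T = {} then Poly_Mapping.single (S \<union> T, a + b) (shuffle_sign S T * c * d) else 0)"
  by (cases "c = 0"; cases "d = 0") (simp_all add: ep_mult_def)

lemma ep_dx_single:
  "ep_dx i (Poly_Mapping.single (S, a) c) = (if i \<in> S
    then Poly_Mapping.single (S - {i}, a) ((-1) ^ card {j \<in> S. j < i} * c) else 0)"
  by (cases "c = 0") (simp_all add: ep_dx_def)

lemma ep_dy_single:
  "ep_dy i (Poly_Mapping.single (S, a) c) =
    Poly_Mapping.single (S, a - Poly_Mapping.single i 1) (of_nat (Poly_Mapping.lookup a i) * c)"
  by (cases "c = 0") (simp_all add: ep_dy_def)

lemma ep_sum:
  "(\<Sum>i\<in>A. f i) \<diamondop> p = (\<Sum>i\<in>A. f i \<diamondop> p)"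
  "p \<diamondop> (\<Sum>i\<in>A. f i) = (\<Sum>i\<in>A. p \<diamondop> f i)"
  "ep_dx j (\<Sum>i\<in>A. f i) = (\<Sum>i\<in>A. ep_dx j (f i))"
  "ep_dy j (\<Sum>i\<in>A. f i) = (\<Sum>i\<in>A. ep_dy j (f i))"
proof -
  have d0: "ep_dx j 0 = 0" "ep_dy j 0 = 0" by (simp_all add: ep_dx_def ep_dy_def)
  show 
  "(\<Sum>i\<in>A. f i) \<diamondop> p = (\<Sum>i\<in>A. f i \<diamondop> p)"
  "p \<diamondop> (\<Sum>i\<in>A. f i) = (\<Sum>i\<in>A. p \<diamondop> f i)"
  "ep_dx j (\<Sum>i\<in>A. f i) = (\<Sum>i\<in>A. ep_dx j (f i))"
  "ep_dy j (\<Sum>i\<in>A. f i) = (\<Sum>i\<in>A. ep_dy j (f i))"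
    by (induction A rule: infinite_finite_induct; simp add: ep_mult_add_left ep_mult_add_right ep_dx_add ep_dy_add d0)+
qed

lemma shuffle_sign_Un:
  assumes "finite S" "finite T" "finite U" "S \<inter> T = {}"
  shows "shuffle_sign (S \<union> T) U = shuffle_sign S U * shuffle_sign T U"
    "shuffle_sign U (S \<union> T) = shuffle_sign U S * shuffle_sign U T"
proof -
  have fin: "finite {(i, j). i \<in> A \<and> j \<in> B \<and> j < i}" if "finite A" "finite B" for A B :: "nat set"
    by (rule finite_subset[of _ "A \<times> B"]) (use that in auto)
  have 1: "{(i, j). i \<in> S \<union> T \<and> j \<in> U \<and> j < i} =
    {(i, j). i \<in> S \<and> j \<in> U \<and> j < i} \<union> {(i, j). i \<in> T \<and> j \<in> U \<and> j < i}" by auto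
  have 2: "{(i, j). i \<in> U \<and> j \<in> S \<union> T \<and> j < i} =
    {(i, j). i \<in> U \<and> j \<in> S \<and> j < i} \<union> {(i, j). i \<in> U \<and> j \<in> T \<and> j < i}" by auto
  show "shuffle_sign (S \<union> T) U = shuffle_sign S U * shuffle_sign T U"
    unfolding shuffle_sign_def 1 power_add[symmetric]
    by (subst card_Un_disjoint) (use assms in \<open>auto intro: fin\<close>)
  show "shuffle_sign U (S \<union> T) = shuffle_sign U S * shuffle_sign U T"
    unfolding shuffle_sign_def 2 power_add[symmetric]
    by (subst card_Un_disjoint) (use assms in \<open>auto intro: fin\<close>)
qed

lemma shuffle_sign_swap:
  assumes "finite S" "finite T" "S \<inter> T = {}"
  shows "shuffle_sign S T = (-1) ^ (card S * card T) * shuffle_sign T S"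
proof -
  let ?A = "{(i, j). i \<in> S \<and> j \<in> T \<and> j < i}" and ?B = "{(i, j). i \<in> T \<and> j \<in> S \<and> j < i}"
  have "?A \<subseteq> S \<times> T" "?B \<subseteq> T \<times> S" by auto
  then have fin: "finite ?A" "finite ?B"
    using assms by (meson finite_SigmaI finite_subset)+
  have "S \<times> T = ?A \<union> prod.swap ` ?B"
    using assms by (auto simp: image_iff)
  then have "card S * card T = card (?A \<union> prod.swap ` ?B)"
    using card_cartesian_product[of S T] by simp
  also have "\<dots> = card ?A + card (prod.swap ` ?B)"
    by (rule card_Un_disjoint) (use fin in auto)
  also have "card (prod.swap ` ?B) = card ?B" by (rule card_image) auto
  finally have e: "card S * card T = card ?A + card ?B" .
  have "(-1) ^ card ?B * (-1) ^ card ?B = (1::'a)"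
    by (simp flip: power_add)
  then show ?thesis
    unfolding shuffle_sign_def e power_add mult.assoc by simp
qed

lemma shuffle_sign_remove:
  assumes "finite S" "finite T" 
  shows "i \<in> S \<Longrightarrow> shuffle_sign S T = (-1) ^ card {j \<in> T. j < i} * shuffle_sign (S - {i}) T"
    and "i \<in> T \<Longrightarrow> shuffle_sign S T = (-1) ^ card {j \<in> S. i < j} * shuffle_sign S (T - {i})"
proof -
  have l: "shuffle_sign {i} T = (-1) ^ card {j \<in> T. j < i}" for i and T :: "nat set"
  proof -
    have "{(i', j). i' \<in> {i} \<and> j \<in> T \<and> j < i'} = Pair i ` {j \<in> T. j < i}" by auto
    then show ?thesis by (simp add: shuffle_sign_def card_image inj_on_def)
  qed
  have r: "shuffle_sign S {i} = (-1) ^ card {j \<in> S. i < j}" for i and S :: "nat set"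
  proof -
    have "{(i', j). i' \<in> S \<and> j \<in> {i} \<and> j < i'} = (\<lambda>j. (j, i)) ` {j \<in> S. i < j}" by auto
    then show ?thesis by (simp add: shuffle_sign_def card_image inj_on_def)
  qed
  show "i \<in> S \<Longrightarrow> shuffle_sign S T = (-1) ^ card {j \<in> T. j < i} * shuffle_sign (S - {i}) T"
    using shuffle_sign_Un(1)[of "{i}" "S - {i}" T] assms by (simp add: l insert_absorb)
  show "i \<in> T \<Longrightarrow> shuffle_sign S T = (-1) ^ card {j \<in> S. i < j} * shuffle_sign S (T - {i})"
    using shuffle_sign_Un(2)[of "{i}" "T - {i}" S] assms by (simp add: r insert_absorb)
qed

abbreviation (input) "pm_single \<equiv> Poly_Mapping.single"

lemma ep_assoc_single:
  assumes "finite S" "finite T" "finite U"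
  shows "(pm_single (S, a) c \<diamondop> pm_single (T, b) d) \<diamondop> pm_single (U, a') c' = pm_single (S, a) c \<diamondop> (pm_single (T, b) d \<diamondop> pm_single (U, a') c')"
  using assms by (auto simp: ep_mult_single shuffle_sign_Un Int_Un_distrib Int_Un_distrib2 Un_assoc add.assoc mult_ac)

lemma ep_dx_leibniz_single:
  assumes "finite S" "finite T"
  shows "ep_dx i (pm_single (S, a) c \<diamondop> pm_single (T, b) d) =
    ep_dx i (pm_single (S, a) c) \<diamondop> pm_single (T, b) d +  pm_single (S, a) ((-1) ^ card S * c) \<diamondop> ep_dx i (pm_single (T, b) d)"
proof -
  have split: "card {j. (j \<in> S \<or> j \<in> T) \<and> j < i} = card {j \<in> S. j < i} + card {j \<in> T. j < i}" if "S \<inter> T = {}"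
  proof -
    have "{j. (j \<in> S \<or> j \<in> T) \<and> j < i} = {j \<in> S. j < i} \<union> {j \<in> T. j < i}" by auto
    then show ?thesis using assms that by (simp add: card_Un_disjoint disjoint_iff)
  qed
  have SS: "card S = card {j \<in> S. j < i} + card {j \<in> S. i < j} + (if i \<in> S then 1 else 0)"
  proof -
    have "S = {j \<in> S. j < i} \<union> {j \<in> S. i < j} \<union> (S \<inter> {i})" by auto
    then have "card S = card ({j \<in> S. j < i} \<union> {j \<in> S. i < j} \<union> (S \<inter> {i}))" by simp
    also have "\<dots> = card ({j \<in> S. j < i} \<union> {j \<in> S. i < j}) + card (S \<inter> {i})"
      by (rule card_Un_disjoint) (use assms in auto)
    also have "card ({j \<in> S. j < i} \<union> {j \<in> S. i < j}) = card {j \<in> S. j < i} + card {j \<in> S. i < j}"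
      by (rule card_Un_disjoint) (use assms in auto)
    finally show ?thesis by auto
  qed
  have sq: "(-1) ^ n * ((-1) ^ n * z) = (z::'a)" "(-1) ^ n * (-1) ^ n = (1::'a)" for n :: nat and z
    by (simp_all flip: power_add mult.assoc)
  consider "i \<notin> S" "i \<notin> T" | "i \<in> S" "i \<notin> T" | "i \<notin> S" "i \<in> T" | "i \<in> S" "i \<in> T" by blast
  then show ?thesis
  proof cases
    case 1
    then show ?thesis by (auto simp: ep_mult_single ep_dx_single)
         (simp add: ep_dx_def)
  next
    case 2
    show ?thesis
    proof (cases "S \<inter> T = {}")
      case True
      moreover have "(S - {i}) \<inter> T = {}" "S \<union> T - {i} = S - {i} \<union> T" using True 2 by auto
      ultimately show ?thesis using 2 
        shuffle_sign_remove(1)[OF assms 2(1), where 'a='a]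
        by (simp add: ep_mult_single ep_dx_single split power_add mult_ac sq)
    next
      case False
      moreover have "(S - {i}) \<inter> T \<noteq> {}" using False 2 by auto
      ultimately show ?thesis using 2 by (simp add: ep_mult_single ep_dx_single) (simp add: ep_dx_def)
    qed
  next
    case 3
    show ?thesis
    proof (cases "S \<inter> T = {}")
      case True
      moreover have "S \<inter> (T - {i}) = {}" "S \<union> T - {i} = S \<union> (T - {i})" using True 3 by auto
      ultimately show ?thesis using 3
        shuffle_sign_remove(2)[OF assms 3(2), where 'b='a]
        by (simp add: ep_mult_single ep_dx_single split power_add mult_ac sq SS)
    next
      case False
      moreover have "S \<inter> (T - {i}) \<noteq> {}" using False 3 by auto
      ultimately show ?thesis using 3 by (simp add: ep_mult_single ep_dx_single) (simp add: ep_dx_def)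
    qed
  next
    case 4
    then have ne: "S \<inter> T \<noteq> {}" by auto
    have L: "ep_dx i (pm_single (S, a) c \<diamondop> pm_single (T, b) d) = 0" using ne by (simp add: ep_mult_single ep_dx_def)
    show ?thesis
    proof (cases "S \<inter> T = {i}")
      case True
      then have *: "(S - {i}) \<inter> T = {}" "S \<inter> (T - {i}) = {}" "S - {i} \<union> T = S \<union> T" "S \<union> (T - {i}) = S \<union> T"
        using 4 by auto
      have s1: "shuffle_sign (S - {i}) T = (-1) ^ card {j \<in> S - {i}. i < j} * (shuffle_sign (S - {i}) (T - {i}) :: 'a)"
        using shuffle_sign_remove(2)[of "S - {i}" T i] assms 4 by simp
      have s2: "shuffle_sign S (T - {i}) = (-1) ^ card {j \<in> T - {i}. j < i} * (shuffle_sign (S - {i}) (T - {i}) :: 'a)"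
        using shuffle_sign_remove(1)[of S "T - {i}" i] assms 4 by simp
      have e: "{j \<in> S - {i}. i < j} = {j \<in> S. i < j}" "{j \<in> T - {i}. j < i} = {j \<in> T. j < i}"
        "{j \<in> S. j \<noteq> i \<and> i < j} = {j \<in> S. i < j}" "{j \<in> T. j \<noteq> i \<and> j < i} = {j \<in> T. j < i}" by auto
      show ?thesis unfolding L using 4 SS
        by (simp add: ep_mult_single ep_dx_single * s1 s2 e power_add mult_ac sq flip: single_add)
    next
      case False
      then have "(S - {i}) \<inter> T \<noteq> {}" "S \<inter> (T - {i}) \<noteq> {}" using 4 by auto
      then show ?thesis unfolding L using 4 by (simp add: ep_mult_single ep_dx_single)
    qed
  qed
qed

lemma ep_dy_leibniz_single:
  "ep_dy i (pm_single (S, a) c \<diamondop> pm_single (T, b) d) =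
    ep_dy i (pm_single (S, a) c) \<diamondop> pm_single (T, b) d +  pm_single (S, a) c \<diamondop> ep_dy i (pm_single (T, b) d)"
proof (cases "S \<inter> T = {}")
  case True
  have 1: "a - pm_single i 1 + b = a + b - pm_single i 1" if "Poly_Mapping.lookup a i \<noteq> 0" for a b :: "nat \<Rightarrow>\<^sub>0 nat"
    by (rule poly_mapping_eqI) (use that in \<open>auto simp: lookup_add lookup_minus lookup_single when_def\<close>)
  have 2: "b + (a - pm_single i 1) = a + b - pm_single i 1" if "Poly_Mapping.lookup a i \<noteq> 0" for a b :: "nat \<Rightarrow>\<^sub>0 nat"
    using 1[OF that] by (simp add: add.commute)
  show ?thesis
    using True 1[of a b] 2[of b a]
    by (cases "Poly_Mapping.lookup a i = 0"; cases "Poly_Mapping.lookup b i = 0")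
      (simp_all add: ep_mult_single ep_dy_single lookup_add add.commute algebra_simps flip: single_add)
next
  case False
  then show ?thesis by (simp add: ep_mult_single ep_dy_single) (simp add: ep_dy_def)
qed


lemma ep_assoc:
  assumes "\<forall>(S, a) \<in> Poly_Mapping.keys u. finite S" "finite T" "finite U"
  shows "(u \<diamondop> pm_single (T, b) d) \<diamondop> pm_single (U, a') c' = u \<diamondop> (pm_single (T, b) d \<diamondop> pm_single (U, a') c')"
  apply (subst (1 2) poly_mapping_expand[of u])
  using assms by (auto simp: ep_sum ep_assoc_single intro!: sum.cong)

lemma ep_left_comm_single:
  assumes "finite S" "finite T" "finite U"
  shows "pm_single (S, a) c \<diamondop> (pm_single (T, b) d \<diamondop> pm_single (U, a') c') =
    pm_single (T, b) ((-1) ^ (card S * card T) * d) \<diamondop> (pm_single (S, a) c \<diamondop> pm_single (U, a') c')"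
  using assms shuffle_sign_swap[of S T, where 'a='a]
  by (auto simp: ep_mult_single shuffle_sign_Un Int_Un_distrib Int_Un_distrib2 Un_left_commute add.left_commute mult_ac)

lemma ep_left_comm_even:
  assumes "\<forall>(S, a) \<in> Poly_Mapping.keys u. finite S \<and> even (card S)" "finite T" "finite U"
  shows "u \<diamondop> (pm_single (T, b) d \<diamondop> pm_single (U, a') c') = pm_single (T, b) d \<diamondop> (u \<diamondop> pm_single (U, a') c')"
  apply (subst (1 2) poly_mapping_expand[of u])
  unfolding ep_sum
  apply (rule sum.cong, rule refl)
  subgoal for \<mu>
    using assms ep_left_comm_single[of "fst \<mu>" T U "snd \<mu>"] by (auto simp: case_prod_beta)
  done

lemma ep_left_comm_odd:
  assumes "\<forall>(S, a) \<in> Poly_Mapping.keys u. finite S \<and> odd (card S)" "finite T" "finite U"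
  shows "u \<diamondop> (pm_single (T, b) d \<diamondop> pm_single (U, a') c') = pm_single (T, b) ((-1) ^ card T * d) \<diamondop> (u \<diamondop> pm_single (U, a') c')"
  apply (subst (1 2) poly_mapping_expand[of u])
  unfolding ep_sum
  apply (rule sum.cong, rule refl)
  subgoal for \<mu>
    using assms ep_left_comm_single[of "fst \<mu>" T U "snd \<mu>"] by (auto simp: case_prod_beta power_mult)
  done

lemma ep_deriv_leibniz_single:
  assumes u: "\<And>i. i < m \<Longrightarrow> \<forall>(S, a) \<in> Poly_Mapping.keys (u i). finite S \<and> even (card S)"
    and v: "\<And>i. i < m \<Longrightarrow> \<forall>(S, a) \<in> Poly_Mapping.keys (v i). finite S \<and> odd (card S)"
    and fin: "finite S" "finite T"
  shows "ep_deriv m u v (pm_single (S, a) c \<diamondop> pm_single (T, b) d) =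
    ep_deriv m u v (pm_single (S, a) c) \<diamondop> pm_single (T, b) d +
    pm_single (S, a) ((-1) ^ card S * c) \<diamondop> ep_deriv m u v (pm_single (T, b) d)"
proof -
  have 1: "u i \<diamondop> ep_dx i (pm_single (S, a) c \<diamondop> pm_single (T, b) d) = (u i \<diamondop> ep_dx i (pm_single (S, a) c)) \<diamondop> pm_single (T, b) d
    + pm_single (S, a) ((-1) ^ card S * c) \<diamondop> (u i \<diamondop> ep_dx i (pm_single (T, b) d))" if "i < m" for i
  proof -
    have f: "\<forall>(S, a) \<in> Poly_Mapping.keys (u i). finite S" using u[OF that] by auto
    show ?thesis
      unfolding ep_dx_leibniz_single[OF fin] ep_mult_add_right
      using ep_assoc[OF f] ep_left_comm_even[OF u[OF that]] fin by (auto simp: ep_dx_single)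
  qed
  have 2: "v i \<diamondop> ep_dy i (pm_single (S, a) c \<diamondop> pm_single (T, b) d) = (v i \<diamondop> ep_dy i (pm_single (S, a) c)) \<diamondop> pm_single (T, b) d
    + pm_single (S, a) ((-1) ^ card S * c) \<diamondop> (v i \<diamondop> ep_dy i (pm_single (T, b) d))" if "i < m" for i
  proof -
    have f: "\<forall>(S, a) \<in> Poly_Mapping.keys (v i). finite S" using v[OF that] by auto
    show ?thesis
      unfolding ep_dy_leibniz_single ep_mult_add_right
      using ep_assoc[OF f] ep_left_comm_odd[OF v[OF that]] fin by (auto simp: ep_dy_single)
  qed
  show ?thesis
    by (simp add: ep_deriv_def ep_sum ep_mult_add_left ep_mult_add_right 1 2 sum.distrib)
qed

lemma ep_deriv_sum: "ep_deriv m u v (\<Sum>i\<in>A. f i) = (\<Sum>i\<in>A. ep_deriv m u v (f i))"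
  unfolding ep_deriv_def ep_sum sum.distrib[symmetric] by (rule sum.swap)

lemma ep_scale_single: "ep_scale c (pm_single \<mu> d) = pm_single \<mu> (c * d)"
  by (rule poly_mapping_eqI) (simp add: ep_scale_def Poly_Mapping.map.rep_eq lookup_single when_def)

lemma lookup_ep_scale: "Poly_Mapping.lookup (ep_scale c p) \<mu> = c * Poly_Mapping.lookup p \<mu>"
  by (simp add: ep_scale_def Poly_Mapping.map.rep_eq when_def)

lemma ep_scale_add: "ep_scale c (p + q) = ep_scale c p + ep_scale c q"
  by (rule poly_mapping_eqI) (simp add: lookup_ep_scale lookup_add distrib_left)

lemma ep_scale_sum: "ep_scale c (\<Sum>i\<in>A. f i) = (\<Sum>i\<in>A. ep_scale c (f i))"
  by (rule poly_mapping_eqI) (simp add: lookup_ep_scale lookup_sum sum_distrib_left)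

lemma ep_deriv_leibniz:
  assumes u: "\<And>i. i < m \<Longrightarrow> \<exists>s t. u i \<in> ep_part m s t \<and> even (2 * s + t)"
    and v: "\<And>i. i < m \<Longrightarrow> \<exists>s t. v i \<in> ep_part m s t \<and> odd (2 * s + t)"
    and p: "p \<in> ep_part m s t" and q: "q \<in> ep_part m s' t'"
  shows "ep_deriv m u v (p \<diamondop> q) =
    ep_deriv m u v p \<diamondop> q + ep_scale ((-1) ^ nat (2 * s + t)) p \<diamondop> ep_deriv m u v q"
proof -
  have u': "\<forall>(S, a) \<in> Poly_Mapping.keys (u i). finite S \<and> even (card S)" if im: "i < m" for i
  proof -
    obtain s t where "u i \<in> ep_part m s t" "even (2 * s + t)" using u[OF im] by blast
    then show ?thesis
      by (auto simp: ep_part_def dest!: bspec intro: finite_subset[of _ "{..<m}"])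
  qed
  have v': "\<forall>(S, a) \<in> Poly_Mapping.keys (v i). finite S \<and> odd (card S)" if im: "i < m" for i
  proof -
    obtain s t where "v i \<in> ep_part m s t" "odd (2 * s + t)" using v[OF im] by blast
    then show ?thesis
      by (auto simp: ep_part_def dest!: bspec intro: finite_subset[of _ "{..<m}"])
  qed
  let ?p = "Poly_Mapping.lookup p" and ?q = "Poly_Mapping.lookup q"
  let ?D = "ep_deriv m u v"
  have *: "?D (pm_single \<mu> (?p \<mu>) \<diamondop> pm_single \<nu> (?q \<nu>)) = ?D (pm_single \<mu> (?p \<mu>)) \<diamondop> pm_single \<nu> (?q \<nu>) +
      ep_scale ((-1) ^ nat (2 * s + t)) (pm_single \<mu> (?p \<mu>)) \<diamondop> ?D (pm_single \<nu> (?q \<nu>))"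
    if "\<mu> \<in> Poly_Mapping.keys p" "\<nu> \<in> Poly_Mapping.keys q" for \<mu> \<nu>
  proof -
    obtain S a T b where [simp]: "\<mu> = (S, a)" "\<nu> = (T, b)" by (cases \<mu>, cases \<nu>)
    have S: "finite S" "int (mon_degree a) = s" "int (card S) = t"
      using p that by (auto simp: ep_part_def dest!: bspec intro: finite_subset[of _ "{..<m}"])
    have T: "finite T"
      using q that by (auto simp: ep_part_def dest!: bspec intro: finite_subset[of _ "{..<m}"])
    have "nat (2 * s + t) = 2 * mon_degree a + card S" using S by simp
    then have e: "(-1) ^ nat (2 * s + t) = ((-1) ^ card S :: 'a)" by (simp add: power_add)
    show ?thesis
      using ep_deriv_leibniz_single[OF u' v' S(1) T] by (simp add: ep_scale_single e)
  qed
  have "?D ((\<Sum>\<mu> \<in> Poly_Mapping.keys p. pm_single \<mu> (?p \<mu>)) \<diamondop> (\<Sum>\<nu> \<in> Poly_Mapping.keys q. pm_single \<nu> (?q \<nu>))) =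
    ?D (\<Sum>\<mu> \<in> Poly_Mapping.keys p. pm_single \<mu> (?p \<mu>)) \<diamondop> (\<Sum>\<nu> \<in> Poly_Mapping.keys q. pm_single \<nu> (?q \<nu>)) +
    ep_scale ((-1) ^ nat (2 * s + t)) (\<Sum>\<mu> \<in> Poly_Mapping.keys p. pm_single \<mu> (?p \<mu>)) \<diamondop>
      ?D (\<Sum>\<nu> \<in> Poly_Mapping.keys q. pm_single \<nu> (?q \<nu>))"
    unfolding ep_sum(1) ep_deriv_sum ep_scale_sum sum.distrib[symmetric]
    apply (rule sum.cong, rule refl)
    unfolding ep_sum(2) ep_deriv_sum sum.distrib[symmetric]
    by (rule sum.cong, rule refl) (rule *)
  then show ?thesis
    by (simp flip: poly_mapping_expand)
qed

lemma ep_mult_one: "p \<diamondop> pm_single ({}, 0) 1 = p"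
proof -
  have "p \<diamondop> pm_single ({}, 0) 1 = (\<Sum>(S, a) \<in> Poly_Mapping.keys p. pm_single (S, a) (Poly_Mapping.lookup p (S, a)))"
    by (subst poly_mapping_expand[of p]) (simp add: ep_sum ep_mult_single shuffle_sign_def case_prod_beta
       ep_mult_single[of "fst x" "snd x" for x, simplified])
  also have "\<dots> = p" by (simp add: case_prod_beta flip: poly_mapping_expand)
  finally show ?thesis .
qed

lemma ep_deriv_x: "i < m \<Longrightarrow> ep_deriv m u v (ep_x i) = u i"
proof -
  have 1: "ep_dx j (ep_x i) = (if j = i then pm_single ({}, 0) 1 else 0)" for j
  proof -
    have [simp]: "{j. j = i \<and> j < i} = {}" by auto
    show ?thesis by (auto simp: ep_x_def ep_dx_single)
  qed
  have 2: "ep_dy j (ep_x i) = 0" for j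
    by (simp add: ep_x_def ep_dy_single)
  show "i < m \<Longrightarrow> ep_deriv m u v (ep_x i) = u i"
    by (simp add: ep_deriv_def 1 2 if_distrib[of "\<lambda>x. _ \<diamondop> x"] sum.delta ep_mult_one cong: if_cong)
qed

lemma ep_deriv_y: "i < m \<Longrightarrow> ep_deriv m u v (ep_y i) = v i"
proof -
  have 1: "ep_dy j (ep_y i) = (if j = i then pm_single ({}, 0) 1 else 0)" for j
    by (auto simp: ep_y_def ep_dy_single lookup_single when_def)
  have 2: "ep_dx j (ep_y i) = 0" for j
    by (simp add: ep_y_def ep_dx_single)
  show "i < m \<Longrightarrow> ep_deriv m u v (ep_y i) = v i"
    by (simp add: ep_deriv_def 1 2 if_distrib[of "\<lambda>x. _ \<diamondop> x"] sum.delta ep_mult_one cong: if_cong)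
qed

lemma ep_part_keys: "ep_part m s t = {p. Poly_Mapping.keys p \<subseteq>
    {\<mu>. case \<mu> of (S, a) \<Rightarrow> S \<subseteq> {..<m} \<and> Poly_Mapping.keys a \<subseteq> {..<m} \<and>
      int (mon_degree a) = s \<and> int (card S) = t}}"
  unfolding ep_part_def by (simp only: subset_eq mem_Collect_eq)

lemma ep_part_add: "p \<in> ep_part m s t \<Longrightarrow> q \<in> ep_part m s t \<Longrightarrow> p + q \<in> ep_part m s t"
  unfolding ep_part_keys mem_Collect_eq
  using Poly_Mapping.keys_add[of p q] by (meson Un_least order_trans)

lemma ep_part_zero: "0 \<in> ep_part m s t"
  by (simp add: ep_part_def)

lemma ep_part_uminus: "p \<in> ep_part m s t \<Longrightarrow> - p \<in> ep_part m s t"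
proof -
  assume p: "p \<in> ep_part m s t"
  have "Poly_Mapping.keys (- p) = Poly_Mapping.keys p"
    by (auto simp: in_keys_iff uminus_poly_mapping.rep_eq)
  with p show ?thesis by (simp only: ep_part_keys mem_Collect_eq)
qed

lemma ep_part_sum: "(\<And>i. i \<in> A \<Longrightarrow> f i \<in> ep_part m s t) \<Longrightarrow> (\<Sum>i\<in>A. f i) \<in> ep_part m s t"
  by (induction A rule: infinite_finite_induct) (auto simp: ep_part_zero ep_part_add)

lemma ep_part_scale: "p \<in> ep_part m s t \<Longrightarrow> ep_scale c p \<in> ep_part m s t"
proof -
  assume p: "p \<in> ep_part m s t"
  have "Poly_Mapping.keys (ep_scale c p) \<subseteq> Poly_Mapping.keys p"
    by (auto simp: in_keys_iff lookup_ep_scale)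
  with p show ?thesis unfolding ep_part_keys mem_Collect_eq by (meson order_trans)
qed

lemma ep_part_gen:
  "i < m \<Longrightarrow> ep_y i \<in> ep_part m 1 0"
  "i < m \<Longrightarrow> j < m \<Longrightarrow> ep_x i \<diamondop> ep_x j \<in> ep_part m 0 2"
  "i < m \<Longrightarrow> j < m \<Longrightarrow> ep_y i \<diamondop> ep_x j \<in> ep_part m 1 1"
  by (auto simp: ep_part_def ep_y_def ep_x_def ep_mult_single mon_degree_def split: if_splits)

lemma lie_complex_leibniz:
  fixes c :: "nat \<Rightarrow> nat \<Rightarrow> nat \<Rightarrow> 'k::comm_ring_1" and m :: nat
  defines "E \<equiv> lie_complex m c"
  assumes "p \<in> ep_part m s t" and "q \<in> ep_part m s' t'"
  shows "dc_d0 E (p \<diamondop> q) = dc_d0 E p \<diamondop> q + ep_scale ((-1) ^ nat (2 * s + t)) p \<diamondop> dc_d0 E q"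
    and "dc_d1 E (p \<diamondop> q) = dc_d1 E p \<diamondop> q + ep_scale ((-1) ^ nat (2 * s + t)) p \<diamondop> dc_d1 E q"
proof -
  have u: "\<exists>s t. - (\<Sum>k<m. \<Sum>j<k. ep_scale (c j k i) (ep_x j \<diamondop> ep_x k)) \<in> ep_part m s t \<and> even (2 * s + t)" for i
    by (rule exI[of _ 0], rule exI[of _ 2])
      (auto intro!: ep_part_uminus ep_part_sum ep_part_scale ep_part_gen)
  have v: "\<exists>s t. (\<Sum>j<m. \<Sum>k<m. ep_scale (c j k i) (ep_y j \<diamondop> ep_x k)) \<in> ep_part m s t \<and> odd (2 * s + t)" for i
    by (rule exI[of _ 1], rule exI[of _ 1])
      (auto intro!: ep_part_sum ep_part_scale ep_part_gen)
  have y: "\<exists>s t. ep_y i \<in> ep_part m s t \<and> even (2 * s + t)" if "i < m" for i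
    by (rule exI[of _ 1], rule exI[of _ 0]) (auto intro!: ep_part_gen that)
  have z: "\<exists>s t. 0 \<in> ep_part m s t \<and> odd (2 * s + t)"
    by (rule exI[of _ 1], rule exI[of _ 1]) (auto intro!: ep_part_zero)
  show "dc_d0 E (p \<diamondop> q) = dc_d0 E p \<diamondop> q + ep_scale ((-1) ^ nat (2 * s + t)) p \<diamondop> dc_d0 E q"
    unfolding E_def lie_complex_def double_complex.simps
    by (rule ep_deriv_leibniz[OF u v assms(2,3)])
  show "dc_d1 E (p \<diamondop> q) = dc_d1 E p \<diamondop> q + ep_scale ((-1) ^ nat (2 * s + t)) p \<diamondop> dc_d1 E q"
    unfolding E_def lie_complex_def double_complex.simps
    by (rule ep_deriv_leibniz[OF y z assms(2,3)])
qed

lemma lie_complex_generators: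
  assumes "i < m"
  shows "dc_d0 (lie_complex m c) (ep_x i) = - (\<Sum>k<m. \<Sum>j<k. ep_scale (c j k i) (ep_x j \<diamondop> ep_x k))"
    and "dc_d0 (lie_complex m c) (ep_y i) = (\<Sum>j<m. \<Sum>k<m. ep_scale (c j k i) (ep_y j \<diamondop> ep_x k))"
    and "dc_d1 (lie_complex m c) (ep_x i) = ep_y i"
    and "dc_d1 (lie_complex m c) (ep_y i) = 0"
  using assms by (simp_all add: lie_complex_def ep_deriv_x ep_deriv_y)

lemma module_ep_scale: "module ep_scale"
  by unfold_locales
    (auto intro!: poly_mapping_eqI simp: lookup_ep_scale lookup_add algebra_simps)

text \<open>\<open>x i\<close> and \<open>y i\<close> have weight \<open>- w i\<close>.\<close>

definition mon_weight :: "(nat \<Rightarrow> 'g \<Rightarrow> complex) \<Rightarrow> monom \<Rightarrow> 'g \<Rightarrow> complex"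
  where "mon_weight w = (\<lambda>(S, a).
    (\<Sum>i\<in>S. - w i) + (\<Sum>i \<in> Poly_Mapping.keys a. fun_scale (of_nat (Poly_Mapping.lookup a i)) (- w i)))"

definition weight_part ::
    "(nat \<Rightarrow> 'g \<Rightarrow> complex) \<Rightarrow> ('k::comm_ring_1, 'k ext_poly) double_complex \<Rightarrow>
      ('g \<Rightarrow> complex) \<Rightarrow> ('k, 'k ext_poly) double_complex"
  where "weight_part w K \<alpha> = K\<lparr> dc_part :=
    (\<lambda>s t. {p \<in> dc_part K s t. \<forall>\<mu> \<in> Poly_Mapping.keys p. mon_weight w \<mu> = \<alpha>}) \<rparr>"

text \<open>All the integers \<open>\<alpha>(h\<^sub>1), \<dots>, \<alpha>(h\<^sub>n)\<close> are divisible by \<open>p\<close>.\<close>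

definition zero_mod ::
    "nat \<Rightarrow> 'g set \<Rightarrow> nat \<Rightarrow> (nat \<Rightarrow> 'g) \<Rightarrow> ('g \<Rightarrow> complex) \<Rightarrow> bool"
  where "zero_mod p H m e \<alpha> \<longleftrightarrow>
    (\<forall>i<m. e i \<in> H \<longrightarrow> (\<exists>z::int. \<alpha> (e i) = of_int z \<and> int p dvd z))"

end

theory Submission
  imports Defs
begin

text \<open>
  The weights enter through one fact about the integral structure constants: if \<open>e k\<close> occurs in
  \<open>[e i, e j]\<close>, then \<open>w k = w i + w j\<close> (\<open>integral_structure_constants\<close>).  Hence both differentials preserve
  the weights of monomials, the double complex is the direct sum of its parts of fixed weight, and
  the projections to these parts are morphisms of filtered complexes.  The cycles and boundaries that
  define the pages then decompose as well, and the pages are the direct sums of the pages of the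
  parts (\<open>graded_filtered_complex.decomposition\<close>).  That the pages carry differentials at all rests on
  \<open>d\<^sup>2 = 0\<close> for the total differential, which holds because \<open>d\<^sup>2\<close> is a derivation that vanishes on the
  generators, by the Jacobi identity (\<open>d_d_zero\<close>).

  The vanishing statements come from Cartan's formula.  For a basis vector \<open>h\<close> in \<open>H\<close>, the contraction
  with \<open>h\<close> preserves the filtration, and its anticommutator with the total differential is the Lie
  derivative along \<open>h\<close>, which multiplies an element of weight \<open>\<alpha>\<close> by the integer \<open>\<alpha> h\<close>.  If this integer
  is invertible in \<open>k\<close>, the contraction is a contracting homotopy up to a unit and all pages from \<open>E\<^sub>1\<close> on
  vanish in weight \<open>\<alpha>\<close>, on all lines (\<open>page_piece_zero\<close>).  Over a field, an integer is invertible unless the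
  characteristic divides it.  A nonzero \<open>\<alpha>\<close> has a nonzero value at some \<open>h\<close>, which settles
  characteristic zero; a weight that is not zero modulo \<open>p\<close> has a value not divisible by \<open>p\<close>, which settles
  characteristic \<open>p\<close>.

  The rank of the root lattice rests on semisimplicity in the following way.  The elements of \<open>H\<close> at which all
  roots vanish form a solvable ideal, because the algebra is spanned by \<open>H\<close> and root vectors and \<open>H\<close> is
  nilpotent; by semisimplicity this ideal is zero (\<open>root_kernel_zero\<close>).  So \<open>H\<close> is abelian, and no element of
  \<open>H\<close> other than zero is annihilated by all roots.  The root lattice embeds into \<open>\<int>\<^sup>n\<close> by its values at the
  basis of \<open>H\<close>, therefore has a basis of at most \<open>n\<close> elements, and cannot have fewer
  (\<open>root_lattice_free\<close>).
\<close>

section \<open>Cosets of submodules\<close>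

text \<open>
  Cosets are written as sums of a singleton and a set, because sums of sets form a commutative
  monoid and can be rearranged freely.
\<close>

lemma elt_set_plus_conv: "x +o S = {x} + S"
  by (auto simp: elt_set_plus_def set_plus_def)

context module
begin

lemma coset_eq_iff:
  assumes "subspace B"
  shows "x +o B = y +o B \<longleftrightarrow> x - y \<in> B"
proof
  assume eq: "x +o B = y +o B"
  have "x \<in> x +o B" using subspace_0[OF assms] by (auto simp: elt_set_plus_def intro!: bexI[of _ 0])
  then obtain b where "b \<in> B" "x = y + b" unfolding eq by (auto simp: elt_set_plus_def)
  then show "x - y \<in> B" by simp
next
  assume d: "x - y \<in> B"
  have "u \<in> y +o B" if u: "u \<in> x +o B" for u
  proof -
    obtain b where "b \<in> B" "u = x + b" using u by (auto simp: elt_set_plus_def)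
    then show ?thesis using subspace_add[OF assms d, of b]
      by (auto simp: elt_set_plus_def intro!: bexI[of _ "x - y + b"])
  qed
  moreover have "u \<in> x +o B" if u: "u \<in> y +o B" for u
  proof -
    obtain b where "b \<in> B" "u = y + b" using u by (auto simp: elt_set_plus_def)
    then show ?thesis using subspace_diff[OF assms _ d, of b]
      by (auto simp: elt_set_plus_def intro!: bexI[of _ "b - (x - y)"])
  qed
  ultimately show "x +o B = y +o B" by blast
qed

lemma coset_eq_self_iff: "subspace B \<Longrightarrow> x +o B = B \<longleftrightarrow> x \<in> B"
  using coset_eq_iff[of B x 0] by simp

lemma subspace_plus_absorb:
  assumes "subspace B" "C \<subseteq> B" "0 \<in> C"
  shows "C + B = B"
proof
  show "C + B \<subseteq> B" using assms by (auto simp: set_plus_def intro: subspace_add)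
  show "B \<subseteq> C + B" using set_plus_intro[OF assms(3)] by fastforce
qed

lemma coset_plus_absorb:
  assumes "subspace B" "C \<subseteq> B" "0 \<in> C"
  shows "(x +o C) + B = x +o B"
  using subspace_plus_absorb[OF assms] by (simp only: elt_set_plus_conv add.assoc)

text \<open>
  The cosets may be taken modulo different submodules \<open>C \<alpha>\<close>: adding \<open>B\<close> at the end coarsens all
  of them to cosets of \<open>B\<close>.  This computes the comparison map from the direct sum of the pages of
  subcomplexes to the page of the whole complex.
\<close>

lemma sum_cosets_plus_absorb:
  assumes "finite A" "subspace B" "\<And>\<alpha>. \<alpha> \<in> A \<Longrightarrow> C \<alpha> \<subseteq> B \<and> 0 \<in> C \<alpha>"
  shows "(\<Sum>\<alpha>\<in>A. x \<alpha> +o C \<alpha>) + B = (\<Sum>\<alpha>\<in>A. x \<alpha>) +o B"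
  using assms(1,3)
proof (induction A rule: finite_induct)
  case empty
  show ?case by (simp add: set_zero)
next
  case (insert \<alpha> A)
  have "(\<Sum>\<beta>\<in>insert \<alpha> A. x \<beta> +o C \<beta>) + B = (x \<alpha> +o C \<alpha>) + ((\<Sum>\<beta>\<in>A. x \<beta> +o C \<beta>) + B)"
    using insert by (simp add: add.assoc)
  also have "(\<Sum>\<beta>\<in>A. x \<beta> +o C \<beta>) + B = (\<Sum>\<beta>\<in>A. x \<beta>) +o B"
    using insert by simp
  also have "(x \<alpha> +o C \<alpha>) + ((\<Sum>\<beta>\<in>A. x \<beta>) +o B) = {x \<alpha>} + {\<Sum>\<beta>\<in>A. x \<beta>} + (C \<alpha> + B)"
    by (simp only: elt_set_plus_conv add.assoc add.left_commute)
  also have "{x \<alpha>} + {\<Sum>\<beta>\<in>A. x \<beta>} = {\<Sum>\<beta>\<in>insert \<alpha> A. x \<beta>}"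
    using insert by (simp add: set_plus_def)
  also have "C \<alpha> + B = B" using insert by (intro subspace_plus_absorb assms(2)) auto
  also have "{\<Sum>\<beta>\<in>insert \<alpha> A. x \<beta>} + B = (\<Sum>\<beta>\<in>insert \<alpha> A. x \<beta>) +o B"
    by (rule elt_set_plus_conv[symmetric])
  finally show ?case .
qed

text \<open>
  An additive map that sends \<open>C\<close> into \<open>B\<close> induces a map on cosets.  Scalar multiplication and the
  differential on a page are defined by the left-hand side.
\<close>

lemma image_coset_plus_absorb:
  assumes "\<And>x y. f (x + y) = f x + f y" "f 0 = 0" "subspace B" "0 \<in> C" "f ` C \<subseteq> B"
  shows "f ` (x +o C) + B = f x +o B"
proof -
  have "f ` (x +o C) = f x +o f ` C"
    unfolding elt_set_plus_def
  proof (intro equalityI subsetI)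
    fix z assume "z \<in> f ` {c. \<exists>b\<in>C. c = x + b}"
    then show "z \<in> {c. \<exists>b\<in>f ` C. c = f x + b}" by (auto simp: assms(1))
  next
    fix z assume "z \<in> {c. \<exists>b\<in>f ` C. c = f x + b}"
    then obtain b where "b \<in> C" "z = f (x + b)" by (auto simp: assms(1))
    then show "z \<in> f ` {c. \<exists>b\<in>C. c = x + b}" by blast
  qed
  moreover have "0 \<in> f ` C" using assms(2,4) by force
  ultimately show ?thesis
    using coset_plus_absorb[OF assms(3,5)] by simp
qed

end

section \<open>Pages of a filtered complex\<close>

text \<open>
  What the pages need from a double complex.  The differential squares to zero on the filtration only,
  since the complex of a Lie algebra is a proper submodule of the type on which its differential is
  defined.
\<close>

locale filtered_complex =
  fixes K :: "('k::comm_ring_1, 'a::ab_group_add) double_complex"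
  assumes smult_module: "module (dc_smult K)"
    and d_add: "total_d K (x + y) = total_d K x + total_d K y"
    and d_smult: "total_d K (dc_smult K a x) = dc_smult K a (total_d K x)"
    and d_filt: "x \<in> filt K s n \<Longrightarrow> total_d K x \<in> filt K s (n + 1)"
    and d_d: "x \<in> filt K s n \<Longrightarrow> total_d K (total_d K x) = 0"
begin

sublocale module "dc_smult K"
  by (rule smult_module)

lemma filt_subspace: "subspace (filt K s n)"
  by (simp add: filt_def)

lemma filt_antimono: "s \<le> s' \<Longrightarrow> filt K s' n \<subseteq> filt K s n"
  unfolding filt_def by (rule span_mono) (rule UN_mono, auto)

lemma d_zero: "total_d K 0 = 0"
  using d_add[of 0 0] by simp

lemma d_diff: "total_d K (x - y) = total_d K x - total_d K y"
  using d_add[of "x - y" y] by simp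

lemma d_sum: "total_d K (\<Sum>i\<in>A. f i) = (\<Sum>i\<in>A. total_d K (f i))"
  by (induction A rule: infinite_finite_induct) (auto simp: d_zero d_add)

lemma Z_subspace: "subspace (ss_Z K r s t)"
proof (rule subspaceI)
  show "0 \<in> ss_Z K r s t"
    by (simp add: ss_Z_def d_zero subspace_0[OF filt_subspace])
  show "x + y \<in> ss_Z K r s t" if "x \<in> ss_Z K r s t" "y \<in> ss_Z K r s t" for x y
    using that by (simp add: ss_Z_def d_add subspace_add[OF filt_subspace])
  show "dc_smult K c x \<in> ss_Z K r s t" if "x \<in> ss_Z K r s t" for c x
    using that by (simp add: ss_Z_def d_smult subspace_scale[OF filt_subspace])
qed

lemma image_d_subspace: "subspace S \<Longrightarrow> subspace (total_d K ` S)"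
  using image_eqI[where f = "total_d K" and x = 0, OF d_zero[symmetric]]
  unfolding subspace_def by (auto simp flip: d_add d_smult)

lemma B_subspace: "subspace (ss_B K r s t)"
proof -
  have "subspace (S + T)" if "subspace S" "subspace T" for S T
  proof (rule subspaceI)
    show "0 \<in> S + T" using set_plus_intro[OF subspace_0[OF that(1)] subspace_0[OF that(2)]] by simp
    show "x + y \<in> S + T" if "x \<in> S + T" "y \<in> S + T" for x y
    proof -
      obtain a b c d where "x = a + b" "y = c + d" "a \<in> S" "c \<in> S" "b \<in> T" "d \<in> T"
        using \<open>x \<in> S + T\<close> \<open>y \<in> S + T\<close> by (auto simp: set_plus_def)
      then have "x + y = (a + c) + (b + d)" "a + c \<in> S" "b + d \<in> T"
        by (auto simp: subspace_add \<open>subspace S\<close> \<open>subspace T\<close>)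
      then show ?thesis by (simp add: set_plus_intro)
    qed
    show "dc_smult K c x \<in> S + T" if "x \<in> S + T" for c x
      using that by (elim set_plus_elim) (simp add: scale_right_distrib set_plus_intro subspace_scale \<open>subspace S\<close> \<open>subspace T\<close>)
  qed
  then show ?thesis
    unfolding ss_B_def by (simp add: Z_subspace image_d_subspace)
qed

lemma B_intro:
  "x \<in> ss_Z K (int r - 1) (s + 1) (t - 2) \<Longrightarrow>
    y \<in> ss_Z K (int r - 1) (s - int r + 1) (t + 2 * int r - 3) \<Longrightarrow>
    x + total_d K y \<in> ss_B K r s t"
  unfolding ss_B_def by (auto intro: set_plus_intro)

lemma B_elim:
  assumes "z \<in> ss_B K r s t"
  obtains x y where "x \<in> ss_Z K (int r - 1) (s + 1) (t - 2)"
    and "y \<in> ss_Z K (int r - 1) (s - int r + 1) (t + 2 * int r - 3)" and "z = x + total_d K y"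
  using assms unfolding ss_B_def by (auto elim!: set_plus_elim)

lemma d_Z: 
  assumes "x \<in> ss_Z K (int r) s t"
  shows "total_d K x \<in> ss_Z K (int r) (s + int r) (t - (2 * int r - 1))"
proof -
  have *: "2 * (s + int r) + (t - (2 * int r - 1)) = 2 * s + t + 1" by simp
  show ?thesis
    using assms unfolding ss_Z_def * by (auto simp: d_d subspace_0[OF filt_subspace])
qed

text \<open>
  The first summand of \<open>ss_B\<close> goes to the second summand of the target, and the second summand is
  killed by \<open>d\<^sup>2 = 0\<close>.
\<close>

lemma d_B: "total_d K ` ss_B K r s t \<subseteq> ss_B K r (s + int r) (t - (2 * int r - 1))"
proof (rule image_subsetI)
  fix z assume "z \<in> ss_B K r s t"
  then obtain x y where x: "x \<in> ss_Z K (int r - 1) (s + 1) (t - 2)"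
    and y: "y \<in> ss_Z K (int r - 1) (s - int r + 1) (t + 2 * int r - 3)"
    and z: "z = x + total_d K y"
    by (rule B_elim)
  have "total_d K z = 0 + total_d K x"
    using y by (auto simp: z d_add ss_Z_def d_d)
  also have "\<dots> \<in> ss_B K r (s + int r) (t - (2 * int r - 1))"
    by (rule B_intro) (use x in \<open>simp_all add: subspace_0[OF Z_subspace]\<close>)
  finally show "total_d K z \<in> ss_B K r (s + int r) (t - (2 * int r - 1))" .
qed

lemma page_elements: "X \<in> ss_page K r s t \<longleftrightarrow> (\<exists>x\<in>ss_Z K (int r) s t. X = x +o ss_B K r s t)"
  unfolding ss_page_def by auto

text \<open>
  If \<open>h\<close> is a homotopy from a unit multiple of the identity to zero and \<open>h\<close> respects the filtration,
  then a cycle \<open>x\<close> of the page satisfies \<open>c x = h (d x) + d (h x)\<close>.  Here \<open>d x\<close> lies \<open>r \<ge> 1\<close> steps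
  deeper in the filtration, hence so does \<open>h (d x)\<close>, which makes the first summand vanish on the page;
  the second summand is a boundary because \<open>d (h x) = c x - h (d x)\<close> stays in the filtration step of \<open>x\<close>.
\<close>

lemma page_zero_if_homotopy:
  assumes r: "1 \<le> r" and c: "c * c' = 1"
    and h: "\<And>x s n. x \<in> filt K s n \<Longrightarrow> h x \<in> filt K s (n - 1)"
    and dh: "\<And>x s n. x \<in> filt K s n \<Longrightarrow> total_d K (h x) + h (total_d K x) = dc_smult K c x"
  shows "ss_page K r s t = {ss_B K r s t}"
proof -
  have "x \<in> ss_B K r s t" if x: "x \<in> ss_Z K (int r) s t" for x
  proof -
    let ?n = "2 * s + t"
    have xF: "x \<in> filt K s ?n" and dxF: "total_d K x \<in> filt K (s + int r) (?n + 1)"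
      using x by (auto simp: ss_Z_def)
    have hx: "h x \<in> filt K s (?n - 1)" by (rule h[OF xF])
    have hdx: "h (total_d K x) \<in> filt K (s + int r) ?n" using h[OF dxF] by simp
    have hd: "h (total_d K x) = dc_smult K c x - total_d K (h x)"
      using dh[OF xF] by (metis add_diff_cancel_left')
    then have "total_d K (h (total_d K x)) = total_d K (dc_smult K c x - total_d K (h x))"
      by (simp only:)
    also have "\<dots> = dc_smult K c (total_d K x)"
      by (simp add: d_diff d_smult d_d[OF hx])
    finally have dhdx: "total_d K (h (total_d K x)) \<in> filt K (s + int r) (?n + 1)"
      using subspace_scale[OF filt_subspace dxF] by simp
    have hdx': "h (total_d K x) \<in> filt K s ?n" "h (total_d K x) \<in> filt K (s + 1) ?n"
      using hdx filt_antimono[of s "s + int r"] filt_antimono[of "s + 1" "s + int r"] r by auto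
    have 1: "h (total_d K x) \<in> ss_Z K (int r - 1) (s + 1) (t - 2)"
      using hdx' dhdx by (simp add: ss_Z_def add.commute add.left_commute)
    have "total_d K (h x) = dc_smult K c x - h (total_d K x)"
      unfolding hd by simp
    then have dhx: "total_d K (h x) \<in> filt K s ?n"
      using subspace_diff[OF filt_subspace subspace_scale[OF filt_subspace xF] hdx'(1)] by simp
    have n: "2 * (s - int r + 1) + (t + 2 * int r - 3) = ?n - 1" by simp
    have 2: "h x \<in> ss_Z K (int r - 1) (s - int r + 1) (t + 2 * int r - 3)"
      using hx dhx filt_antimono[of "s - int r + 1" s] r unfolding ss_Z_def n by auto
    have "dc_smult K c x \<in> ss_B K r s t"
      using B_intro[OF 1 2] dh[OF xF] by (simp add: add.commute)
    then have "dc_smult K (c' * c) x \<in> ss_B K r s t"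
      using subspace_scale[OF B_subspace, of "dc_smult K c x" r s t c'] by simp
    then show ?thesis using c by (simp add: mult.commute)
  qed
  then have "x +o ss_B K r s t = ss_B K r s t" if "x \<in> ss_Z K (int r) s t" for x
    using that by (simp add: coset_eq_self_iff[OF B_subspace])
  moreover have "ss_Z K (int r) s t \<noteq> {}" using subspace_0[OF Z_subspace] by blast
  ultimately show ?thesis unfolding ss_page_def by auto
qed

end

section \<open>Direct sums of filtered complexes\<close>

text \<open>
  An internal direct sum decomposition, given by its projections, which are compatible with the
  filtration.  They commute with the differential because every part is a subcomplex (\<open>d_proj\<close>).
\<close>

locale graded_filtered_complex = filtered_complex K
  for K :: "('k::comm_ring_1, 'a::ab_group_add) double_complex" +
  fixes I :: "'i set" and K' :: "'i \<Rightarrow> ('k, 'a) double_complex" and proj :: "'i \<Rightarrow> 'a \<Rightarrow> 'a"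
  assumes subcomplex: "\<alpha> \<in> I \<Longrightarrow> double_subcomplex (K' \<alpha>) K"
    and filtered_part: "\<alpha> \<in> I \<Longrightarrow> filtered_complex (K' \<alpha>)"
    and proj_add: "proj \<alpha> (x + y) = proj \<alpha> x + proj \<alpha> y"
    and proj_filt: "\<alpha> \<in> I \<Longrightarrow> x \<in> filt K s n \<Longrightarrow> proj \<alpha> x \<in> filt (K' \<alpha>) s n"
    and proj_part: "\<alpha> \<in> I \<Longrightarrow> \<beta> \<in> I \<Longrightarrow> x \<in> filt (K' \<alpha>) s n \<Longrightarrow> proj \<beta> x = (if \<beta> = \<alpha> then x else 0)"
    and proj_sum: "x \<in> filt K s n \<Longrightarrow>
      \<exists>A. finite A \<and> A \<subseteq> I \<and> (\<forall>\<alpha>\<in>I - A. proj \<alpha> x = 0) \<and> (\<Sum>\<alpha>\<in>A. proj \<alpha> x) = x"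
begin

lemma smult_part: "\<alpha> \<in> I \<Longrightarrow> dc_smult (K' \<alpha>) = dc_smult K"
  using subcomplex by (auto simp: double_subcomplex_def)

lemma d_part: "\<alpha> \<in> I \<Longrightarrow> total_d (K' \<alpha>) = total_d K"
  using subcomplex by (auto simp: double_subcomplex_def total_d_def)

lemma filt_part:
  assumes "\<alpha> \<in> I"
  shows "filt (K' \<alpha>) s n \<subseteq> filt K s n"
proof -
  have "dc_part (K' \<alpha>) s t \<subseteq> dc_part K s t" for s t
    using subcomplex[OF assms] by (auto simp: double_subcomplex_def)
  then show ?thesis
    unfolding filt_def smult_part[OF assms] by - (rule span_mono, rule UN_mono, auto)
qed

lemma proj_zero: "proj \<alpha> 0 = 0"
  using proj_add[of \<alpha> 0 0] by simp

lemma proj_diff: "proj \<alpha> (x - y) = proj \<alpha> x - proj \<alpha> y"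
  using proj_add[of \<alpha> "x - y" y] by simp

lemma proj_of_sum: "proj \<alpha> (\<Sum>i\<in>A. f i) = (\<Sum>i\<in>A. proj \<alpha> (f i))"
  by (induction A rule: infinite_finite_induct) (auto simp: proj_zero proj_add)

lemma proj_sum_parts:
  assumes "finite A" "A \<subseteq> I" "\<And>\<alpha>. \<alpha> \<in> A \<Longrightarrow> x \<alpha> \<in> filt (K' \<alpha>) s n" "\<beta> \<in> I"
  shows "proj \<beta> (\<Sum>\<alpha>\<in>A. x \<alpha>) = (if \<beta> \<in> A then x \<beta> else 0)"
proof -
  have "proj \<beta> (\<Sum>\<alpha>\<in>A. x \<alpha>) = (\<Sum>\<alpha>\<in>A. if \<beta> = \<alpha> then x \<alpha> else 0)"
    unfolding proj_of_sum using assms by (intro sum.cong refl proj_part) auto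
  then show ?thesis using assms(1) by simp
qed

lemma d_proj:
  assumes \<alpha>: "\<alpha> \<in> I" and x: "x \<in> filt K s n"
  shows "total_d K (proj \<alpha> x) = proj \<alpha> (total_d K x)"
proof -
  obtain A where A: "finite A" "A \<subseteq> I" "\<forall>\<alpha>\<in>I - A. proj \<alpha> x = 0" "(\<Sum>\<alpha>\<in>A. proj \<alpha> x) = x"
    using proj_sum[OF x] by blast
  have d: "total_d K (proj \<beta> x) \<in> filt (K' \<beta>) s (n + 1)" if "\<beta> \<in> I" for \<beta>
    using filtered_complex.d_filt[OF filtered_part[OF that] proj_filt[OF that x]]
    by (simp add: d_part that)
  have "proj \<alpha> (total_d K x) = proj \<alpha> (\<Sum>\<beta>\<in>A. total_d K (proj \<beta> x))"
    by (simp add: A(4) flip: d_sum)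
  also have "\<dots> = (if \<alpha> \<in> A then total_d K (proj \<alpha> x) else 0)"
    using A(2) d by (intro proj_sum_parts[OF A(1,2) _ \<alpha>]) auto
  also have "\<dots> = total_d K (proj \<alpha> x)"
    using A(3) \<alpha> by (auto simp: d_zero)
  finally show ?thesis by simp
qed

lemma Z_part: "\<alpha> \<in> I \<Longrightarrow> ss_Z (K' \<alpha>) r s t \<subseteq> ss_Z K r s t"
  unfolding ss_Z_def using filt_part[of \<alpha>] by (auto simp: d_part)

lemma proj_Z: "\<alpha> \<in> I \<Longrightarrow> x \<in> ss_Z K r s t \<Longrightarrow> proj \<alpha> x \<in> ss_Z (K' \<alpha>) r s t"
  unfolding ss_Z_def by (auto simp: d_part d_proj intro: proj_filt)

lemma B_part:
  assumes "\<alpha> \<in> I"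
  shows "ss_B (K' \<alpha>) r s t \<subseteq> ss_B K r s t"
  unfolding ss_B_def d_part[OF assms] using Z_part[OF assms] by (intro set_plus_mono2 image_mono)

lemma proj_B:
  assumes \<alpha>: "\<alpha> \<in> I" and z: "z \<in> ss_B K r s t"
  shows "proj \<alpha> z \<in> ss_B (K' \<alpha>) r s t"
proof -
  obtain x y where x: "x \<in> ss_Z K (int r - 1) (s + 1) (t - 2)"
    and y: "y \<in> ss_Z K (int r - 1) (s - int r + 1) (t + 2 * int r - 3)"
    and z: "z = x + total_d K y"
    using z by (rule B_elim)
  have "proj \<alpha> z = proj \<alpha> x + total_d (K' \<alpha>) (proj \<alpha> y)"
    using y by (auto simp: z proj_add d_part \<alpha> ss_Z_def d_proj)
  then show ?thesis
    using filtered_complex.B_intro[OF filtered_part[OF \<alpha>] proj_Z[OF \<alpha> x] proj_Z[OF \<alpha> y]] by simp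
qed

lemma B_part_subspace: "\<alpha> \<in> I \<Longrightarrow> subspace (ss_B (K' \<alpha>) r s t)"
  using filtered_complex.B_subspace[OF filtered_part] by (simp add: smult_part)

lemma Z_part_subspace: "\<alpha> \<in> I \<Longrightarrow> subspace (ss_Z (K' \<alpha>) r s t)"
  using filtered_complex.Z_subspace[OF filtered_part] by (simp add: smult_part)

text \<open>
  Finitely supported families of representatives, with an explicit finite set \<open>A\<close> that contains the
  support.  The sum map on the direct sum of the pages is governed by the set of indices at which a
  coset is nonzero, which changes under the module operations and under the differential; a set \<open>A\<close>
  that may be enlarged avoids following it.
\<close>

definition family :: "nat \<Rightarrow> int \<Rightarrow> int \<Rightarrow> ('i \<Rightarrow> 'a) \<Rightarrow> 'i set \<Rightarrow> bool"
  where "family r s t x A \<longleftrightarrow> finite A \<and> A \<subseteq> I \<and>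
    (\<forall>\<alpha>\<in>I. x \<alpha> \<in> ss_Z (K' \<alpha>) (int r) s t) \<and> (\<forall>\<alpha>\<in>I - A. x \<alpha> = 0)"

abbreviation cosets :: "nat \<Rightarrow> int \<Rightarrow> int \<Rightarrow> ('i \<Rightarrow> 'a) \<Rightarrow> 'i \<Rightarrow> 'a set"
  where "cosets r s t x \<equiv> (\<lambda>\<alpha>\<in>I. x \<alpha> +o ss_B (K' \<alpha>) r s t)"

text \<open>
  An index in \<open>A\<close> whose coset is zero contributes an element of \<open>ss_B\<close>, so the sum over all of \<open>A\<close>
  represents the same coset as the sum over the support of the family of cosets.
\<close>

lemma direct_sum_cosets:
  assumes f: "family r s t x A"
  shows "cosets r s t x \<in> ss_direct_sum I K' r s t" (is ?m)
    and "ss_sum_map K I K' r s t (cosets r s t x) = (\<Sum>\<alpha>\<in>A. x \<alpha>) +o ss_B K r s t" (is ?e)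
proof -
  let ?N = "{\<alpha> \<in> I. cosets r s t x \<alpha> \<noteq> ss_B (K' \<alpha>) r s t}"
  have A: "finite A" "A \<subseteq> I" and x: "\<And>\<alpha>. \<alpha> \<in> I \<Longrightarrow> x \<alpha> \<in> ss_Z (K' \<alpha>) (int r) s t"
    and x0: "\<And>\<alpha>. \<alpha> \<in> I \<Longrightarrow> \<alpha> \<notin> A \<Longrightarrow> x \<alpha> = 0"
    using f by (auto simp: family_def)
  have N: "?N \<subseteq> A" using x0 by auto
  then have fN: "finite ?N" using A(1) finite_subset by blast
  show ?m unfolding ss_direct_sum_def
    using fN x filtered_complex.page_elements[OF filtered_part] by (auto simp: Pi_iff)
  have "ss_sum_map K I K' r s t (cosets r s t x) =
      (\<Sum>\<alpha>\<in>?N. x \<alpha> +o ss_B (K' \<alpha>) r s t) + ss_B K r s t"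
    unfolding ss_sum_map_def by (intro arg_cong2[of _ _ _ _ "(+)"] sum.cong refl) auto
  also have "\<dots> = (\<Sum>\<alpha>\<in>?N. x \<alpha>) +o ss_B K r s t"
    using B_part B_part_subspace by (intro sum_cosets_plus_absorb fN B_subspace) (auto intro: subspace_0)
  also have "\<dots> = (\<Sum>\<alpha>\<in>A. x \<alpha>) +o ss_B K r s t"
  proof -
    have "x \<alpha> \<in> ss_B K r s t" if "\<alpha> \<in> A - ?N" for \<alpha>
    proof -
      have "\<alpha> \<in> I" "x \<alpha> +o ss_B (K' \<alpha>) r s t = ss_B (K' \<alpha>) r s t" using that A(2) by auto
      then show ?thesis using B_part coset_eq_self_iff[OF B_part_subspace] by blast
    qed
    then have "(\<Sum>\<alpha>\<in>A - ?N. x \<alpha>) \<in> ss_B K r s t"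
      by (intro subspace_sum[OF B_subspace])
    moreover have "(\<Sum>\<alpha>\<in>A. x \<alpha>) - (\<Sum>\<alpha>\<in>?N. x \<alpha>) = (\<Sum>\<alpha>\<in>A - ?N. x \<alpha>)"
      using sum_diff[OF A(1) N, of x] by simp
    ultimately have "(\<Sum>\<alpha>\<in>A. x \<alpha>) +o ss_B K r s t = (\<Sum>\<alpha>\<in>?N. x \<alpha>) +o ss_B K r s t"
      by (simp only: coset_eq_iff[OF B_subspace])
    then show ?thesis by (rule sym)
  qed
  finally show ?e .
qed

lemma direct_sum_elim:
  assumes f: "f \<in> ss_direct_sum I K' r s t"
  obtains x A where "family r s t x A" "f = cosets r s t x"
proof -
  define A where "A = {\<alpha> \<in> I. f \<alpha> \<noteq> ss_B (K' \<alpha>) r s t}"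
  have A: "finite A" "A \<subseteq> I" using f by (auto simp: A_def ss_direct_sum_def)
  have "\<exists>z. z \<in> ss_Z (K' \<alpha>) (int r) s t \<and> f \<alpha> = z +o ss_B (K' \<alpha>) r s t \<and> (\<alpha> \<notin> A \<longrightarrow> z = 0)"
    if "\<alpha> \<in> I" for \<alpha>
  proof (cases "\<alpha> \<in> A")
    case True
    have "f \<alpha> \<in> ss_page (K' \<alpha>) r s t" using f that by (auto simp: ss_direct_sum_def)
    with True show ?thesis by (auto simp: ss_page_def)
  next
    case False
    then show ?thesis using that unfolding A_def
      by (auto intro!: exI[of _ 0] subspace_0[OF Z_part_subspace])
  qed
  then obtain x where x: "\<And>\<alpha>. \<alpha> \<in> I \<Longrightarrow> x \<alpha> \<in> ss_Z (K' \<alpha>) (int r) s t \<and>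
      f \<alpha> = x \<alpha> +o ss_B (K' \<alpha>) r s t \<and> (\<alpha> \<notin> A \<longrightarrow> x \<alpha> = 0)"
    by metis
  have "family r s t x A" unfolding family_def using A x by blast
  moreover have "f = cosets r s t x"
  proof (rule extensionalityI[of f I])
    show "f \<in> extensional I" using f by (auto simp: ss_direct_sum_def PiE_def)
    show "f \<alpha> = cosets r s t x \<alpha>" if "\<alpha> \<in> I" for \<alpha> using x[OF that] that by (metis restrict_apply')
  qed simp
  ultimately show thesis by (rule that)
qed

lemma family_union: "family r s t x A \<Longrightarrow> finite C \<Longrightarrow> C \<subseteq> I \<Longrightarrow> family r s t x (A \<union> C)"
  by (auto simp: family_def)

lemma cosets_cong: "(\<And>\<alpha>. \<alpha> \<in> I \<Longrightarrow> x \<alpha> +o ss_B (K' \<alpha>) r s t = g \<alpha>) \<Longrightarrow> (\<lambda>\<alpha>\<in>I. g \<alpha>) = cosets r s t x"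
  by (rule restrict_ext) simp

text \<open>
  Projections map the cycles and the boundaries of \<open>K\<close> to those of the parts.  Hence a family whose
  sum is a boundary consists of boundaries, which is injectivity, and a cycle is the sum of the cycles
  that are its projections, which is surjectivity.  The compatibilities hold on representatives.
\<close>

theorem decomposition: "ss_decomposition K I K'"
  unfolding ss_decomposition_def
proof (intro conjI allI ballI)
  fix \<alpha> assume "\<alpha> \<in> I"
  then show "double_subcomplex (K' \<alpha>) K" by (rule subcomplex)
next
  fix r s t
  let ?S = "ss_sum_map K I K' r s t" and ?B = "ss_B K r s t"
  show "bij_betw ?S (ss_direct_sum I K' r s t) (ss_page K r s t)"
    unfolding bij_betw_def
  proof
    show "inj_on ?S (ss_direct_sum I K' r s t)"
    proof (rule inj_onI)
      fix f g assume f: "f \<in> ss_direct_sum I K' r s t" and g: "g \<in> ss_direct_sum I K' r s t" and eq: "?S f = ?S g"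
      obtain x A where x: "family r s t x A" "f = cosets r s t x" using f by (rule direct_sum_elim)
        obtain y C where y: "family r s t y C" "g = cosets r s t y" using g by (rule direct_sum_elim)
      let ?U = "A \<union> C"
      have x': "family r s t x ?U" and y': "family r s t y ?U"
        using family_union[OF x(1), of C] family_union[OF y(1), of A] x(1) y(1)
        by (auto simp: family_def Un_commute)
      have B: "(\<Sum>\<alpha>\<in>?U. x \<alpha>) - (\<Sum>\<alpha>\<in>?U. y \<alpha>) \<in> ?B"
        using eq unfolding x(2) y(2) direct_sum_cosets(2)[OF x'] direct_sum_cosets(2)[OF y']
          coset_eq_iff[OF B_subspace] .
      have "x \<beta> +o ss_B (K' \<beta>) r s t = y \<beta> +o ss_B (K' \<beta>) r s t" if \<beta>: "\<beta> \<in> I" for \<beta>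
      proof -
        have *: "proj \<beta> (\<Sum>\<alpha>\<in>?U. z \<alpha>) = z \<beta>" if "family r s t z ?U" for z
        proof -
          have "proj \<beta> (\<Sum>\<alpha>\<in>?U. z \<alpha>) = (if \<beta> \<in> ?U then z \<beta> else 0)"
            by (rule proj_sum_parts[where s = s and n = "2 * s + t"])
              (use that \<beta> in \<open>auto simp: family_def ss_Z_def\<close>)
          then show ?thesis using that \<beta> by (auto simp: family_def)
        qed
        have "x \<beta> - y \<beta> \<in> ss_B (K' \<beta>) r s t"
          using proj_B[OF \<beta> B] by (simp add: proj_diff * x' y')
        then show ?thesis by (simp only: coset_eq_iff[OF B_part_subspace[OF \<beta>]])
      qed
      then show "f = g" unfolding x(2) y(2) by (intro restrict_ext)
    qed
    show "?S ` ss_direct_sum I K' r s t = ss_page K r s t"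
    proof (intro equalityI subsetI)
      fix X assume "X \<in> ?S ` ss_direct_sum I K' r s t"
      then obtain f where f: "f \<in> ss_direct_sum I K' r s t" and X: "X = ?S f" by blast
      obtain x A where x: "family r s t x A" "f = cosets r s t x" using f by (rule direct_sum_elim)
      have "(\<Sum>\<alpha>\<in>A. x \<alpha>) \<in> ss_Z K (int r) s t"
        using x(1) Z_part by (intro subspace_sum[OF Z_subspace]) (unfold family_def, blast)
      then show "X \<in> ss_page K r s t"
        unfolding X x(2) direct_sum_cosets(2)[OF x(1)] by (auto simp: page_elements)
    next
      fix X assume "X \<in> ss_page K r s t"
      then obtain z where z: "z \<in> ss_Z K (int r) s t" "X = z +o ?B" by (auto simp: page_elements)
      then obtain A where A: "finite A" "A \<subseteq> I" "\<forall>\<alpha>\<in>I - A. proj \<alpha> z = 0" "(\<Sum>\<alpha>\<in>A. proj \<alpha> z) = z"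
        using proj_sum[of z s "2 * s + t"] by (auto simp: ss_Z_def)
      have "family r s t (\<lambda>\<alpha>. proj \<alpha> z) A"
        using A z proj_Z by (auto simp: family_def)
      from direct_sum_cosets[OF this] show "X \<in> ?S ` ss_direct_sum I K' r s t"
        unfolding A(4) z(2) by (intro image_eqI[of _ ?S]) simp_all
    qed
  qed
next
  fix r s t f g
  assume f: "f \<in> ss_direct_sum I K' r s t" and g: "g \<in> ss_direct_sum I K' r s t"
  obtain x A where x: "family r s t x A" "f = cosets r s t x" using f by (rule direct_sum_elim)
    obtain y C where y: "family r s t y C" "g = cosets r s t y" using g by (rule direct_sum_elim)
  let ?U = "A \<union> C"
  have x': "family r s t x ?U" and y': "family r s t y ?U"
    using family_union[OF x(1), of C] family_union[OF y(1), of A] x(1) y(1)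
    by (auto simp: family_def Un_commute)
  have xy: "family r s t (\<lambda>\<alpha>. x \<alpha> + y \<alpha>) ?U"
    using x' y' subspace_add[OF Z_part_subspace] by (auto simp: family_def)
  have "(\<lambda>\<alpha>\<in>I. f \<alpha> + g \<alpha>) = cosets r s t (\<lambda>\<alpha>. x \<alpha> + y \<alpha>)"
  proof (rule cosets_cong)
    fix \<alpha> assume \<alpha>: "\<alpha> \<in> I"
    have "ss_B (K' \<alpha>) r s t + ss_B (K' \<alpha>) r s t = ss_B (K' \<alpha>) r s t"
      using subspace_plus_absorb[OF B_part_subspace[OF \<alpha>] order.refl subspace_0[OF B_part_subspace[OF \<alpha>]]] .
    then show "(x \<alpha> + y \<alpha>) +o ss_B (K' \<alpha>) r s t = f \<alpha> + g \<alpha>"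
      using \<alpha> by (simp add: x(2) y(2) set_plus_rearrange)
  qed
  moreover have "ss_B K r s t + ss_B K r s t = ss_B K r s t"
    using subspace_plus_absorb[OF B_subspace order.refl subspace_0[OF B_subspace]] .
  ultimately show "ss_sum_map K I K' r s t (\<lambda>\<alpha>\<in>I. f \<alpha> + g \<alpha>) =
      ss_sum_map K I K' r s t f + ss_sum_map K I K' r s t g"
    using direct_sum_cosets(2)[OF xy] direct_sum_cosets(2)[OF x'] direct_sum_cosets(2)[OF y']
    by (simp add: x(2) y(2) set_plus_rearrange sum.distrib)
next
  fix r s t a f
  assume f: "f \<in> ss_direct_sum I K' r s t"
  obtain x A where x: "family r s t x A" "f = cosets r s t x" using f by (rule direct_sum_elim)
  have ax: "family r s t (\<lambda>\<alpha>. dc_smult K a (x \<alpha>)) A"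
    using x(1) subspace_scale[OF Z_part_subspace] by (auto simp: family_def)
  have sB: "dc_smult K a ` S \<subseteq> S" if "subspace S" for S
    using subspace_scale[OF that] by auto
  have "(\<lambda>\<alpha>\<in>I. ss_smult (K' \<alpha>) r s t a (f \<alpha>)) = cosets r s t (\<lambda>\<alpha>. dc_smult K a (x \<alpha>))"
  proof (rule cosets_cong)
    fix \<alpha> assume \<alpha>: "\<alpha> \<in> I"
    note B = B_part_subspace[OF \<alpha>, of r s t]
    show "dc_smult K a (x \<alpha>) +o ss_B (K' \<alpha>) r s t = ss_smult (K' \<alpha>) r s t a (f \<alpha>)"
      using \<alpha> image_coset_plus_absorb[OF scale_right_distrib scale_zero_right B subspace_0[OF B] sB[OF B]]
      by (simp add: x(2) ss_smult_def smult_part)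
  qed
  moreover have "dc_smult K a ` ((\<Sum>\<alpha>\<in>A. x \<alpha>) +o ss_B K r s t) + ss_B K r s t =
      dc_smult K a (\<Sum>\<alpha>\<in>A. x \<alpha>) +o ss_B K r s t"
    by (rule image_coset_plus_absorb[OF scale_right_distrib scale_zero_right B_subspace
          subspace_0[OF B_subspace] sB[OF B_subspace]])
  ultimately show "ss_sum_map K I K' r s t (\<lambda>\<alpha>\<in>I. ss_smult (K' \<alpha>) r s t a (f \<alpha>)) =
      ss_smult K r s t a (ss_sum_map K I K' r s t f)"
    using direct_sum_cosets(2)[OF ax] direct_sum_cosets(2)[OF x(1)]
    by (simp add: x(2) ss_smult_def scale_sum_right)
next
  fix r s t f
  assume f: "f \<in> ss_direct_sum I K' r s t"
  obtain x A where x: "family r s t x A" "f = cosets r s t x" using f by (rule direct_sum_elim)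
  let ?s = "s + int r" and ?t = "t - (2 * int r - 1)"
  have dx: "family r ?s ?t (\<lambda>\<alpha>. total_d K (x \<alpha>)) A"
    using x(1) filtered_complex.d_Z[OF filtered_part] by (auto simp: family_def d_part d_zero)
  have "(\<lambda>\<alpha>\<in>I. ss_d (K' \<alpha>) r s t (f \<alpha>)) = cosets r ?s ?t (\<lambda>\<alpha>. total_d K (x \<alpha>))"
  proof (rule cosets_cong)
    fix \<alpha> assume \<alpha>: "\<alpha> \<in> I"
    note B = B_part_subspace[OF \<alpha>]
    have "total_d K ` ss_B (K' \<alpha>) r s t \<subseteq> ss_B (K' \<alpha>) r ?s ?t"
      using filtered_complex.d_B[OF filtered_part[OF \<alpha>]] by (simp add: d_part \<alpha>)
    from image_coset_plus_absorb[OF d_add d_zero B subspace_0[OF B] this]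
    show "total_d K (x \<alpha>) +o ss_B (K' \<alpha>) r ?s ?t = ss_d (K' \<alpha>) r s t (f \<alpha>)"
      using \<alpha> by (simp add: x(2) ss_d_def d_part)
  qed
  moreover have "total_d K ` ((\<Sum>\<alpha>\<in>A. x \<alpha>) +o ss_B K r s t) + ss_B K r ?s ?t =
      total_d K (\<Sum>\<alpha>\<in>A. x \<alpha>) +o ss_B K r ?s ?t"
    by (rule image_coset_plus_absorb[OF d_add d_zero B_subspace subspace_0[OF B_subspace] d_B])
  ultimately show "ss_sum_map K I K' r ?s ?t (\<lambda>\<alpha>\<in>I. ss_d (K' \<alpha>) r s t (f \<alpha>)) =
      ss_d K r s t (ss_sum_map K I K' r s t f)"
    using direct_sum_cosets(2)[OF dx] direct_sum_cosets(2)[OF x(1)]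
    by (simp add: x(2) ss_d_def d_sum)
qed

end

section \<open>Supports\<close>

text \<open>
  All submodules of \<open>ext_poly\<close> that occur (the bigraded parts, the filtration, the parts of a given
  weight, the elements of even or odd exterior degree) are spanned by the monomials in some set.
\<close>

definition ep_supp :: "monom set \<Rightarrow> 'k::comm_ring_1 ext_poly set"
  where "ep_supp M = {p. Poly_Mapping.keys p \<subseteq> M}"

lemma ep_supp_single: "\<mu> \<in> M \<Longrightarrow> Poly_Mapping.single \<mu> c \<in> ep_supp M"
  by (simp add: ep_supp_def)

lemma ep_supp_mono: "M \<subseteq> N \<Longrightarrow> ep_supp M \<subseteq> ep_supp N"
  by (auto simp: ep_supp_def)

lemma subspace_ep_supp: "module.subspace ep_scale (ep_supp M)"
proof -
  interpret module ep_scale by (rule module_ep_scale)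
  show ?thesis
  proof (rule subspaceI)
    show "p + q \<in> ep_supp M" if "p \<in> ep_supp M" "q \<in> ep_supp M" for p q
      using that Poly_Mapping.keys_add[of p q] by (auto simp: ep_supp_def)
    show "ep_scale c p \<in> ep_supp M" if "p \<in> ep_supp M" for c p
      using that by (auto simp: ep_supp_def in_keys_iff lookup_ep_scale subset_iff) (metis mult_zero_right)
  qed (simp add: ep_supp_def)
qed

lemmas ep_supp_closed =
  module.subspace_0[OF module_ep_scale subspace_ep_supp]
  module.subspace_add[OF module_ep_scale subspace_ep_supp]
  module.subspace_neg[OF module_ep_scale subspace_ep_supp]
  module.subspace_scale[OF module_ep_scale subspace_ep_supp]
  module.subspace_sum[OF module_ep_scale subspace_ep_supp]

lemma ep_supp_induct [consumes 1, case_names zero add single]: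
  assumes p: "p \<in> ep_supp M"
    and "P 0" and add: "\<And>p q. P p \<Longrightarrow> P q \<Longrightarrow> P (p + q)"
    and single: "\<And>S a c. (S, a) \<in> M \<Longrightarrow> P (Poly_Mapping.single (S, a) c)"
  shows "P p"
proof -
  have "P (\<Sum>\<mu>\<in>A. Poly_Mapping.single \<mu> (Poly_Mapping.lookup p \<mu>))"
    if "finite A" "A \<subseteq> Poly_Mapping.keys p" for A
    using that
  proof (induction A rule: finite_induct)
    case (insert \<mu> A)
    then have "\<mu> \<in> M" using p by (auto simp: ep_supp_def)
    then have "P (Poly_Mapping.single \<mu> (Poly_Mapping.lookup p \<mu>))"
      by (cases \<mu>) (auto intro: single)
    with insert show ?case by (auto intro: add)
  qed (simp add: \<open>P 0\<close>)
  from this[of "Poly_Mapping.keys p"] show ?thesis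
    by (simp flip: poly_mapping_expand)
qed

lemma ep_induct [case_names zero add single]:
  fixes p :: "'k::comm_ring_1 ext_poly"
  assumes "P 0" "\<And>p q. P p \<Longrightarrow> P q \<Longrightarrow> P (p + q)" "\<And>S a c. P (Poly_Mapping.single (S, a) c)"
  shows "P p"
  by (rule ep_supp_induct[of p UNIV]) (use assms in \<open>auto simp: ep_supp_def\<close>)

lemma ep_mult_supp:
  assumes "p \<in> ep_supp M" "q \<in> ep_supp N"
    and PN: "\<And>S a T b. (S, a) \<in> M \<Longrightarrow> (T, b) \<in> N \<Longrightarrow> S \<inter> T = {} \<Longrightarrow> (S \<union> T, a + b) \<in> R"
  shows "p \<diamondop> q \<in> ep_supp R"
  using assms(1)
proof (induction p rule: ep_supp_induct)
  case (single S a c)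
  show ?case using assms(2)
    by (induction q rule: ep_supp_induct)
      (auto simp: ep_mult_add_right ep_supp_closed ep_mult_single intro!: ep_supp_single PN single)
qed (auto simp: ep_mult_add_left ep_supp_closed)

lemma ep_dx_zero [simp]: "ep_dx i 0 = 0" and ep_dy_zero [simp]: "ep_dy i 0 = 0"
  by (simp_all add: ep_dx_def ep_dy_def)

lemma ep_dx_supp:
  assumes "p \<in> ep_supp M" and "\<And>S a. (S, a) \<in> M \<Longrightarrow> i \<in> S \<Longrightarrow> (S - {i}, a) \<in> R"
  shows "ep_dx i p \<in> ep_supp R"
  using assms(1)
  by (induction p rule: ep_supp_induct)
    (auto simp: ep_dx_add ep_supp_closed ep_dx_single intro!: ep_supp_single assms(2))

lemma ep_dy_supp:
  assumes "p \<in> ep_supp M"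
    and "\<And>S a. (S, a) \<in> M \<Longrightarrow> i \<in> Poly_Mapping.keys a \<Longrightarrow> (S, a - Poly_Mapping.single i 1) \<in> R"
  shows "ep_dy i p \<in> ep_supp R"
  using assms(1)
proof (induction p rule: ep_supp_induct)
  case (single S a c)
  then show ?case
    using assms(2)[of S a]
    by (cases "i \<in> Poly_Mapping.keys a")
      (auto simp: ep_dy_single in_keys_iff ep_supp_closed intro!: ep_supp_single)
qed (auto simp: ep_dy_add ep_supp_closed)

lemma ep_mult_minus_left: "(- p) \<diamondop> q = - (p \<diamondop> q)" and ep_mult_minus_right: "p \<diamondop> (- q) = - (p \<diamondop> q)"
  using ep_mult_add_left[of p "- p" q] ep_mult_add_right[of p q "- q"]
  by (simp_all add: eq_neg_iff_add_eq_0 add.commute)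

lemma ep_mult_scale_left: "ep_scale c p \<diamondop> q = ep_scale c (p \<diamondop> q)"
proof (induction p rule: ep_induct)
  case (single S a d)
  show ?case
    by (induction q rule: ep_induct)
      (auto simp: ep_mult_add_right ep_scale_add ep_mult_single ep_scale_single mult_ac
        module.scale_zero_right[OF module_ep_scale])
qed (auto simp: ep_mult_add_left ep_scale_add module.scale_zero_right[OF module_ep_scale])

lemma ep_mult_scale_right: "p \<diamondop> ep_scale c q = ep_scale c (p \<diamondop> q)"
proof (induction p rule: ep_induct)
  case (single S a d)
  show ?case
    by (induction q rule: ep_induct)
      (auto simp: ep_mult_add_right ep_scale_add ep_mult_single ep_scale_single mult_ac
        module.scale_zero_right[OF module_ep_scale])
qed (auto simp: ep_mult_add_left ep_scale_add module.scale_zero_right[OF module_ep_scale])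

lemma ep_dx_scale: "ep_dx i (ep_scale c p) = ep_scale c (ep_dx i p)"
  by (induction p rule: ep_induct)
    (auto simp: ep_dx_add ep_scale_add ep_dx_single ep_scale_single mult_ac
      module.scale_zero_right[OF module_ep_scale])

lemma ep_dy_scale: "ep_dy i (ep_scale c p) = ep_scale c (ep_dy i p)"
  by (induction p rule: ep_induct)
    (auto simp: ep_dy_add ep_scale_add ep_dy_single ep_scale_single mult_ac
      module.scale_zero_right[OF module_ep_scale])

lemma ep_one_mult: "Poly_Mapping.single ({}, 0) 1 \<diamondop> p = p"
  by (induction p rule: ep_induct) (auto simp: ep_mult_add_right ep_mult_single shuffle_sign_def)

section \<open>Derivations of the algebra of forms and polynomials\<close>

text \<open>
  The type \<open>ext_poly\<close> also contains variables with index \<open>\<ge> m\<close>, and monomials \<open>(S, a)\<close> with infinite \<open>S\<close>,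
  for which signs are meaningless.  The Leibniz rules and the weight formulas hold on the monomials
  in \<open>x 0, \<dots>, x (m - 1)\<close> and \<open>y 0, \<dots>, y (m - 1)\<close>.
\<close>

definition mon_box :: "nat \<Rightarrow> monom set"
  where "mon_box m = {(S, a). S \<subseteq> {..<m} \<and> Poly_Mapping.keys a \<subseteq> {..<m}}"

definition mon_parity :: "nat \<Rightarrow> bool \<Rightarrow> monom set"
  where "mon_parity m ev = {(S, a) \<in> mon_box m. even (card S) \<longleftrightarrow> ev}"

lemma finite_mon_box: "(S, a) \<in> mon_box m \<Longrightarrow> finite S"
  by (auto simp: mon_box_def intro: finite_subset)

lemma mon_parity_box: "mon_parity m ev \<subseteq> mon_box m"
  by (auto simp: mon_parity_def)

lemma ep_parity_box: "p \<in> ep_supp (mon_parity m ev) \<Longrightarrow> p \<in> ep_supp (mon_box m)"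
  using ep_supp_mono[OF mon_parity_box] by blast

lemma mon_box_mult: "(S, a) \<in> mon_box m \<Longrightarrow> (T, b) \<in> mon_box m \<Longrightarrow> (S \<union> T, a + b) \<in> mon_box m"
  using Poly_Mapping.keys_add[of a b] by (auto simp: mon_box_def)

lemma mon_parity_mult:
  assumes "(S, a) \<in> mon_parity m ev" "(T, b) \<in> mon_parity m ev'" "S \<inter> T = {}"
  shows "(S \<union> T, a + b) \<in> mon_parity m (ev = ev')"
  using assms mon_box_mult[of S a m T b] finite_mon_box[of S a m] finite_mon_box[of T b m]
  by (auto simp: mon_parity_def card_Un_disjoint)

lemma ep_mult_parity:
  "p \<in> ep_supp (mon_parity m ev) \<Longrightarrow> q \<in> ep_supp (mon_parity m ev') \<Longrightarrow>
    p \<diamondop> q \<in> ep_supp (mon_parity m (ev = ev'))"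
  by (erule ep_mult_supp) (auto intro: mon_parity_mult)

lemma ep_x_parity: "i < m \<Longrightarrow> ep_x i \<in> ep_supp (mon_parity m False)"
  and ep_y_parity: "i < m \<Longrightarrow> ep_y i \<in> ep_supp (mon_parity m True)"
  unfolding ep_x_def ep_y_def by (intro ep_supp_single; auto simp: mon_parity_def mon_box_def)+

lemma keys_diff_single: "Poly_Mapping.keys (a - Poly_Mapping.single i (k::nat)) \<subseteq> Poly_Mapping.keys a"
  by (auto simp: in_keys_iff lookup_minus)

lemma ep_dx_parity:
  "p \<in> ep_supp (mon_parity m ev) \<Longrightarrow> ep_dx i p \<in> ep_supp (mon_parity m (\<not> ev))"
proof (erule ep_dx_supp)
  fix S :: "nat set" and a :: "nat \<Rightarrow>\<^sub>0 nat" assume S: "(S, a) \<in> mon_parity m ev" "i \<in> S"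
  then have "finite S" using finite_mon_box mon_parity_box by blast
  then have "card S = Suc (card (S - {i}))" using S(2) by (metis card_Suc_Diff1)
  then show "(S - {i}, a) \<in> mon_parity m (\<not> ev)" using S by (auto simp: mon_parity_def mon_box_def)
qed

lemma ep_dy_parity:
  "p \<in> ep_supp (mon_parity m ev) \<Longrightarrow> ep_dy i p \<in> ep_supp (mon_parity m ev)"
  by (erule ep_dy_supp) (use keys_diff_single in \<open>fastforce simp: mon_parity_def mon_box_def\<close>)

text \<open>
  As the \<open>y i\<close> have even total degree, the sign in the Leibniz rule depends only on the parity of the
  exterior degree of the first factor.
\<close>

definition odd_derivation :: "nat \<Rightarrow> ('k::comm_ring_1 ext_poly \<Rightarrow> 'k ext_poly) \<Rightarrow> bool"
  where "odd_derivation m D \<longleftrightarrow>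
    (\<forall>p q. D (p + q) = D p + D q) \<and> (\<forall>c p. D (ep_scale c p) = ep_scale c (D p)) \<and>
    (\<forall>ev. \<forall>p \<in> ep_supp (mon_parity m ev). D p \<in> ep_supp (mon_parity m (\<not> ev)) \<and>
      (\<forall>q \<in> ep_supp (mon_box m). D (p \<diamondop> q) = D p \<diamondop> q + (if ev then p \<diamondop> D q else - (p \<diamondop> D q))))"

lemma odd_derivationI:
  assumes add: "\<And>p q. D (p + q) = D p + D q" and scale: "\<And>c p. D (ep_scale c p) = ep_scale c (D p)"
    and parity: "\<And>p ev. p \<in> ep_supp (mon_parity m ev) \<Longrightarrow> D p \<in> ep_supp (mon_parity m (\<not> ev))"
    and leibniz: "\<And>S a c T b d. (S, a) \<in> mon_box m \<Longrightarrow> (T, b) \<in> mon_box m \<Longrightarrow>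
      D (pm_single (S, a) c \<diamondop> pm_single (T, b) d) =
      D (pm_single (S, a) c) \<diamondop> pm_single (T, b) d +
      pm_single (S, a) ((-1) ^ card S * c) \<diamondop> D (pm_single (T, b) d)"
  shows "odd_derivation m D"
  unfolding odd_derivation_def
proof (intro conjI allI ballI add scale parity)
  have D0: "D 0 = 0" using add[of 0 0] by simp
  fix ev and p q :: "'a ext_poly"
  assume "p \<in> ep_supp (mon_parity m ev)" and q: "q \<in> ep_supp (mon_box m)"
  then show "D (p \<diamondop> q) = D p \<diamondop> q + (if ev then p \<diamondop> D q else - (p \<diamondop> D q))"
  proof (induction p rule: ep_supp_induct)
    case (single S a c)
    have s: "pm_single (S, a) ((-1) ^ card S * c) = (if ev then pm_single (S, a) c else - pm_single (S, a) c)"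
      using single(1) by (auto simp: mon_parity_def single_uminus)
    have "(S, a) \<in> mon_box m" using single(1) mon_parity_box by blast
    from single(2) show ?case
      by (induction q rule: ep_supp_induct)
        (auto simp: D0 add ep_mult_add_right ep_mult_minus_left s leibniz[OF \<open>(S, a) \<in> mon_box m\<close>])
  qed (auto simp: D0 add ep_mult_add_left)
qed

lemma ep_deriv_odd_derivation:
  assumes u: "\<And>i. i < m \<Longrightarrow> u i \<in> ep_supp (mon_parity m True)"
    and v: "\<And>i. i < m \<Longrightarrow> v i \<in> ep_supp (mon_parity m False)"
  shows "odd_derivation m (ep_deriv m u v)"
proof (rule odd_derivationI)
  show "ep_deriv m u v (p + q) = ep_deriv m u v p + ep_deriv m u v q" for p q
    by (simp add: ep_deriv_def ep_dx_add ep_dy_add ep_mult_add_right sum.distrib)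
  show "ep_deriv m u v (ep_scale c p) = ep_scale c (ep_deriv m u v p)" for c p
    by (simp add: ep_deriv_def ep_dx_scale ep_dy_scale ep_mult_scale_right ep_scale_sum ep_scale_add)
  show "ep_deriv m u v p \<in> ep_supp (mon_parity m (\<not> ev))" if p: "p \<in> ep_supp (mon_parity m ev)" for p ev
  proof -
    have "u i \<diamondop> ep_dx i p \<in> ep_supp (mon_parity m (\<not> ev))" if "i < m" for i
      using ep_mult_parity[OF u[OF that] ep_dx_parity[OF p]] by simp
    moreover have "v i \<diamondop> ep_dy i p \<in> ep_supp (mon_parity m (\<not> ev))" if "i < m" for i
      using ep_mult_parity[OF v[OF that] ep_dy_parity[OF p]] by simp
    ultimately show ?thesis unfolding ep_deriv_def by (intro ep_supp_closed) auto
  qed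
next
  fix S :: "nat set" and a :: "nat \<Rightarrow>\<^sub>0 nat" and c T b d
  assume "(S, a) \<in> mon_box m" "(T, b) \<in> mon_box m"
  then show "ep_deriv m u v (pm_single (S, a) c \<diamondop> pm_single (T, b) d) =
      ep_deriv m u v (pm_single (S, a) c) \<diamondop> pm_single (T, b) d +
      pm_single (S, a) ((-1) ^ card S * c) \<diamondop> ep_deriv m u v (pm_single (T, b) d)"
  proof (intro ep_deriv_leibniz_single finite_mon_box)
    show "\<forall>(S, a) \<in> Poly_Mapping.keys (u i). finite S \<and> even (card S)" if "i < m" for i
      using u[OF that] by (auto simp: ep_supp_def mon_parity_def subset_iff dest: finite_mon_box)
    show "\<forall>(S, a) \<in> Poly_Mapping.keys (v i). finite S \<and> odd (card S)" if "i < m" for i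
      using v[OF that] by (auto simp: ep_supp_def mon_parity_def subset_iff dest: finite_mon_box)
  qed
qed

lemma ep_dx_odd_derivation: "odd_derivation m (ep_dx i)"
  by (rule odd_derivationI)
    (auto simp: ep_dx_add ep_dx_scale ep_dx_parity intro!: ep_dx_leibniz_single finite_mon_box)

lemma odd_derivation_simps:
  assumes "odd_derivation m D"
  shows "D (p + q) = D p + D q" "D (ep_scale c p) = ep_scale c (D p)" "D 0 = 0" "D (- p) = - D p"
    "D (p - q) = D p - D q" "D (\<Sum>i\<in>A. f i) = (\<Sum>i\<in>A. D (f i))"
proof -
  have add: "D (p + q) = D p + D q" for p q using assms by (simp add: odd_derivation_def)
  show "D (p + q) = D p + D q" by (rule add)
  show "D (ep_scale c p) = ep_scale c (D p)" using assms by (simp add: odd_derivation_def)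
  show D0: "D 0 = 0" using add[of 0 0] by simp
  show "D (- p) = - D p" using add[of p "- p"] by (simp add: D0 eq_neg_iff_add_eq_0 add.commute)
  show "D (p - q) = D p - D q" using add[of "p - q" q] by simp
  show "D (\<Sum>i\<in>A. f i) = (\<Sum>i\<in>A. D (f i))"
    by (induction A rule: infinite_finite_induct) (auto simp: D0 add)
qed

lemma odd_derivation_parity:
  "odd_derivation m D \<Longrightarrow> p \<in> ep_supp (mon_parity m ev) \<Longrightarrow> D p \<in> ep_supp (mon_parity m (\<not> ev))"
  by (simp add: odd_derivation_def)

lemma odd_derivation_leibniz:
  assumes "odd_derivation m D" "q \<in> ep_supp (mon_box m)"
  shows "p \<in> ep_supp (mon_parity m True) \<Longrightarrow> D (p \<diamondop> q) = D p \<diamondop> q + p \<diamondop> D q"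
    and "p \<in> ep_supp (mon_parity m False) \<Longrightarrow> D (p \<diamondop> q) = D p \<diamondop> q - p \<diamondop> D q"
  using assms by (fastforce simp: odd_derivation_def)+

lemma odd_derivation_box:
  assumes D: "odd_derivation m D" and p: "p \<in> ep_supp (mon_box m)"
  shows "D p \<in> ep_supp (mon_box m)"
  using p
proof (induction p rule: ep_supp_induct)
  case (single S a c)
  then have "pm_single (S, a) c \<in> ep_supp (mon_parity m (even (card S)))"
    by (intro ep_supp_single) (auto simp: mon_parity_def)
  from odd_derivation_parity[OF D this] show ?case by (rule ep_parity_box)
qed (auto simp: odd_derivation_simps[OF D] ep_supp_closed)

text \<open>
  The two mixed terms change sign when \<open>D\<close> and \<open>D'\<close> are exchanged.  They cancel in \<open>D D\<close> and
  in \<open>D D' + D' D\<close>, so both operators satisfy the Leibniz rule without signs.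
\<close>

lemma odd_derivation_comp_leibniz:
  assumes D: "odd_derivation m D" "odd_derivation m D'"
    and p: "p \<in> ep_supp (mon_parity m ev)" and q: "q \<in> ep_supp (mon_box m)"
  shows "D (D' (p \<diamondop> q)) = D (D' p) \<diamondop> q + p \<diamondop> D (D' q) +
    (if ev then D p \<diamondop> D' q - D' p \<diamondop> D q else D' p \<diamondop> D q - D p \<diamondop> D' q)"
proof (cases ev)
  case True
  have "D' p \<in> ep_supp (mon_parity m False)" using odd_derivation_parity[OF D(2) p] True by simp
  then show ?thesis
    using p True odd_derivation_box[OF D(2) q]
    by (simp add: odd_derivation_leibniz[OF D(2) q] odd_derivation_leibniz[OF D(1)] q
        odd_derivation_simps[OF D(1)])
next
  case False
  have "D' p \<in> ep_supp (mon_parity m True)" using odd_derivation_parity[OF D(2) p] False by simp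
  then show ?thesis
    using p False odd_derivation_box[OF D(2) q]
    by (simp add: odd_derivation_leibniz[OF D(2) q] odd_derivation_leibniz[OF D(1)] q
        odd_derivation_simps[OF D(1)])
qed

definition even_derivation :: "nat \<Rightarrow> ('k::comm_ring_1 ext_poly \<Rightarrow> 'k ext_poly) \<Rightarrow> bool"
  where "even_derivation m T \<longleftrightarrow>
    (\<forall>p q. T (p + q) = T p + T q) \<and> (\<forall>c p. T (ep_scale c p) = ep_scale c (T p)) \<and>
    (\<forall>ev. \<forall>p \<in> ep_supp (mon_parity m ev). \<forall>q \<in> ep_supp (mon_box m). T (p \<diamondop> q) = T p \<diamondop> q + p \<diamondop> T q)"

lemma even_derivation_square: "odd_derivation m D \<Longrightarrow> even_derivation m (\<lambda>p. D (D p))"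
  unfolding even_derivation_def
  by (auto simp: odd_derivation_simps odd_derivation_comp_leibniz[of m D D])

lemma even_derivation_anticommutator:
  "odd_derivation m D \<Longrightarrow> odd_derivation m D' \<Longrightarrow> even_derivation m (\<lambda>p. D (D' p) + D' (D p))"
  unfolding even_derivation_def
  by (auto simp: odd_derivation_simps odd_derivation_comp_leibniz[of m D D']
      odd_derivation_comp_leibniz[of m D' D] ep_scale_add ep_mult_add_left ep_mult_add_right)

text \<open>
  A derivation that multiplies every generator by a scalar acts on a monomial by the sum of the scalars
  of its factors.  With all scalars zero this says that a derivation is determined by its values on the
  generators.
\<close>

lemma even_derivation_eigen:
  assumes T: "even_derivation m T"
    and x: "\<And>i. i < m \<Longrightarrow> T (ep_x i) = ep_scale (l i) (ep_x i)"
    and y: "\<And>i. i < m \<Longrightarrow> T (ep_y i) = ep_scale (l i) (ep_y i)"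
    and Sa: "(S, a) \<in> mon_box m"
  shows "T (pm_single (S, a) c) =
    ep_scale ((\<Sum>i\<in>S. l i) + (\<Sum>i<m. of_nat (Poly_Mapping.lookup a i) * l i)) (pm_single (S, a) c)"
proof -
  have leibniz: "T (p \<diamondop> q) = T p \<diamondop> q + p \<diamondop> T q"
    if "p \<in> ep_supp (mon_parity m ev)" "q \<in> ep_supp (mon_box m)" for p q ev
    using T that by (auto simp: even_derivation_def)
  have scale: "T (ep_scale c p) = ep_scale c (T p)" for c p using T by (simp add: even_derivation_def)
  have step: "T (p \<diamondop> q) = ep_scale (k + n) (p \<diamondop> q)"
    if "p \<in> ep_supp (mon_parity m ev)" "q \<in> ep_supp (mon_box m)"
      "T p = ep_scale k p" "T q = ep_scale n q" for p q ev k n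
    by (simp add: leibniz[OF that(1,2)] that(3,4) ep_mult_scale_left ep_mult_scale_right
        module.scale_left_distrib[OF module_ep_scale])
  \<comment> \<open>The Leibniz rule for \<open>1 = 1 \<diamondop> 1\<close>.\<close>
  have one: "T (pm_single ({}, 0) c) = 0" for c
  proof -
    let ?e = "pm_single ({}, 0) 1 :: 'a ext_poly"
    have 1: "?e \<in> ep_supp (mon_parity m True)"
      by (intro ep_supp_single) (simp add: mon_parity_def mon_box_def)
    have "T (?e \<diamondop> ?e) = T ?e \<diamondop> ?e + ?e \<diamondop> T ?e" by (rule leibniz[OF 1 ep_parity_box[OF 1]])
    then have "T ?e = 0" by (simp add: ep_one_mult ep_mult_one)
    then have "T (ep_scale c ?e) = 0"
      by (simp add: scale module.scale_zero_right[OF module_ep_scale])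
    then show ?thesis by (simp add: ep_scale_single)
  qed
  have ya: "T (pm_single ({}, a) c) = ep_scale (\<Sum>i<m. of_nat (Poly_Mapping.lookup a i) * l i) (pm_single ({}, a) c)"
    if "({}, a) \<in> mon_box m" for a c
    using that
  proof (induction "\<Sum>i<m. Poly_Mapping.lookup a i" arbitrary: a)
    case 0
    then have "Poly_Mapping.lookup a i = 0" for i
      by (cases "i < m") (auto simp: mon_box_def in_keys_iff subset_iff)
    then have "a = 0" by (intro poly_mapping_eqI) simp
    then show ?case by (simp add: one module.scale_zero_left[OF module_ep_scale])
  next
    case (Suc n)
    then obtain i where i: "i < m" "Poly_Mapping.lookup a i \<noteq> 0"
      by (metis (no_types, lifting) lessThan_iff nat.distinct(1) sum.neutral)
    define a' where "a' = a - Poly_Mapping.single i 1"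
    have a: "a = Poly_Mapping.single i 1 + a'"
      using i(2) by (intro poly_mapping_eqI) (auto simp: a'_def lookup_add lookup_minus lookup_single when_def)
    have box: "({}, a') \<in> mon_box m"
      using Suc.prems keys_diff_single[of a i 1] by (auto simp: mon_box_def a'_def)
    have sum: "(\<Sum>j<m. Poly_Mapping.lookup a j) = Suc (\<Sum>j<m. Poly_Mapping.lookup a' j)"
      using i(1) by (simp add: a lookup_add sum.distrib lookup_single when_def)
    have "T (pm_single ({}, a') c) =
        ep_scale (\<Sum>i<m. of_nat (Poly_Mapping.lookup a' i) * l i) (pm_single ({}, a') c)"
      by (rule Suc.hyps(1)) (use Suc.hyps(2) sum box in auto)
    from step[OF ep_y_parity[OF i(1)] ep_supp_single[OF box] y[OF i(1)] this]
    have "T (ep_y i \<diamondop> pm_single ({}, a') c) = ep_scale (l i + (\<Sum>i<m. of_nat (Poly_Mapping.lookup a' i) * l i))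
        (ep_y i \<diamondop> pm_single ({}, a') c)" .
    moreover have "ep_y i \<diamondop> pm_single ({}, a') c = pm_single ({}, a) c"
      by (simp add: ep_y_def ep_mult_single shuffle_sign_def a)
    moreover have "(\<Sum>j<m. of_nat (Poly_Mapping.lookup a j) * l j) = l i + (\<Sum>i<m. of_nat (Poly_Mapping.lookup a' i) * l i)"
      using i(1) by (simp add: a lookup_add sum.distrib lookup_single when_def distrib_right if_distrib[of "\<lambda>z. of_nat z * _"] cong: if_cong)
    ultimately show ?case by simp
  qed
  have "finite S" "S \<subseteq> {..<m}" "Poly_Mapping.keys a \<subseteq> {..<m}"
    using Sa finite_mon_box by (auto simp: mon_box_def)
  then show ?thesis
  proof (induction S arbitrary: c rule: finite_induct)
    case empty
    then show ?case using ya by (simp add: mon_box_def)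
  next
    case (insert i S)
    define s where "s = (shuffle_sign {i} S :: 'a)"
    have box: "(S, a) \<in> mon_box m" and i: "i < m" using insert by (auto simp: mon_box_def)
    \<comment> \<open>\<open>s = \<plusminus>1\<close> is the sign by which splitting off the factor \<open>x i\<close> changes the coefficient.\<close>
    have ss: "s * (s * c) = c"
      by (simp add: s_def shuffle_sign_def flip: mult.assoc power_add)
    have e: "ep_x i \<diamondop> pm_single (S, a) (s * c) = pm_single (insert i S, a) c"
      using insert(2) by (simp add: ep_x_def ep_mult_single ss flip: s_def)
    from step[OF ep_x_parity[OF i] ep_supp_single[OF box] x[OF i] insert.IH] insert.prems
    have "T (ep_x i \<diamondop> pm_single (S, a) (s * c)) =
      ep_scale (l i + ((\<Sum>i\<in>S. l i) + (\<Sum>i<m. of_nat (Poly_Mapping.lookup a i) * l i)))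
        (ep_x i \<diamondop> pm_single (S, a) (s * c))" by auto
    then show ?case unfolding e using insert(1,2) by (simp add: add.assoc)
  qed
qed

section \<open>Multiplication in the algebra of forms and polynomials\<close>

lemma sum_square_eq_sum_pairs:
  fixes f :: "nat \<Rightarrow> nat \<Rightarrow> 'a::comm_monoid_add"
  assumes "\<And>j. j < m \<Longrightarrow> f j j = 0"
  shows "(\<Sum>j<m. \<Sum>k<m. f j k) = (\<Sum>k<m. \<Sum>j<k. f j k + f k j)"
  using assms by (induction m) (simp_all add: sum.distrib ac_simps)

text \<open>
  A sum over all pairs \<open>a < b\<close> and all \<open>k\<close> is sorted by the position of \<open>k\<close> relative to \<open>a\<close> and \<open>b\<close>.
  This brings the three terms of the Jacobi identity together without a division by \<open>3\<close> or \<open>2\<close>, as is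
  necessary over an arbitrary ring.
\<close>

lemma sum_cube_eq_sum_triples:
  fixes F :: "nat \<Rightarrow> nat \<Rightarrow> nat \<Rightarrow> 'a::comm_monoid_add"
  assumes "\<And>a b. a < b \<Longrightarrow> b < m \<Longrightarrow> F a b a = 0" "\<And>a b. a < b \<Longrightarrow> b < m \<Longrightarrow> F a b b = 0"
  shows "(\<Sum>k<m. \<Sum>b<m. \<Sum>a<b. F a b k) = (\<Sum>r<m. \<Sum>q<r. \<Sum>p<q. F p q r + F p r q + F q r p)"
  using assms
proof (induction m)
  case (Suc m)
  have "(\<Sum>k<m. \<Sum>a<m. F a m k) = (\<Sum>a<m. \<Sum>k<m. F a m k)" by (rule sum.swap)
  also have "\<dots> = (\<Sum>q<m. \<Sum>p<q. F p m q + F q m p)"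
    by (rule sum_square_eq_sum_pairs) (use Suc.prems(1) in auto)
  finally have "(\<Sum>k<m. \<Sum>a<m. F a m k) = (\<Sum>q<m. \<Sum>p<q. F p m q + F q m p)" .
  moreover have "(\<Sum>a<m. F a m m) = 0" using Suc.prems(2) by (intro sum.neutral) auto
  moreover have "(\<Sum>k<m. \<Sum>b<m. \<Sum>a<b. F a b k) = (\<Sum>r<m. \<Sum>q<r. \<Sum>p<q. F p q r + F p r q + F q r p)"
    by (rule Suc.IH) (use Suc.prems in auto)
  ultimately show ?case by (simp add: sum.distrib ac_simps)
qed simp

lemma ep_mult_assoc:
  assumes "p \<in> ep_supp (mon_box m)" "q \<in> ep_supp (mon_box m)" "r \<in> ep_supp (mon_box m)"
  shows "(p \<diamondop> q) \<diamondop> r = p \<diamondop> (q \<diamondop> r)"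
  using assms(1)
proof (induction p rule: ep_supp_induct)
  case (single S a c)
  note p = this
  show ?case using assms(2)
  proof (induction q rule: ep_supp_induct)
    case (single T b d)
    note q = this
    show ?case using assms(3)
      by (induction r rule: ep_supp_induct)
        (auto simp: ep_mult_add_right intro!: ep_assoc_single finite_mon_box p q)
  qed (auto simp: ep_mult_add_left ep_mult_add_right)
qed (auto simp: ep_mult_add_left)

lemma ep_mult_commute_even:
  assumes "p \<in> ep_supp (mon_parity m True)" "q \<in> ep_supp (mon_box m)"
  shows "p \<diamondop> q = q \<diamondop> p"
  using assms(1)
proof (induction p rule: ep_supp_induct)
  case (single S a c)
  then have S: "finite S" "even (card S)" by (auto simp: mon_parity_def dest: finite_mon_box)
  show ?case using assms(2)
  proof (induction q rule: ep_supp_induct)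
    case (single T b d)
    have "shuffle_sign S T = (shuffle_sign T S :: 'a)" if "S \<inter> T = {}"
      using shuffle_sign_swap[of S T] S single that by (simp add: finite_mon_box)
    then show ?case by (auto simp: ep_mult_single Un_commute Int_commute add.commute mult_ac)
  qed (auto simp: ep_mult_add_left ep_mult_add_right)
qed (auto simp: ep_mult_add_left ep_mult_add_right)

lemma ep_x_box: "i < m \<Longrightarrow> ep_x i \<in> ep_supp (mon_box m)" and ep_y_box: "i < m \<Longrightarrow> ep_y i \<in> ep_supp (mon_box m)"
  by (auto intro: ep_parity_box ep_x_parity ep_y_parity)

lemma ep_x_anticommute: "ep_x i \<diamondop> ep_x j = - (ep_x j \<diamondop> ep_x i)"
proof -
  have "shuffle_sign {i} {j} = (- shuffle_sign {j} {i} :: 'a)" if "i \<noteq> j"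
    using shuffle_sign_remove(1)[of "{i}" "{j}" i, where 'a = 'a]
      shuffle_sign_remove(1)[of "{j}" "{i}" j, where 'a = 'a] that
    by (cases "i < j") (simp_all add: shuffle_sign_def Collect_conv_if)
  then show ?thesis
    by (auto simp: ep_x_def ep_mult_single insert_commute simp flip: single_uminus)
qed

section \<open>Bidegree and weight\<close>

definition mon_graded :: "nat \<Rightarrow> (nat \<Rightarrow> 'g \<Rightarrow> complex) \<Rightarrow> int \<Rightarrow> int \<Rightarrow> ('g \<Rightarrow> complex) \<Rightarrow> monom set"
  where "mon_graded m w s t \<alpha> = {(S, a) \<in> mon_box m.
    int (mon_degree a) = s \<and> int (card S) = t \<and> mon_weight w (S, a) = \<alpha>}"

lemma mon_degree_box:
  assumes "Poly_Mapping.keys a \<subseteq> {..<m}"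
  shows "mon_degree a = (\<Sum>i<m. Poly_Mapping.lookup a i)"
  unfolding mon_degree_def by (rule sum.mono_neutral_left) (use assms in \<open>auto simp: in_keys_iff\<close>)

lemma mon_weight_box:
  assumes "Poly_Mapping.keys a \<subseteq> {..<m}"
  shows "mon_weight w (S, a) =
    (\<Sum>i\<in>S. - w i) + (\<Sum>i<m. fun_scale (of_nat (Poly_Mapping.lookup a i)) (- w i))"
  unfolding mon_weight_def prod.case
  by (intro arg_cong2[of _ _ _ _ "(+)"] refl sum.mono_neutral_left)
    (use assms in \<open>auto simp: in_keys_iff fun_scale_def fun_eq_iff\<close>)

lemma mon_graded_mult:
  assumes "(S, a) \<in> mon_graded m w s t \<alpha>" "(T, b) \<in> mon_graded m w s' t' \<beta>" "S \<inter> T = {}"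
  shows "(S \<union> T, a + b) \<in> mon_graded m w (s + s') (t + t') (\<alpha> + \<beta>)"
proof -
  have box: "(S, a) \<in> mon_box m" "(T, b) \<in> mon_box m" using assms by (auto simp: mon_graded_def)
  then have fin: "finite S" "finite T" by (auto dest: finite_mon_box)
  have k: "Poly_Mapping.keys a \<subseteq> {..<m}" "Poly_Mapping.keys b \<subseteq> {..<m}" "Poly_Mapping.keys (a + b) \<subseteq> {..<m}"
    using box mon_box_mult[OF box] by (auto simp: mon_box_def)
  have fs: "fun_scale (x + y) v = fun_scale x v + fun_scale y v" for x y and v :: "'g \<Rightarrow> complex"
    by (simp add: fun_scale_def fun_eq_iff distrib_right)
  have "mon_weight w (S \<union> T, a + b) = mon_weight w (S, a) + mon_weight w (T, b)"
    unfolding k[THEN mon_weight_box]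
    by (simp add: sum.union_disjoint fin assms(3) lookup_add fs sum.distrib sum_negf)
  moreover have "mon_degree (a + b) = mon_degree a + mon_degree b"
    unfolding k[THEN mon_degree_box] by (simp add: lookup_add sum.distrib)
  ultimately show ?thesis
    using assms mon_box_mult[OF box] by (auto simp: mon_graded_def card_Un_disjoint fin)
qed

lemma ep_mult_graded:
  "p \<in> ep_supp (mon_graded m w s t \<alpha>) \<Longrightarrow> q \<in> ep_supp (mon_graded m w s' t' \<beta>) \<Longrightarrow>
    p \<diamondop> q \<in> ep_supp (mon_graded m w (s + s') (t + t') (\<alpha> + \<beta>))"
  by (erule ep_mult_supp) (auto intro: mon_graded_mult)

lemma ep_x_graded: "i < m \<Longrightarrow> ep_x i \<in> ep_supp (mon_graded m w 0 1 (- w i))"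
  unfolding ep_x_def
  by (rule ep_supp_single) (auto simp: mon_graded_def mon_box_def mon_degree_def mon_weight_def)

lemma ep_y_graded: "i < m \<Longrightarrow> ep_y i \<in> ep_supp (mon_graded m w 1 0 (- w i))"
  unfolding ep_y_def
  by (rule ep_supp_single) (auto simp: mon_graded_def mon_box_def mon_degree_def mon_weight_def fun_scale_def)

lemma ep_dx_graded:
  "p \<in> ep_supp (mon_graded m w s t \<alpha>) \<Longrightarrow> ep_dx i p \<in> ep_supp (mon_graded m w s (t - 1) (\<alpha> + w i))"
proof (erule ep_dx_supp)
  fix S :: "nat set" and a :: "nat \<Rightarrow>\<^sub>0 nat" assume S: "(S, a) \<in> mon_graded m w s t \<alpha>" "i \<in> S"
  then have fin: "finite S" and k: "Poly_Mapping.keys a \<subseteq> {..<m}"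
    by (auto simp: mon_graded_def mon_box_def intro: finite_subset)
  have "card S = Suc (card (S - {i}))" using S(2) fin by (metis card_Suc_Diff1)
  moreover have "mon_weight w (S - {i}, a) = mon_weight w (S, a) + w i"
    unfolding mon_weight_box[OF k] using sum.remove[OF fin S(2), of "\<lambda>i. - w i"] by simp
  ultimately show "(S - {i}, a) \<in> mon_graded m w s (t - 1) (\<alpha> + w i)"
    using S by (auto simp: mon_graded_def mon_box_def)
qed

lemma ep_dy_graded:
  "p \<in> ep_supp (mon_graded m w s t \<alpha>) \<Longrightarrow> ep_dy i p \<in> ep_supp (mon_graded m w (s - 1) t (\<alpha> + w i))"
proof (erule ep_dy_supp)
  fix S :: "nat set" and a :: "nat \<Rightarrow>\<^sub>0 nat"
  assume S: "(S, a) \<in> mon_graded m w s t \<alpha>" "i \<in> Poly_Mapping.keys a"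
  define a' where "a' = a - Poly_Mapping.single i 1"
  have a: "a = a' + Poly_Mapping.single i 1"
    using S(2) by (intro poly_mapping_eqI) (auto simp: a'_def lookup_add lookup_minus lookup_single when_def in_keys_iff)
  have k: "Poly_Mapping.keys a \<subseteq> {..<m}" "Poly_Mapping.keys a' \<subseteq> {..<m}"
    using S keys_diff_single[of a i 1] by (auto simp: mon_graded_def mon_box_def a'_def)
  have i: "i < m" using k S(2) by auto
  have "mon_weight w (S, a') = mon_weight w (S, a) + w i"
  proof -
    have "(\<Sum>j<m. fun_scale (of_nat (Poly_Mapping.lookup a j)) (- w j)) =
        (\<Sum>j<m. fun_scale (of_nat (Poly_Mapping.lookup a' j)) (- w j) + (if j = i then - w i else 0))"
      by (intro sum.cong refl) (auto simp: a lookup_add lookup_single when_def fun_scale_def fun_eq_iff algebra_simps)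
    also have "\<dots> = (\<Sum>j<m. fun_scale (of_nat (Poly_Mapping.lookup a' j)) (- w j)) - w i"
      using i by (simp add: sum.distrib)
    finally show ?thesis unfolding k[THEN mon_weight_box] by simp
  qed
  moreover have "mon_degree a = Suc (mon_degree a')"
    using i unfolding k[THEN mon_degree_box] by (simp add: a lookup_add sum.distrib lookup_single when_def)
  ultimately show "(S, a - Poly_Mapping.single i 1) \<in> mon_graded m w (s - 1) t (\<alpha> + w i)"
    using S k unfolding a'_def[symmetric] by (auto simp: mon_graded_def mon_box_def)
qed

lemma mon_graded_box: "mon_graded m w s t \<alpha> \<subseteq> mon_box m"
  by (auto simp: mon_graded_def)

text \<open>
  The derivative with respect to \<open>x i\<close> or \<open>y i\<close> removes a factor of weight \<open>- w i\<close>, and multiplication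
  by \<open>u i\<close> or \<open>v i\<close> puts this weight back.
\<close>

lemma ep_deriv_graded:
  assumes u: "\<And>i. i < m \<Longrightarrow> u i \<in> ep_supp (mon_graded m w s' (t' + 1) (- w i))"
    and v: "\<And>i. i < m \<Longrightarrow> v i \<in> ep_supp (mon_graded m w (s' + 1) t' (- w i))"
    and p: "p \<in> ep_supp (mon_graded m w s t \<alpha>)"
  shows "ep_deriv m u v p \<in> ep_supp (mon_graded m w (s + s') (t + t') \<alpha>)"
proof -
  have "u i \<diamondop> ep_dx i p \<in> ep_supp (mon_graded m w (s + s') (t + t') \<alpha>)" if "i < m" for i
    using ep_mult_graded[OF u[OF that] ep_dx_graded[OF p, of i]] by (simp add: algebra_simps)
  moreover have "v i \<diamondop> ep_dy i p \<in> ep_supp (mon_graded m w (s + s') (t + t') \<alpha>)" if "i < m" for i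
    using ep_mult_graded[OF v[OF that] ep_dy_graded[OF p, of i]] by (simp add: algebra_simps)
  ultimately show ?thesis unfolding ep_deriv_def by (intro ep_supp_closed) auto
qed

lemma lie_complex_weight_part:
  "dc_smult (weight_part w (lie_complex m c) \<alpha>) = ep_scale"
  "dc_part (weight_part w (lie_complex m c) \<alpha>) s t = ep_supp (mon_graded m w s t \<alpha>)"
  "dc_d0 (weight_part w (lie_complex m c) \<alpha>) = dc_d0 (lie_complex m c)"
  "dc_d1 (weight_part w (lie_complex m c) \<alpha>) = dc_d1 (lie_complex m c)"
  "total_d (weight_part w (lie_complex m c) \<alpha>) = total_d (lie_complex m c)"
  by (auto simp: weight_part_def lie_complex_def ep_part_keys ep_supp_def mon_graded_def mon_box_def total_d_def fun_eq_iff)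

text \<open>
  The whole complex is the part of weight zero for the trivial weights.  So what is shown for the parts
  of a weight covers the whole complex as well.
\<close>

lemma lie_complex_eq_weight_part_zero: "lie_complex m c = weight_part (\<lambda>_. 0) (lie_complex m c) 0"
  by (simp add: weight_part_def lie_complex_def mon_weight_def fun_scale_def case_prod_beta flip: zero_fun_def)

lemma span_UN_ep_supp:
  fixes M :: "'i \<Rightarrow> monom set"
  shows "module.span ep_scale (\<Union>i\<in>J. ep_supp (M i)) =
     (ep_supp (\<Union>i\<in>J. M i) :: 'k::comm_ring_1 ext_poly set)"
proof -
  interpret module "ep_scale :: 'k \<Rightarrow> 'k ext_poly \<Rightarrow> 'k ext_poly" by (rule module_ep_scale)
  show ?thesis
  proof (rule equalityI)
    show "span (\<Union>i\<in>J. ep_supp (M i)) \<subseteq> ep_supp (\<Union>i\<in>J. M i)"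
      by (rule span_minimal[OF _ subspace_ep_supp]) (auto simp: ep_supp_def)
    show "ep_supp (\<Union>i\<in>J. M i) \<subseteq> span (\<Union>i\<in>J. ep_supp (M i))"
    proof
      fix p :: "'k ext_poly" assume "p \<in> ep_supp (\<Union>i\<in>J. M i)"
      then show "p \<in> span (\<Union>i\<in>J. ep_supp (M i))"
      proof (induction p rule: ep_supp_induct)
        case (single S a c)
        then obtain i where "i \<in> J" "(S, a) \<in> M i" by blast
        then show ?case by (intro span_base) (auto intro: ep_supp_single)
      qed (auto intro: span_zero span_add)
    qed
  qed
qed

lemma filt_weight_part:
  "filt (weight_part w (lie_complex m c) \<alpha>) s n = ep_supp (\<Union>s'\<in>{s..}. mon_graded m w s' (n - 2 * s') \<alpha>)"
  by (simp add: filt_def lie_complex_weight_part span_UN_ep_supp)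

lemma filt_weight_part_box: "filt (weight_part w (lie_complex m c) \<alpha>) s n \<subseteq> ep_supp (mon_box m)"
  unfolding filt_weight_part using mon_graded_box by (intro ep_supp_mono) blast

section \<open>The differential squares to zero\<close>

text \<open>
  The structure constants of a Lie algebra in a basis.  Alternation and skew symmetry are separate, as
  neither implies the other for a fixed basis.
\<close>

locale lie_constants =
  fixes m :: nat and c :: "nat \<Rightarrow> nat \<Rightarrow> nat \<Rightarrow> 'k::comm_ring_1"
  assumes alternating: "i < m \<Longrightarrow> k < m \<Longrightarrow> c i i k = 0"
    and skew: "i < m \<Longrightarrow> j < m \<Longrightarrow> k < m \<Longrightarrow> c i j k = - c j i k"
    and jacobi: "i < m \<Longrightarrow> j < m \<Longrightarrow> k < m \<Longrightarrow> q < m \<Longrightarrow>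
      (\<Sum>l<m. c i j l * c l k q) + (\<Sum>l<m. c j k l * c l i q) + (\<Sum>l<m. c k i l * c l j q) = 0"
begin

abbreviation d :: "'k ext_poly \<Rightarrow> 'k ext_poly" where "d \<equiv> total_d (lie_complex m c)"

definition "d0x i = - (\<Sum>k<m. \<Sum>j<k. ep_scale (c j k i) (ep_x j \<diamondop> ep_x k))"
definition "d0y i = (\<Sum>j<m. \<Sum>k<m. ep_scale (c j k i) (ep_y j \<diamondop> ep_x k))"

lemma d0_eq: "dc_d0 (lie_complex m c) = ep_deriv m d0x d0y"
  and d1_eq: "dc_d1 (lie_complex m c) = ep_deriv m ep_y (\<lambda>_. 0)"
  by (simp_all add: lie_complex_def d0x_def[abs_def] d0y_def[abs_def])

lemma d_eq: "d = ep_deriv m (\<lambda>i. d0x i + ep_y i) d0y"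
  by (simp add: fun_eq_iff total_d_def d0_eq d1_eq ep_deriv_def ep_mult_add_left sum.distrib ac_simps)

lemma d_x: "i < m \<Longrightarrow> d (ep_x i) = d0x i + ep_y i" and d_y: "i < m \<Longrightarrow> d (ep_y i) = d0y i"
  by (simp_all add: d_eq ep_deriv_x ep_deriv_y)

lemma d0x_parity: "d0x i \<in> ep_supp (mon_parity m True)"
proof -
  have "ep_x j \<diamondop> ep_x k \<in> ep_supp (mon_parity m True)" if "j < k" "k < m" for j k
    using ep_mult_parity[OF ep_x_parity ep_x_parity, of j m k] that by simp
  then show ?thesis unfolding d0x_def by (intro ep_supp_closed) auto
qed

lemma d0y_parity: "d0y i \<in> ep_supp (mon_parity m False)"
proof -
  have "ep_y j \<diamondop> ep_x k \<in> ep_supp (mon_parity m False)" if "j < m" "k < m" for j k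
    using ep_mult_parity[OF ep_y_parity ep_x_parity, of j m k] that by simp
  then show ?thesis unfolding d0y_def by (intro ep_supp_closed) auto
qed

lemma d_odd_derivation: "odd_derivation m d"
  unfolding d_eq by (intro ep_deriv_odd_derivation d0y_parity ep_supp_closed d0x_parity ep_y_parity)

text \<open>
  Relates sums over \<open>j < k\<close>, as in the differential of \<open>x i\<close>, to sums over all pairs, as in the
  differential of \<open>y i\<close>.
\<close>

lemma sum_structure_constants:
  assumes "i < m"
  shows "(\<Sum>k<m. \<Sum>j<k. ep_scale (c j k i) (P j k - P k j)) = (\<Sum>j<m. \<Sum>k<m. ep_scale (c j k i) (P j k))"
proof -
  interpret module ep_scale by (rule module_ep_scale)
  have "(\<Sum>j<m. \<Sum>k<m. ep_scale (c j k i) (P j k)) =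
      (\<Sum>k<m. \<Sum>j<k. ep_scale (c j k i) (P j k) + ep_scale (c k j i) (P k j))"
    by (rule sum_square_eq_sum_pairs) (simp add: alternating assms)
  also have "\<dots> = (\<Sum>k<m. \<Sum>j<k. ep_scale (c j k i) (P j k - P k j))"
  proof (intro sum.cong refl)
    fix k j assume "k \<in> {..<m}" "j \<in> {..<k}"
    then have "c k j i = - c j k i" using assms by (intro skew) auto
    then show "ep_scale (c j k i) (P j k) + ep_scale (c k j i) (P k j) = ep_scale (c j k i) (P j k - P k j)"
      by (simp add: scale_right_diff_distrib)
  qed
  finally show ?thesis by simp
qed

text \<open>
  Up to sign this is the identity \<open>d\<^sub>0\<^sup>2 (x i) = 0\<close>, that is, the Jacobi identity: the coefficient of
  \<open>x p x q x r\<close> for \<open>p < q < r\<close> is the cyclic sum of the iterated brackets.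
\<close>

lemma sum_d0x_x_zero:
  assumes i: "i < m"
  shows "(\<Sum>j<m. \<Sum>k<m. ep_scale (c j k i) (d0x j \<diamondop> ep_x k)) = 0"
proof -
  interpret module ep_scale by (rule module_ep_scale)
  define X where "X a b k = (ep_x a \<diamondop> ep_x b \<diamondop> ep_x k :: 'k ext_poly)" for a b k
  define g where "g a b k = (\<Sum>j<m. c a b j * c j k i)" for a b k
  have "(\<Sum>j<m. \<Sum>k<m. ep_scale (c j k i) (d0x j \<diamondop> ep_x k)) =
      - (\<Sum>j<m. \<Sum>k<m. \<Sum>b<m. \<Sum>a<b. ep_scale (c a b j * c j k i) (X a b k))"
    by (simp add: d0x_def ep_mult_minus_left ep_sum ep_mult_scale_left scale_sum_right X_def sum_negf mult.commute)
  also have "(\<Sum>j<m. \<Sum>k<m. \<Sum>b<m. \<Sum>a<b. ep_scale (c a b j * c j k i) (X a b k)) =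
      (\<Sum>k<m. \<Sum>j<m. \<Sum>b<m. \<Sum>a<b. ep_scale (c a b j * c j k i) (X a b k))"
    by (rule sum.swap)
  also have "\<dots> = (\<Sum>k<m. \<Sum>b<m. \<Sum>j<m. \<Sum>a<b. ep_scale (c a b j * c j k i) (X a b k))"
    by (rule sum.cong[OF refl], rule sum.swap)
  also have "\<dots> = (\<Sum>k<m. \<Sum>b<m. \<Sum>a<b. \<Sum>j<m. ep_scale (c a b j * c j k i) (X a b k))"
    by (rule sum.cong[OF refl], rule sum.cong[OF refl], rule sum.swap)
  also have "\<dots> = (\<Sum>k<m. \<Sum>b<m. \<Sum>a<b. ep_scale (g a b k) (X a b k))"
    by (simp add: g_def scale_sum_left)
  also have "\<dots> = (\<Sum>r<m. \<Sum>q<r. \<Sum>p<q. ep_scale (g p q r) (X p q r) +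
      ep_scale (g p r q) (X p r q) + ep_scale (g q r p) (X q r p))"
    by (rule sum_cube_eq_sum_triples) (simp_all add: X_def ep_x_def ep_mult_single)
  also have "\<dots> = 0"
  proof (intro sum.neutral ballI)
    fix r q p assume "r \<in> {..<m}" "q \<in> {..<r}" "p \<in> {..<q}"
    then have pqr: "p < m" "q < m" "r < m" by auto
    note assoc = ep_mult_assoc[OF ep_x_box ep_x_box ep_x_box]
    have 1: "X p r q = - X p q r"
      using pqr by (simp add: X_def assoc ep_x_anticommute[of r q] ep_mult_minus_right)
    have "ep_x q \<diamondop> ep_x r \<in> (ep_supp (mon_parity m True) :: 'k ext_poly set)"
      using ep_mult_parity[OF ep_x_parity ep_x_parity] pqr by fastforce
    then have "X q r p = ep_x p \<diamondop> (ep_x q \<diamondop> ep_x r)"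
      using pqr by (simp add: X_def ep_mult_commute_even ep_x_box)
    then have 2: "X q r p = X p q r" using pqr by (simp add: X_def assoc)
    \<comment> \<open>The middle term of the cyclic sum has its first two indices in the opposite order.\<close>
    have "g p r q = - g r p q"
      using pqr by (simp add: g_def skew[of p r] flip: sum_negf)
    then have "g p q r - g p r q + g q r p = 0"
      using jacobi[OF pqr i] by (simp add: g_def ac_simps)
    then show "ep_scale (g p q r) (X p q r) + ep_scale (g p r q) (X p r q) + ep_scale (g q r p) (X q r p) = 0"
      by (simp add: 1 2 flip: scale_left_distrib scale_left_diff_distrib)
  qed
  finally show ?thesis by simp
qed

text \<open>
  By the Leibniz rule and \<open>sum_structure_constants\<close>, the part of \<open>d (d\<^sub>0 (x i))\<close> that comes from \<open>d\<^sub>1\<close>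
  is \<open>- d\<^sub>0 (y i)\<close>, which cancels against \<open>d (d\<^sub>1 (x i)) = d (y i)\<close>.
\<close>

lemma d_d_x:
  assumes i: "i < m"
  shows "d (d (ep_x i)) = 0"
proof -
  interpret module ep_scale by (rule module_ep_scale)
  note D = odd_derivation_simps[OF d_odd_derivation]
  have dd: "d (ep_x j \<diamondop> ep_x k) = d (ep_x j) \<diamondop> ep_x k - d (ep_x k) \<diamondop> ep_x j" if "j < m" "k < m" for j k
  proof -
    have "d (ep_x k) \<in> ep_supp (mon_parity m True)"
      using odd_derivation_parity[OF d_odd_derivation ep_x_parity[OF that(2)]] by simp
    then show ?thesis
      using odd_derivation_leibniz(2)[OF d_odd_derivation ep_x_box[OF that(2)] ep_x_parity[OF that(1)]]
      by (simp add: ep_mult_commute_even ep_x_box that)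
  qed
  have "d (d0x i) = - (\<Sum>k<m. \<Sum>j<k. ep_scale (c j k i) (d (ep_x j) \<diamondop> ep_x k - d (ep_x k) \<diamondop> ep_x j))"
    by (simp add: d0x_def D dd)
  also have "\<dots> = - (\<Sum>j<m. \<Sum>k<m. ep_scale (c j k i) (d (ep_x j) \<diamondop> ep_x k))"
    by (simp only: sum_structure_constants[OF i, where P = "\<lambda>j k. d (ep_x j) \<diamondop> ep_x k"])
  also have "\<dots> = - d0y i - (\<Sum>j<m. \<Sum>k<m. ep_scale (c j k i) (d0x j \<diamondop> ep_x k))"
    by (simp add: d_x ep_mult_add_left scale_right_distrib sum.distrib d0y_def)
  also have "\<dots> = - d0y i"
    by (simp add: sum_d0x_x_zero i)
  finally show ?thesis by (simp add: d_x d_y D i)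
qed

text \<open>
  \<open>d\<^sup>2\<close> is a derivation, so it suffices to consider generators.  It vanishes on the \<open>x i\<close>, hence on
  \<open>d\<^sub>0 (x i)\<close>, which is a polynomial in the \<open>x j\<close>, and then also on \<open>y i = d (x i) - d\<^sub>0 (x i)\<close>.
\<close>

lemma d_d_zero:
  assumes "p \<in> ep_supp (mon_box m)"
  shows "d (d p) = 0"
proof -
  interpret module ep_scale by (rule module_ep_scale)
  note D = odd_derivation_simps[OF d_odd_derivation]
  have even: "even_derivation m (\<lambda>p. d (d p))" by (rule even_derivation_square[OF d_odd_derivation])
  have "d (d (ep_x j \<diamondop> ep_x k)) = 0" if "j < m" "k < m" for j k
    using even ep_x_parity[OF that(1)] ep_x_box[OF that(2)]
    by (fastforce simp: even_derivation_def d_d_x that)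
  then have *: "d (d (d0x i)) = 0" for i by (simp add: d0x_def D)
  have y: "d (d (ep_y i)) = 0" if "i < m" for i
  proof -
    have "d (d (d (ep_x i))) = 0" by (simp add: d_d_x[OF that] D)
    then show ?thesis unfolding d_x[OF that] D * by simp
  qed
  show ?thesis using assms
  proof (induction p rule: ep_supp_induct)
    case (single S a c)
    from even_derivation_eigen[OF even _ _ this, where l = "\<lambda>_. 0"] show ?case
      by (simp add: d_d_x y)
  qed (auto simp: D)
qed

end

section \<open>The weight decomposition of the double complex\<close>

locale weighted_lie_constants = lie_constants m c
  for m and c :: "nat \<Rightarrow> nat \<Rightarrow> nat \<Rightarrow> 'k::comm_ring_1" +
  fixes w :: "nat \<Rightarrow> 'g \<Rightarrow> complex"
  assumes weight: "i < m \<Longrightarrow> j < m \<Longrightarrow> k < m \<Longrightarrow> c i j k \<noteq> 0 \<Longrightarrow> w k = w i + w j"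
begin

abbreviation "piece \<equiv> weight_part w (lie_complex m c)"

lemma d0x_graded:
  assumes "i < m"
  shows "d0x i \<in> ep_supp (mon_graded m w 0 2 (- w i))"
proof -
  interpret module ep_scale by (rule module_ep_scale)
  have "ep_scale (c j k i) (ep_x j \<diamondop> ep_x k) \<in> ep_supp (mon_graded m w 0 2 (- w i))" if "j < m" "k < m" for j k
  proof (cases "c j k i = 0")
    case False
    have "ep_x j \<diamondop> ep_x k \<in> ep_supp (mon_graded m w 0 2 (- w i))"
      using ep_mult_graded[OF ep_x_graded[OF that(1)] ep_x_graded[OF that(2)], of w] weight[OF that assms False] that by simp
    then show ?thesis by (rule ep_supp_closed)
  qed (simp add: ep_supp_closed)
  then show ?thesis unfolding d0x_def by (intro ep_supp_closed(3,5)) auto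
qed

lemma d0y_graded:
  assumes "i < m"
  shows "d0y i \<in> ep_supp (mon_graded m w 1 1 (- w i))"
proof -
  interpret module ep_scale by (rule module_ep_scale)
  have "ep_scale (c j k i) (ep_y j \<diamondop> ep_x k) \<in> ep_supp (mon_graded m w 1 1 (- w i))" if "j < m" "k < m" for j k
  proof (cases "c j k i = 0")
    case False
    have "ep_y j \<diamondop> ep_x k \<in> ep_supp (mon_graded m w 1 1 (- w i))"
      using ep_mult_graded[OF ep_y_graded[OF that(1)] ep_x_graded[OF that(2)], of w] weight[OF that assms False] that by simp
    then show ?thesis by (rule ep_supp_closed)
  qed (simp add: ep_supp_closed)
  then show ?thesis unfolding d0y_def by (intro ep_supp_closed(3,5)) auto
qed

lemma d0_graded:
  "p \<in> ep_supp (mon_graded m w s t \<alpha>) \<Longrightarrow> dc_d0 (lie_complex m c) p \<in> ep_supp (mon_graded m w s (t + 1) \<alpha>)"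
  using ep_deriv_graded[of m d0x w 0 1 d0y p s t \<alpha>] d0x_graded d0y_graded by (simp add: d0_eq)

lemma d1_graded:
  "p \<in> ep_supp (mon_graded m w s t \<alpha>) \<Longrightarrow> dc_d1 (lie_complex m c) p \<in> ep_supp (mon_graded m w (s + 1) (t - 1) \<alpha>)"
  using ep_deriv_graded[of m ep_y w 1 "-1" "\<lambda>_. 0" p s t \<alpha>] by (simp add: d1_eq ep_supp_closed ep_y_graded)

lemma filtered_complex_piece: "filtered_complex (piece \<alpha>)"
proof (rule filtered_complex.intro)
  show "module (dc_smult (piece \<alpha>))" by (simp add: lie_complex_weight_part module_ep_scale)
  note D = odd_derivation_simps[OF d_odd_derivation]
  show "total_d (piece \<alpha>) (x + y) = total_d (piece \<alpha>) x + total_d (piece \<alpha>) y" for x y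
    by (simp add: lie_complex_weight_part D)
  show "total_d (piece \<alpha>) (dc_smult (piece \<alpha>) a x) = dc_smult (piece \<alpha>) a (total_d (piece \<alpha>) x)" for a x
    by (simp add: lie_complex_weight_part D)
  show "total_d (piece \<alpha>) x \<in> filt (piece \<alpha>) s (n + 1)" if "x \<in> filt (piece \<alpha>) s n" for x s n
    using that unfolding filt_weight_part lie_complex_weight_part
  proof (induction x rule: ep_supp_induct)
    case (single S a b)
    then obtain s' where s': "s \<le> s'" "(S, a) \<in> mon_graded m w s' (n - 2 * s') \<alpha>" by auto
    let ?p = "pm_single (S, a) b"
    have p: "?p \<in> ep_supp (mon_graded m w s' (n - 2 * s') \<alpha>)" by (rule ep_supp_single[OF s'(2)])
    let ?M = "\<lambda>s'. mon_graded m w s' (n + 1 - 2 * s') \<alpha>"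
    have "dc_d0 (lie_complex m c) ?p \<in> ep_supp (?M s')"
      using d0_graded[OF p] by (simp add: algebra_simps)
    moreover have "dc_d1 (lie_complex m c) ?p \<in> ep_supp (?M (s' + 1))"
      using d1_graded[OF p] by (simp add: algebra_simps)
    moreover have "ep_supp (?M s') \<subseteq> ep_supp (\<Union>s'\<in>{s..}. ?M s')" "ep_supp (?M (s' + 1)) \<subseteq> ep_supp (\<Union>s'\<in>{s..}. ?M s')"
      using s'(1) by (intro ep_supp_mono UN_upper; simp)+
    ultimately show ?case unfolding total_d_def by (intro ep_supp_closed(2)) blast+
  qed (auto simp: D ep_supp_closed)
  show "total_d (piece \<alpha>) (total_d (piece \<alpha>) x) = 0" if "x \<in> filt (piece \<alpha>) s n" for x s n
    using d_d_zero[OF subsetD[OF filt_weight_part_box that]] by (simp add: lie_complex_weight_part)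
qed

lemma double_subcomplex_piece: "double_subcomplex (piece \<alpha>) (lie_complex m c)"
proof -
  have "ep_supp (mon_graded m w s t \<alpha>) \<subseteq> dc_part (lie_complex m c) s t" for s t
    by (auto simp: lie_complex_def ep_part_keys ep_supp_def mon_graded_def mon_box_def)
  moreover have "dc_smult (lie_complex m c) = ep_scale" by (simp add: lie_complex_def)
  ultimately show ?thesis
    unfolding double_subcomplex_def lie_complex_weight_part
    using d0_graded d1_graded by (auto simp: subspace_ep_supp)
qed

end

lemma (in lie_constants) filtered_complex_lie_complex: "filtered_complex (lie_complex m c)"
proof -
  interpret weighted_lie_constants m c "\<lambda>_. 0 :: nat \<Rightarrow> complex"
    by unfold_locales simp
  show ?thesis
    using filtered_complex_piece[of 0] by (simp flip: lie_complex_eq_weight_part_zero)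
qed

definition weight_proj :: "(nat \<Rightarrow> 'g \<Rightarrow> complex) \<Rightarrow> ('g \<Rightarrow> complex) \<Rightarrow>
    'k::comm_ring_1 ext_poly \<Rightarrow> 'k ext_poly"
  where "weight_proj w \<alpha> p = Poly_Mapping.mapp (\<lambda>\<mu> c. c when mon_weight w \<mu> = \<alpha>) p"

lemma lookup_weight_proj:
  "Poly_Mapping.lookup (weight_proj w \<alpha> p) \<mu> = (Poly_Mapping.lookup p \<mu> when mon_weight w \<mu> = \<alpha>)"
  by (auto simp: weight_proj_def lookup_mapp when_def in_keys_iff)

lemma keys_weight_proj:
  "Poly_Mapping.keys (weight_proj w \<alpha> p) = {\<mu> \<in> Poly_Mapping.keys p. mon_weight w \<mu> = \<alpha>}"
  by (auto simp: in_keys_iff lookup_weight_proj)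

context weighted_lie_constants
begin

lemma filt_piece_iff:
  "p \<in> filt (piece \<alpha>) s n \<longleftrightarrow> p \<in> filt (lie_complex m c) s n \<and> (\<forall>\<mu>\<in>Poly_Mapping.keys p. mon_weight w \<mu> = \<alpha>)"
proof -
  have "filt (lie_complex m c) s n = ep_supp (\<Union>s'\<in>{s..}. mon_graded m (\<lambda>_. 0 :: 'g \<Rightarrow> complex) s' (n - 2 * s') 0)"
    using filt_weight_part[of "\<lambda>_. 0 :: 'g \<Rightarrow> complex" m c 0 s n]
    by (simp flip: lie_complex_eq_weight_part_zero)
  then show ?thesis
    unfolding filt_weight_part
    by (auto simp: ep_supp_def mon_graded_def subset_iff mon_weight_def fun_scale_def simp flip: zero_fun_def) 
qed

lemma graded_filtered_complex_pieces:
  assumes \<Lambda>: "\<And>\<mu>. \<mu> \<in> mon_box m \<Longrightarrow> mon_weight w \<mu> \<in> \<Lambda>"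
  shows "graded_filtered_complex (lie_complex m c) \<Lambda> piece (weight_proj w)"
proof (intro graded_filtered_complex.intro graded_filtered_complex_axioms.intro)
  show "filtered_complex (lie_complex m c)" by (rule filtered_complex_lie_complex)
  show "double_subcomplex (piece \<alpha>) (lie_complex m c)" for \<alpha> by (rule double_subcomplex_piece)
  show "filtered_complex (piece \<alpha>)" for \<alpha> by (rule filtered_complex_piece)
  show "weight_proj w \<alpha> (p + q) = weight_proj w \<alpha> p + weight_proj w \<alpha> q" for \<alpha> and p q :: "'k ext_poly"
    by (rule poly_mapping_eqI) (simp add: lookup_weight_proj lookup_add when_def)
  show "weight_proj w \<alpha> p \<in> filt (piece \<alpha>) s n" if "p \<in> filt (lie_complex m c) s n" for \<alpha> p s n
  proof -
    have "p \<in> filt (weight_part (\<lambda>_. 0 :: 'g \<Rightarrow> complex) (lie_complex m c) 0) s n"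
      using that by (simp flip: lie_complex_eq_weight_part_zero)
    then have "weight_proj w \<alpha> p \<in> filt (weight_part (\<lambda>_. 0 :: 'g \<Rightarrow> complex) (lie_complex m c) 0) s n"
      unfolding filt_weight_part ep_supp_def by (auto simp: keys_weight_proj)
    then show ?thesis
      by (simp add: filt_piece_iff keys_weight_proj flip: lie_complex_eq_weight_part_zero)
  qed
  show "weight_proj w \<beta> p = (if \<beta> = \<alpha> then p else 0)" if "p \<in> filt (piece \<alpha>) s n" for \<alpha> \<beta> p s n
  proof -
    have "Poly_Mapping.lookup p \<mu> = 0 \<or> mon_weight w \<mu> = \<alpha>" for \<mu>
      using that by (auto simp: filt_piece_iff in_keys_iff)
    then show ?thesis
      by (intro poly_mapping_eqI) (auto simp: lookup_weight_proj when_def)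
  qed
  show "\<exists>A. finite A \<and> A \<subseteq> \<Lambda> \<and> (\<forall>\<alpha>\<in>\<Lambda> - A. weight_proj w \<alpha> p = 0) \<and> (\<Sum>\<alpha>\<in>A. weight_proj w \<alpha> p) = p"
    if "p \<in> filt (lie_complex m c) s n" for p s n
  proof -
    have "p \<in> filt (weight_part (\<lambda>_. 0 :: 'g \<Rightarrow> complex) (lie_complex m c) 0) s n"
      using that by (simp flip: lie_complex_eq_weight_part_zero)
    then have box: "p \<in> ep_supp (mon_box m)" using filt_weight_part_box by blast
    let ?A = "mon_weight w ` Poly_Mapping.keys p"
    have "(\<Sum>\<alpha>\<in>?A. weight_proj w \<alpha> p) = p"
    proof (rule poly_mapping_eqI)
      fix \<mu>
      have "(\<Sum>\<alpha>\<in>?A. Poly_Mapping.lookup p \<mu> when mon_weight w \<mu> = \<alpha>) =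
          (if mon_weight w \<mu> \<in> ?A then Poly_Mapping.lookup p \<mu> else 0)"
        by (simp add: when_def)
      also have "\<dots> = Poly_Mapping.lookup p \<mu>" by (auto simp: in_keys_iff)
      finally show "Poly_Mapping.lookup (\<Sum>\<alpha>\<in>?A. weight_proj w \<alpha> p) \<mu> = Poly_Mapping.lookup p \<mu>"
        by (simp add: lookup_sum lookup_weight_proj)
    qed
    moreover have "weight_proj w \<alpha> p = 0" if "\<alpha> \<notin> ?A" for \<alpha>
      using that by (intro poly_mapping_eqI) (auto simp: lookup_weight_proj when_def in_keys_iff)
    moreover have "?A \<subseteq> \<Lambda>" using box \<Lambda> by (auto simp: ep_supp_def)
    ultimately show ?thesis by (intro exI[of _ ?A]) auto
  qed
qed

text \<open>
  Cartan's formula for the element \<open>e l\<close>, which acts diagonally: the contraction with \<open>e l\<close> is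
  \<open>\<partial>/\<partial>x l\<close>, and its anticommutator with \<open>d\<close> is the Lie derivative along \<open>e l\<close>.  The contraction
  anticommutes with \<open>d\<^sub>1\<close>, so that the total differential gives the same Lie derivative as \<open>d\<^sub>0\<close>.
  On the dual generators the Lie derivative is multiplication by \<open>- \<zeta> i\<close>.
\<close>

lemma ep_dx_d_anticommutator:
  assumes l: "l < m"
    and diag: "\<And>i k. i < m \<Longrightarrow> k < m \<Longrightarrow> c l k i = (if k = i then \<zeta> i else 0)"
    and Sa: "(S, a) \<in> mon_box m"
  shows "d (ep_dx l (pm_single (S, a) b)) + ep_dx l (d (pm_single (S, a) b)) =
    ep_scale (- (\<Sum>i\<in>S. \<zeta> i) - (\<Sum>i<m. of_nat (Poly_Mapping.lookup a i) * \<zeta> i)) (pm_single (S, a) b)"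
proof -
  interpret module ep_scale by (rule module_ep_scale)
  note D = odd_derivation_simps[OF d_odd_derivation] odd_derivation_simps[OF ep_dx_odd_derivation]
  let ?e = "pm_single ({}, 0) 1 :: 'k ext_poly"
  have x: "ep_dx l (ep_x j) = (if j = l then ?e else 0)" for j
  proof -
    have [simp]: "{i. i = l \<and> i < l} = {}" by auto
    then show ?thesis by (simp add: ep_x_def ep_dx_single)
  qed
  have y: "ep_dx l (ep_y j) = (0 :: 'k ext_poly)" for j by (simp add: ep_y_def ep_dx_single)
  have one: "d ?e = 0"
    by (simp add: d_eq ep_deriv_def ep_dx_single ep_dy_single)
  have xx: "ep_dx l (ep_x j \<diamondop> ep_x k :: 'k ext_poly) = (if j = l then ep_x k else 0) - (if k = l then ep_x j else 0)"
    if "j < m" "k < m" for j k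
    by (simp add: odd_derivation_leibniz(2)[OF ep_dx_odd_derivation ep_x_box[OF that(2)] ep_x_parity[OF that(1)]] x ep_one_mult ep_mult_one)
  have yx: "ep_dx l (ep_y j \<diamondop> ep_x k :: 'k ext_poly) = (if k = l then ep_y j else 0)" if "j < m" "k < m" for j k
    by (simp add: odd_derivation_leibniz(1)[OF ep_dx_odd_derivation ep_x_box[OF that(2)] ep_y_parity[OF that(1)]] x y ep_mult_one)
  have X: "d (ep_dx l (ep_x i)) + ep_dx l (d (ep_x i)) = ep_scale (- \<zeta> i) (ep_x i)" if i: "i < m" for i
  proof -
    have "ep_dx l (d0x i) = - (\<Sum>k<m. \<Sum>j<k. ep_scale (c j k i)
        ((if j = l then ep_x k else 0) - (if k = l then ep_x j else 0)))"
      by (simp add: d0x_def D xx)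
    also have "\<dots> = - (\<Sum>j<m. \<Sum>k<m. ep_scale (c j k i) (if j = l then ep_x k else 0))"
      by (simp only: sum_structure_constants[OF i, where P = "\<lambda>j k. if j = l then ep_x k else 0"])
    also have "\<dots> = - (\<Sum>j<m. if j = l then \<Sum>k<m. ep_scale (c l k i) (ep_x k) else 0)"
      by (intro arg_cong[of _ _ uminus] sum.cong refl) auto
    also have "\<dots> = - (\<Sum>k<m. if k = i then ep_scale (\<zeta> i) (ep_x i) else 0)"
      using l by (simp add: diag i if_distrib[of "\<lambda>z. ep_scale z _"] cong: if_cong)
    also have "\<dots> = ep_scale (- \<zeta> i) (ep_x i)" using i by simp
    finally show ?thesis by (simp add: d_x i D x y one)
  qed
  have Y: "d (ep_dx l (ep_y i)) + ep_dx l (d (ep_y i)) = ep_scale (- \<zeta> i) (ep_y i)" if i: "i < m" for i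
  proof -
    have "ep_dx l (d0y i) = (\<Sum>j<m. \<Sum>k<m. if k = l then ep_scale (c j l i) (ep_y j) else 0)"
      by (simp add: d0y_def D yx if_distrib cong: if_cong)
    also have "\<dots> = (\<Sum>j<m. if j = i then ep_scale (- \<zeta> i) (ep_y i) else 0)"
      using l by (intro sum.cong refl) (auto simp: skew[of _ l] diag i)
    also have "\<dots> = ep_scale (- \<zeta> i) (ep_y i)" using i by simp
    finally show ?thesis by (simp add: d_y i D y)
  qed
  from even_derivation_eigen[OF even_derivation_anticommutator[OF d_odd_derivation ep_dx_odd_derivation] X Y Sa]
  show ?thesis by (simp add: sum_negf)
qed

text \<open>
  On the part of weight \<open>\<alpha>\<close> the Lie derivative along \<open>e l\<close> is multiplication by \<open>\<alpha> (e l)\<close>, and the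
  contraction with \<open>e l\<close> is a homotopy as in \<open>page_zero_if_homotopy\<close>.  It preserves the weight because
  \<open>e l\<close> has weight zero, and it preserves the filtration because it does not touch the \<open>y i\<close>.
\<close>

theorem page_piece_zero:
  fixes \<zeta> :: "nat \<Rightarrow> int" and z :: int
  assumes l: "l < m" "w l = 0"
    and diag: "\<And>i k. i < m \<Longrightarrow> k < m \<Longrightarrow> c l k i = (if k = i then of_int (\<zeta> i) else 0)"
    and w: "\<And>i. i < m \<Longrightarrow> w i h = of_int (\<zeta> i)" and z: "\<alpha> h = of_int z"
    and unit: "of_int z * c' = (1 :: 'k)" and r: "1 \<le> r"
  shows "ss_page (piece \<alpha>) r s t = {ss_B (piece \<alpha>) r s t}"
proof (rule filtered_complex.page_zero_if_homotopy[OF filtered_complex_piece r unit, where h = "ep_dx l"])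
  show "ep_dx l x \<in> filt (piece \<alpha>) s (n - 1)" if "x \<in> filt (piece \<alpha>) s n" for x s n
    using that unfolding filt_weight_part
  proof (induction x rule: ep_supp_induct)
    case (single S a b)
    then obtain s' where s': "s \<le> s'" "(S, a) \<in> mon_graded m w s' (n - 2 * s') \<alpha>" by auto
    have "ep_dx l (pm_single (S, a) b) \<in> ep_supp (mon_graded m w s' (n - 1 - 2 * s') \<alpha>)"
      using ep_dx_graded[OF ep_supp_single[OF s'(2)], of l b] by (simp add: l(2) algebra_simps)
    moreover have "mon_graded m w s' (n - 1 - 2 * s') \<alpha> \<subseteq> (\<Union>s'\<in>{s..}. mon_graded m w s' (n - 1 - 2 * s') \<alpha>)"
      using s'(1) by (intro UN_upper) simp
    ultimately show ?case by (rule subsetD[OF ep_supp_mono, rotated])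
  qed (simp_all add: ep_dx_add ep_supp_closed)
next
  note D = odd_derivation_simps[OF d_odd_derivation] odd_derivation_simps[OF ep_dx_odd_derivation]
  fix x s n
  assume "x \<in> filt (piece \<alpha>) s n"
  then show "total_d (piece \<alpha>) (ep_dx l x) + ep_dx l (total_d (piece \<alpha>) x) =
      dc_smult (piece \<alpha>) (of_int z) x"
    unfolding filt_weight_part lie_complex_weight_part
  proof (induction x rule: ep_supp_induct)
    case (single S a b)
    then have box: "(S, a) \<in> mon_box m" and \<alpha>: "mon_weight w (S, a) = \<alpha>"
      by (auto simp: mon_graded_def)
    then have S: "S \<subseteq> {..<m}" and a: "Poly_Mapping.keys a \<subseteq> {..<m}" by (auto simp: mon_box_def)
    have app: "(\<Sum>i\<in>A. f i) h = (\<Sum>i\<in>A. f i h)" for A and f :: "nat \<Rightarrow> 'g \<Rightarrow> complex"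
      by (induction A rule: infinite_finite_induct) auto
    have "of_int z = mon_weight w (S, a) h" using z by (simp add: \<alpha>)
    also have "\<dots> = of_int (- (\<Sum>i\<in>S. \<zeta> i) - (\<Sum>i<m. int (Poly_Mapping.lookup a i) * \<zeta> i))"
    proof -
      have "(\<Sum>i\<in>S. w i h) = (\<Sum>i\<in>S. of_int (\<zeta> i))"
        using S by (intro sum.cong refl w) auto
      moreover have "(\<Sum>i<m. of_nat (Poly_Mapping.lookup a i) * w i h) =
          (\<Sum>i<m. of_nat (Poly_Mapping.lookup a i) * of_int (\<zeta> i))"
        by (intro sum.cong refl) (simp add: w)
      ultimately show ?thesis
        unfolding mon_weight_box[OF a] by (simp add: app fun_scale_def sum_negf)
    qed
    finally have z': "z = - (\<Sum>i\<in>S. \<zeta> i) - (\<Sum>i<m. int (Poly_Mapping.lookup a i) * \<zeta> i)"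
      by (simp only: of_int_eq_iff)
    show ?case
      using ep_dx_d_anticommutator[where \<zeta> = "\<lambda>i. of_int (\<zeta> i)", OF l(1) diag box] by (simp add: z')
  next
    case zero
    show ?case by (simp add: D module.scale_zero_right[OF module_ep_scale])
  next
    case (add p q)
    have "d (ep_dx l (p + q)) + ep_dx l (d (p + q)) =
        (d (ep_dx l p) + ep_dx l (d p)) + (d (ep_dx l q) + ep_dx l (d q))"
      by (simp add: D)
    then show ?case by (simp only: add ep_scale_add)
  qed
qed

end

section \<open>Lattices and linear systems\<close>

lemma module_of_int: "module scale \<Longrightarrow> module (\<lambda>n::int. scale (of_int n))"
  unfolding module_def by simp

lemma module_fun_scale: "module fun_scale"
  unfolding module_def by (simp add: fun_scale_def fun_eq_iff algebra_simps)

text \<open>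
  A subgroup of \<open>\<int>\<^sup>n\<close> is free of rank at most \<open>n\<close>.  The subgroup \<open>L\<close> is embedded into \<open>\<int>\<^sup>n\<close> by the
  coordinates \<open>f i\<close>.  By induction the kernel \<open>L'\<close> of one coordinate has a basis; an element \<open>b\<close> on which
  this coordinate takes its least positive value \<open>d\<close> completes it to a basis of \<open>L\<close>, since \<open>d\<close> divides
  all values of the coordinate.
\<close>

lemma subgroup_basis_of_int_coordinates:
  fixes scale :: "int \<Rightarrow> 'a::ab_group_add \<Rightarrow> 'a" and f :: "'i \<Rightarrow> 'a \<Rightarrow> int"
  assumes mod: "module scale" and "finite F" and L: "module.subspace scale L"
    and add: "\<And>i x y. i \<in> F \<Longrightarrow> x \<in> L \<Longrightarrow> y \<in> L \<Longrightarrow> f i (x + y) = f i x + f i y"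
    and mult: "\<And>i n x. i \<in> F \<Longrightarrow> x \<in> L \<Longrightarrow> f i (scale n x) = n * f i x"
    and inj: "\<And>x. x \<in> L \<Longrightarrow> (\<And>i. i \<in> F \<Longrightarrow> f i x = 0) \<Longrightarrow> x = 0"
  shows "\<exists>B. finite B \<and> card B \<le> card F \<and> \<not> module.dependent scale B \<and> module.span scale B = L"
  using \<open>finite F\<close> L add mult inj
proof (induction F arbitrary: L rule: finite_induct)
  case empty
  interpret module scale by (rule mod)
  have "L = {0}" using empty.prems(4) subspace_0[OF empty.prems(1)] by auto
  then show ?case by (intro exI[of _ "{}"]) (simp add: independent_empty)
next
  case (insert i F)
  interpret module scale by (rule mod)
  note L = insert.prems(1) and add = insert.prems(2) and mult = insert.prems(3) and inj = insert.prems(4)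
  have f0: "f i 0 = 0" using mult[of i 0 0] subspace_0[OF L] by simp
  define L' where "L' = {x \<in> L. f i x = 0}"
  have L'L: "L' \<subseteq> L" by (auto simp: L'_def)
  have L': "subspace L'"
    using L by (auto simp: L'_def subspace_def f0 add mult)
  have "\<exists>B. finite B \<and> card B \<le> card F \<and> \<not> dependent B \<and> span B = L'"
  proof (rule insert.IH[OF L'])
    show "x = 0" if "x \<in> L'" "\<And>j. j \<in> F \<Longrightarrow> f j x = 0" for x
      by (rule inj) (use that in \<open>auto simp: L'_def\<close>)
    show "f j (x + y) = f j x + f j y" if "j \<in> F" "x \<in> L'" "y \<in> L'" for j x y
      by (rule add) (use that L'L in auto)
    show "f j (scale n x) = n * f j x" if "j \<in> F" "x \<in> L'" for j n x
      by (rule mult) (use that L'L in auto)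
  qed
  then obtain B where B: "finite B" "card B \<le> card F" "independent B" "span B = L'" by auto
  show ?case
  proof (cases "L' = L")
    case True
    with B insert(1,2) show ?thesis by (intro exI[of _ B]) auto
  next
    case False
    have "\<exists>d>0. \<exists>b\<in>L. f i b = int d"
    proof -
      obtain x where x: "x \<in> L" "f i x \<noteq> 0" using False L'L by (auto simp: L'_def)
      then have "f i (scale (sgn (f i x)) x) = \<bar>f i x\<bar>" "scale (sgn (f i x)) x \<in> L"
        by (simp_all add: mult subspace_scale[OF L] abs_sgn mult.commute)
      then show ?thesis using x(2) by (intro exI[of _ "nat \<bar>f i x\<bar>"]) auto
    qed
    then have ex: "\<exists>d. 0 < d \<and> (\<exists>b\<in>L. f i b = int d)" by blast
    define d where "d = (LEAST d. 0 < d \<and> (\<exists>b\<in>L. f i b = int d))"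
    have "0 < d \<and> (\<exists>b\<in>L. f i b = int d)" unfolding d_def by (rule LeastI_ex[OF ex])
    then obtain b where d: "0 < d" and b: "b \<in> L" "f i b = int d" by blast
    have sub: "f i (x - scale n b) = f i x - n * int d" "x - scale n b \<in> L" if "x \<in> L" for x n
    proof -
      have "x - scale n b = x + scale (- n) b" by simp
      then show "f i (x - scale n b) = f i x - n * int d" "x - scale n b \<in> L"
        using that b by (simp_all only: add[of i] mult[of i] subspace_scale[OF L] subspace_add[OF L] insertI1 simp_thms)
    qed
    have rem: "x - scale (f i x div int d) b \<in> L'" if x: "x \<in> L" for x
    proof -
      have v: "f i (x - scale (f i x div int d) b) = f i x mod int d"
        by (simp add: sub(1)[OF x] minus_div_mult_eq_mod)
      have "f i x mod int d = 0"
      proof (rule ccontr)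
        assume "f i x mod int d \<noteq> 0"
        moreover have "0 \<le> f i x mod int d" "f i x mod int d < int d" using d by simp_all
        ultimately have "0 < nat (f i x mod int d) \<and> (\<exists>b\<in>L. f i b = int (nat (f i x mod int d)))"
          and "nat (f i x mod int d) < d"
          using sub(2)[OF x] v by auto
        then show False using not_less_Least unfolding d_def by blast
      qed
      then show ?thesis using v sub(2)[OF x] by (simp add: L'_def)
    qed
    have bB: "b \<notin> B"
      using b d span_base[of b B] B(4) by (auto simp: L'_def)
    have "independent (insert b B)"
      unfolding independent_explicit_module
    proof (intro allI impI)
      fix t u v
      assume t: "finite t" "t \<subseteq> insert b B" "(\<Sum>v\<in>t. scale (u v) v) = 0" "v \<in> t"
      have rest: "(\<Sum>v\<in>t - {b}. scale (u v) v) \<in> L'"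
        unfolding B(4)[symmetric] using t(2) by (intro span_sum span_scale span_base) auto
      have split: "scale (u b) b + (\<Sum>v\<in>t - {b}. scale (u v) v) = 0" if "b \<in> t"
        using sum.remove[OF t(1) that, of "\<lambda>v. scale (u v) v"] t(3) by (rule trans[OF sym])
      have ub: "u b = 0" if "b \<in> t"
      proof -
        have "f i (scale (u b) b + (\<Sum>v\<in>t - {b}. scale (u v) v)) = 0" using split[OF that] f0 by simp
        moreover have "f i (scale (u b) b + (\<Sum>v\<in>t - {b}. scale (u v) v)) =
            f i (scale (u b) b) + f i (\<Sum>v\<in>t - {b}. scale (u v) v)"
          using rest L'L subspace_scale[OF L b(1)] by (intro add) auto
        moreover have "f i (\<Sum>v\<in>t - {b}. scale (u v) v) = 0" using rest by (simp add: L'_def)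
        moreover have "f i (scale (u b) b) = u b * int d" using mult[OF _ b(1)] b(2) by simp
        ultimately show ?thesis using d by simp
      qed
      have "(\<Sum>v\<in>t - {b}. scale (u v) v) = 0"
      proof (cases "b \<in> t")
        case True
        then show ?thesis using split ub by simp
      next
        case False
        then show ?thesis using t(3) by simp
      qed
      then have "u v = 0" if "v \<noteq> b"
      proof -
        have "finite (t - {b})" "t - {b} \<subseteq> B" "v \<in> t - {b}" using t that by auto
        with \<open>(\<Sum>v\<in>t - {b}. scale (u v) v) = 0\<close> show ?thesis
          using B(3)[unfolded independent_explicit_module, rule_format] by blast
      qed
      with ub t(4) show "u v = 0" by blast
    qed
    moreover have "span (insert b B) = L"
    proof
      show "span (insert b B) \<subseteq> L"
        by (rule span_minimal[OF _ L]) (use b B(4) L'L span_base[of _ B] in blast)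
      show "L \<subseteq> span (insert b B)"
      proof
        fix x assume "x \<in> L"
        then have "x - scale (f i x div int d) b \<in> span B" using rem B(4) by simp
        then have "x - scale (f i x div int d) b \<in> span (insert b B)"
          using span_mono[of B "insert b B"] by blast
        moreover have "scale (f i x div int d) b \<in> span (insert b B)"
          by (intro span_scale span_base) simp
        ultimately have "x - scale (f i x div int d) b + scale (f i x div int d) b \<in> span (insert b B)"
          by (rule span_add)
        then show "x \<in> span (insert b B)" by simp
      qed
    qed
    ultimately show ?thesis
      using B(1,2) bB insert(1,2) by (intro exI[of _ "insert b B"]) auto
  qed
qed

text \<open>
  Gaussian elimination: one equation is used to eliminate one unknown \<open>l0\<close> from the others.
\<close>

lemma homogeneous_system_nontrivial_solution:
  fixes M :: "'b \<Rightarrow> 'i \<Rightarrow> 'k::field"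
  assumes "finite B" "finite F" "card B < card F"
  shows "\<exists>a. (\<exists>l\<in>F. a l \<noteq> 0) \<and> (\<forall>b\<in>B. (\<Sum>l\<in>F. a l * M b l) = 0)"
  using assms
proof (induction B arbitrary: M F rule: finite_induct)
  case empty
  then have "F \<noteq> {}" by auto
  then show ?case by (intro exI[of _ "\<lambda>_. 1"]) auto
next
  case (insert b B)
  show ?case
  proof (cases "\<forall>l\<in>F. M b l = 0")
    case True
    obtain a where "\<exists>l\<in>F. a l \<noteq> 0" "\<forall>b\<in>B. (\<Sum>l\<in>F. a l * M b l) = 0"
      using insert.IH[where F = F and M = M, OF insert.prems(1)] insert.hyps insert.prems(2) by auto
    with True show ?thesis by (intro exI[of _ a]) auto
  next
    case False
    then obtain l0 where l0: "l0 \<in> F" "M b l0 \<noteq> 0" by blast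
    let ?F = "F - {l0}"
    have "\<exists>a. (\<exists>l\<in>?F. a l \<noteq> 0) \<and>
        (\<forall>b'\<in>B. (\<Sum>l\<in>?F. a l * (M b' l - M b' l0 * M b l / M b l0)) = 0)"
      by (rule insert.IH) (use insert.prems insert.hyps l0(1) in auto)
    then obtain a where a: "\<exists>l\<in>?F. a l \<noteq> 0"
      "\<forall>b'\<in>B. (\<Sum>l\<in>?F. a l * (M b' l - M b' l0 * M b l / M b l0)) = 0"
      by blast
    define a0 where "a0 = - (\<Sum>l\<in>?F. a l * M b l) / M b l0"
    have sum: "(\<Sum>l\<in>F. (a(l0 := a0)) l * M b' l) = a0 * M b' l0 + (\<Sum>l\<in>?F. a l * M b' l)" for b'
      using insert.prems(1) l0(1) by (subst sum.remove[of F l0]) (auto intro!: sum.cong)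
    have "(\<Sum>l\<in>F. (a(l0 := a0)) l * M b' l) = 0" if "b' \<in> insert b B" for b'
    proof (cases "b' = b")
      case True
      then show ?thesis unfolding sum using l0(2) by (simp add: a0_def)
    next
      case False
      have "(\<Sum>l\<in>?F. a l * M b' l) - (\<Sum>l\<in>?F. a l * M b l) * (M b' l0 / M b l0) =
          (\<Sum>l\<in>?F. a l * (M b' l - M b' l0 * M b l / M b l0))"
        unfolding sum_distrib_right sum_subtractf[symmetric] by (intro sum.cong refl) (simp add: algebra_simps)
      also have "\<dots> = 0" using a(2) that False by auto
      finally show ?thesis unfolding sum by (simp add: a0_def algebra_simps)
    qed
    moreover have "\<exists>l\<in>F. (a(l0 := a0)) l \<noteq> 0" using a(1) by auto
    ultimately show ?thesis by (intro exI[of _ "a(l0 := a0)"]) blast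
  qed
qed

section \<open>Lie algebras with a basis\<close>

context lie_algebra
begin

lemma bracket_zero: "bracket 0 y = 0" "bracket x 0 = 0"
  using bracket_add_left[of 0 0 y] bracket_add_right[of x 0 0] by simp_all

lemma bracket_sum: "bracket (\<Sum>i\<in>A. f i) y = (\<Sum>i\<in>A. bracket (f i) y)"
  "bracket x (\<Sum>i\<in>A. f i) = (\<Sum>i\<in>A. bracket x (f i))"
  by (induction A rule: infinite_finite_induct) (auto simp: bracket_zero bracket_add_left bracket_add_right)

lemma bracket_anticommute: "bracket x y = - bracket y x"
proof -
  have "bracket (x + y) (x + y) = bracket x x + bracket y y + (bracket x y + bracket y x)"
    by (simp only: bracket_add_left bracket_add_right ac_simps)
  then have "bracket x y + bracket y x = 0" by (simp add: bracket_self)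
  then show ?thesis by (simp add: eq_neg_iff_add_eq_0)
qed

lemma bracket_minus: "bracket x (- y) = - bracket x y"
  using bracket_add_right[of x y "- y"] by (simp add: bracket_zero eq_neg_iff_add_eq_0 add.commute)

lemma jacobi_left: "bracket (bracket x y) z + bracket (bracket y z) x + bracket (bracket z x) y = 0"
proof -
  have "bracket (bracket x y) z + bracket (bracket y z) x + bracket (bracket z x) y =
      - (bracket x (bracket y z) + bracket y (bracket z x) + bracket z (bracket x y))"
    using bracket_anticommute[of "bracket x y" z] bracket_anticommute[of "bracket y z" x]
      bracket_anticommute[of "bracket z x" y] by simp
  then show ?thesis by (simp only: jacobi minus_zero)
qed

lemma lie_basis_expand:
  assumes "lie_basis m e"
  shows "(\<Sum>i<m. scale (representation (e ` {..<m}) x (e i)) (e i)) = x"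
proof -
  have "(\<Sum>v\<in>e ` {..<m}. scale (representation (e ` {..<m}) x v) v) = x"
    by (rule sum_representation_eq) (use assms in \<open>auto simp: lie_basis_def\<close>)
  then show ?thesis using assms by (simp add: sum.reindex lie_basis_def)
qed

lemma lie_basis_unique:
  assumes "lie_basis m e" "(\<Sum>i<m. scale (a i) (e i)) = (\<Sum>i<m. scale (b i) (e i))" "k < m"
  shows "a k = b k"
proof -
  have inj: "inj_on e {..<m}" and ind: "independent (e ` {..<m})" using assms by (auto simp: lie_basis_def)
  define u where "u v = (a (inv_into {..<m} e v) - b (inv_into {..<m} e v))" for v
  have "(\<Sum>v\<in>e ` {..<m}. scale (u v) v) = (\<Sum>i<m. scale (a i - b i) (e i))"
    using inj by (simp add: sum.reindex u_def)
  also have "\<dots> = 0" using assms(2) by (simp add: scale_left_diff_distrib sum_subtractf)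
  finally have "u (e k) = 0"
    using ind assms(3) unfolding independent_explicit_module by blast
  then show ?thesis using inj assms(3) by (simp add: u_def)
qed

lemma bracket_basis:
  assumes "lie_basis m e"
  shows "bracket (e i) (e j) = (\<Sum>k<m. scale (structure_constants m e i j k) (e k))"
  unfolding structure_constants_def by (rule lie_basis_expand[OF assms, symmetric])

lemma lie_constants_structure_constants:
  assumes e: "lie_basis m e"
  shows "lie_constants m (structure_constants m e)"
proof
  let ?c = "structure_constants m e"
  note unique = lie_basis_unique[OF e]
  show "?c i i k = 0" if "k < m" for i k
  proof (rule unique[OF _ that])
    show "(\<Sum>k<m. scale (?c i i k) (e k)) = (\<Sum>k<m. scale 0 (e k))"
      by (simp add: bracket_basis[OF e, symmetric] bracket_self)
  qed
  show "?c i j k = - ?c j i k" if "k < m" for i j k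
  proof (rule unique[OF _ that])
    show "(\<Sum>k<m. scale (?c i j k) (e k)) = (\<Sum>k<m. scale (- ?c j i k) (e k))"
      using bracket_anticommute[of "e i" "e j"] by (simp add: bracket_basis[OF e, symmetric] sum_negf)
  qed
  have b: "bracket (bracket (e i) (e j)) (e k) = (\<Sum>q<m. scale (\<Sum>l<m. ?c i j l * ?c l k q) (e q))" for i j k
  proof -
    have "bracket (bracket (e i) (e j)) (e k) = (\<Sum>l<m. \<Sum>q<m. scale (?c i j l * ?c l k q) (e q))"
      by (simp add: bracket_basis[OF e, of i j] bracket_sum bracket_scale_left bracket_basis[OF e, of _ k] scale_sum_right)
    also have "\<dots> = (\<Sum>q<m. \<Sum>l<m. scale (?c i j l * ?c l k q) (e q))" by (rule sum.swap)
    finally show ?thesis by (simp add: scale_sum_left)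
  qed
  show "(\<Sum>l<m. ?c i j l * ?c l k q) + (\<Sum>l<m. ?c j k l * ?c l i q) + (\<Sum>l<m. ?c k i l * ?c l j q) = 0"
    if "q < m" for i j k q
  proof (rule unique[OF _ that])
    show "(\<Sum>q<m. scale ((\<Sum>l<m. ?c i j l * ?c l k q) + (\<Sum>l<m. ?c j k l * ?c l i q) +
        (\<Sum>l<m. ?c k i l * ?c l j q)) (e q)) = (\<Sum>q<m. scale 0 (e q))"
      using jacobi_left[of "e i" "e j" "e k"] by (simp add: b scale_left_distrib sum.distrib)
  qed
qed

end


section \<open>Roots and integral forms\<close>

lemma int_span_image_expand:
  assumes mod: "module scale" and x: "x \<in> int_span scale (e ` {..<m})"
  shows "\<exists>n::nat \<Rightarrow> int. x = (\<Sum>k<m. scale (of_int (n k)) (e k))"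
proof -
  interpret Z: module "\<lambda>n::int. scale (of_int n)" by (rule module_of_int[OF mod])
  let ?S = "{x. \<exists>n::nat \<Rightarrow> int. x = (\<Sum>k<m. scale (of_int (n k)) (e k))}"
  have "Z.span (e ` {..<m}) \<subseteq> ?S"
  proof (rule Z.span_minimal)
    show "e ` {..<m} \<subseteq> ?S"
    proof clarify
      fix i assume "i < m"
      then have "e i = (\<Sum>k<m. if k = i then e i else 0)" by simp
      also have "\<dots> = (\<Sum>k<m. scale (of_int (if k = i then 1 else 0)) (e k))"
        by (intro sum.cong refl) (auto simp: module.scale_one[OF mod] module.scale_zero_left[OF mod])
      finally show "\<exists>n::nat \<Rightarrow> int. e i = (\<Sum>k<m. scale (of_int (n k)) (e k))"
        by (rule exI[where x = "\<lambda>k. if k = i then 1 else 0"])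
    qed
    show "Z.subspace ?S"
    proof (rule Z.subspaceI)
      show "0 \<in> ?S" by (auto intro!: exI[of _ "\<lambda>_. 0"] simp: module.scale_zero_left[OF mod])
    next
      fix x y assume "x \<in> ?S" "y \<in> ?S"
      then obtain a b :: "nat \<Rightarrow> int" where "x = (\<Sum>k<m. scale (of_int (a k)) (e k))"
        "y = (\<Sum>k<m. scale (of_int (b k)) (e k))" by auto
      then have "x + y = (\<Sum>k<m. scale (of_int (a k + b k)) (e k))"
        by (simp add: sum.distrib module.scale_left_distrib[OF mod])
      then show "x + y \<in> ?S" unfolding mem_Collect_eq by (rule exI[where x = "\<lambda>k. a k + b k"])
    next
      fix c x assume "x \<in> ?S"
      then obtain a :: "nat \<Rightarrow> int" where "x = (\<Sum>k<m. scale (of_int (a k)) (e k))" by auto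
      then have "scale (of_int c) x = (\<Sum>k<m. scale (of_int (c * a k)) (e k))"
        by (simp add: module.scale_sum_right[OF mod] module.scale_scale[OF mod])
      then show "scale (of_int c) x \<in> ?S" unfolding mem_Collect_eq by (rule exI[where x = "\<lambda>k. c * a k"])
    qed
  qed
  with x show ?thesis by blast
qed

locale adapted_integral_form = lie_algebra scale bracket
  for scale :: "complex \<Rightarrow> 'g::ab_group_add \<Rightarrow> 'g" and bracket +
  fixes H :: "'g set" and m :: nat and e :: "nat \<Rightarrow> 'g" and w :: "nat \<Rightarrow> 'g \<Rightarrow> complex"
  assumes semisimple: semisimple and cartan: "cartan_subalgebra H"
    and integral: "integral_form scale bracket H m e w"
begin

sublocale V: vector_space scale
  by unfold_locales (simp_all add: algebra_simps)

abbreviation "\<Lambda> \<equiv> root_lattice scale bracket H"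

lemma basis: "lie_basis m e"
  and e_cases: "i < m \<Longrightarrow> e i \<in> H \<and> w i = 0 \<or> w i \<in> roots H \<and> e i \<in> root_space H (w i)"
  and span_H: "span {e i | i. i < m \<and> e i \<in> H} = H"
  and roots_int: "\<alpha> \<in> roots H \<Longrightarrow> i < m \<Longrightarrow> e i \<in> H \<Longrightarrow> \<alpha> (e i) \<in> \<int>"
  and bracket_int_span: "x \<in> int_span scale (e ` {..<m}) \<Longrightarrow> y \<in> int_span scale (e ` {..<m}) \<Longrightarrow>
    bracket x y \<in> int_span scale (e ` {..<m})"
  using integral by (auto simp: integral_form_def)

lemma H_subspace: "subspace H" and H_bracket: "x \<in> H \<Longrightarrow> y \<in> H \<Longrightarrow> bracket x y \<in> H"
  and H_nilpotent: "nilpotent H"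
  using cartan by (auto simp: cartan_subalgebra_def subalgebra_def)

lemma roots_dual: "\<alpha> \<in> roots H \<Longrightarrow> \<alpha> \<in> dual_space H"
  by (simp add: roots_def)

text \<open>
  A root \<open>\<alpha>\<close> has an eigenvector \<open>v\<close>, and on the line spanned by \<open>v\<close> the commutator of the actions of
  \<open>x\<close> and \<open>y\<close> is zero.
\<close>

lemma root_bracket_zero:
  assumes \<alpha>: "\<alpha> \<in> roots H" and x: "x \<in> H" and y: "y \<in> H"
  shows "\<alpha> (bracket x y) = 0"
proof -
  have "0 \<in> root_space H \<alpha>" by (simp add: root_space_def bracket_zero)
  then obtain v where v: "v \<in> root_space H \<alpha>" "v \<noteq> 0"
    using \<alpha> by (auto simp: roots_def)
  then have ev: "bracket u v = scale (\<alpha> u) v" if "u \<in> H" for u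
    using that by (simp add: root_space_def)
  have "bracket (bracket x y) v + bracket (bracket y v) x + bracket (bracket v x) y = 0"
    by (rule jacobi_left)
  moreover have "bracket (bracket y v) x = - scale (\<alpha> y * \<alpha> x) v"
    using bracket_anticommute[of v x] by (simp add: ev x y bracket_scale_left)
  moreover have "bracket (bracket v x) y = scale (\<alpha> y * \<alpha> x) v"
    using bracket_anticommute[of v x] bracket_anticommute[of "bracket v x" y]
    by (simp add: ev x y bracket_scale_right bracket_minus mult.commute)
  ultimately have "scale (\<alpha> (bracket x y)) v = 0"
    using ev[OF H_bracket[OF x y]] by simp
  then show ?thesis using v(2) by simp
qed

text \<open>
  The common kernel of all roots in \<open>H\<close>.  It is zero by semisimplicity.  Two facts follow: \<open>H\<close> is abelian
  (as brackets in \<open>H\<close> lie in the kernel) and the roots span the dual space of \<open>H\<close>.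
\<close>

definition "root_kernel = {h \<in> H. \<forall>\<alpha>\<in>roots H. \<alpha> h = 0}"

lemma root_kernel_subspace: "subspace root_kernel"
proof (rule subspaceI)
  have lin: "\<alpha> (x + y) = \<alpha> x + \<alpha> y" "\<alpha> (scale a x) = a * \<alpha> x" "\<alpha> 0 = 0"
    if "\<alpha> \<in> roots H" "x \<in> H" "y \<in> H" for \<alpha> x y a
  proof -
    have "\<alpha> (0 + 0) = \<alpha> 0 + \<alpha> 0"
      using roots_dual[OF that(1)] subspace_0[OF H_subspace] unfolding dual_space_def by blast
    then show "\<alpha> 0 = 0" by simp
  qed (use roots_dual[OF that(1)] that in \<open>auto simp: dual_space_def\<close>)
  show "0 \<in> root_kernel"
    unfolding root_kernel_def using lin(3) subspace_0[OF H_subspace] by blast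
  show "x + y \<in> root_kernel" if "x \<in> root_kernel" "y \<in> root_kernel" for x y
  proof -
    have xy: "x \<in> H" "y \<in> H" using that by (auto simp: root_kernel_def)
    have "\<alpha> (x + y) = 0" if \<alpha>: "\<alpha> \<in> roots H" for \<alpha>
    proof -
      have "\<alpha> x = 0" "\<alpha> y = 0"
        using \<alpha> \<open>x \<in> root_kernel\<close> \<open>y \<in> root_kernel\<close> unfolding root_kernel_def by blast+
      then show ?thesis using lin(1)[OF \<alpha> xy] by simp
    qed
    then show ?thesis using subspace_add[OF H_subspace xy] by (simp add: root_kernel_def)
  qed
  show "scale a x \<in> root_kernel" if "x \<in> root_kernel" for a x
  proof -
    have x: "x \<in> H" using that by (auto simp: root_kernel_def)
    have "\<alpha> (scale a x) = 0" if \<alpha>: "\<alpha> \<in> roots H" for \<alpha>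
    proof -
      have "\<alpha> x = 0" using \<alpha> \<open>x \<in> root_kernel\<close> unfolding root_kernel_def by blast
      then show ?thesis using lin(2)[OF \<alpha> x x] by simp
    qed
    then show ?thesis using subspace_scale[OF H_subspace x] by (simp add: root_kernel_def)
  qed
qed

text \<open>
  The root vectors commute with the kernel, and \<open>H\<close> brackets it into the kernel by \<open>root_bracket_zero\<close>.
\<close>

lemma root_kernel_ideal: "lie_ideal root_kernel"
  unfolding lie_ideal_def
proof (intro conjI root_kernel_subspace allI ballI)
  fix x y assume y: "y \<in> root_kernel"
  then have yH: "y \<in> H" by (simp add: root_kernel_def)
  have "bracket (e i) y \<in> root_kernel" if i: "i < m" for i
    using e_cases[OF i]
  proof
    assume "e i \<in> H \<and> w i = 0"
    then show ?thesis using yH H_bracket root_bracket_zero by (auto simp: root_kernel_def)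
  next
    assume "w i \<in> roots H \<and> e i \<in> root_space H (w i)"
    then have "bracket y (e i) = 0" using y yH by (simp add: root_kernel_def root_space_def)
    then show ?thesis
      using bracket_anticommute[of "e i" y] subspace_0[OF root_kernel_subspace] by simp
  qed
  then have "bracket (\<Sum>i<m. scale (representation (e ` {..<m}) x (e i)) (e i)) y \<in> root_kernel"
    unfolding bracket_sum bracket_scale_left
    by (intro subspace_sum[OF root_kernel_subspace] subspace_scale[OF root_kernel_subspace]) auto
  then show "bracket x y \<in> root_kernel" by (simp add: lie_basis_expand[OF basis])
qed

text \<open>
  The derived series of a subset of \<open>H\<close> lies below the lower central series of \<open>H\<close>.
\<close>

lemma root_kernel_solvable: "solvable root_kernel"
proof -
  let ?D = "\<lambda>n. ((\<lambda>B. brackets B B) ^^ n) root_kernel" and ?C = "\<lambda>n. ((\<lambda>B. brackets H B) ^^ n) H"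
  obtain n where n: "?C n = {0}" using H_nilpotent by (auto simp: nilpotent_def)
  have sub: "brackets A A \<subseteq> H" "brackets A A \<subseteq> brackets H C" if "A \<subseteq> H" "A \<subseteq> C" for A C
  proof -
    show "brackets A A \<subseteq> H"
      unfolding brackets_def by (rule span_minimal[OF _ H_subspace]) (use that H_bracket in blast)
    show "brackets A A \<subseteq> brackets H C"
      unfolding brackets_def by (rule span_mono) (use that in blast)
  qed
  have "?D n \<subseteq> H \<and> ?D n \<subseteq> ?C n" for n
  proof (induction n)
    case 0
    show ?case by (auto simp: root_kernel_def)
  next
    case (Suc n)
    then show ?case using sub[of "?D n" "?C n"] by simp
  qed
  moreover have "0 \<in> ?D n" for n
    by (cases n) (simp_all add: brackets_def span_zero subspace_0[OF root_kernel_subspace])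
  ultimately have "?D n = {0}" using n by blast
  then show ?thesis by (auto simp: solvable_def)
qed

lemma root_kernel_zero: "root_kernel = {0}"
  using semisimple root_kernel_ideal root_kernel_solvable by (simp add: semisimple_def)

lemma bracket_H_basis:
  assumes y: "y \<in> H" and i: "i < m"
  shows "bracket y (e i) = scale (w i y) (e i)"
  using e_cases[OF i]
proof
  assume *: "e i \<in> H \<and> w i = 0"
  then have "bracket y (e i) \<in> root_kernel"
    using y H_bracket root_bracket_zero by (auto simp: root_kernel_def)
  then show ?thesis using * root_kernel_zero by simp
next
  assume "w i \<in> roots H \<and> e i \<in> root_space H (w i)"
  then show ?thesis using y by (simp add: root_space_def)
qed

lemma weight_cartan_zero:
  assumes "i < m" "e i \<in> H"
  shows "w i = 0"
proof
  fix y
  show "w i y = 0 y"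
  proof (cases "y \<in> H")
    case True
    then have "bracket y (e i) \<in> root_kernel"
      using assms(2) H_bracket root_bracket_zero by (auto simp: root_kernel_def)
    moreover have "0 \<notin> e ` {..<m}"
      using basis dependent_zero[of "e ` {..<m}"] unfolding lie_basis_def by blast
    then have "e i \<noteq> 0" using assms(1) by (metis imageI lessThan_iff)
    ultimately show ?thesis
      using bracket_H_basis[OF True assms(1)] root_kernel_zero by simp
  next
    case False
    then show ?thesis using e_cases[OF assms(1)] roots_dual[of "w i"] by (auto simp: dual_space_def)
  qed
qed

lemma weight_outside_cartan: "i < m \<Longrightarrow> y \<notin> H \<Longrightarrow> w i y = 0"
  using e_cases[of i] roots_dual[of "w i"] by (auto simp: dual_space_def)

sublocale Z: module "\<lambda>n::int. fun_scale (of_int n) :: ('g \<Rightarrow> complex) \<Rightarrow> _"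
  by (rule module_of_int[OF module_fun_scale])

lemma root_lattice_subspace: "Z.subspace \<Lambda>"
  unfolding root_lattice_def by (rule Z.subspace_span)

lemma roots_in_root_lattice: "\<alpha> \<in> roots H \<Longrightarrow> \<alpha> \<in> \<Lambda>"
  unfolding root_lattice_def by (rule Z.span_base)

lemma weight_in_root_lattice: "i < m \<Longrightarrow> w i \<in> \<Lambda>"
  using e_cases[of i] roots_in_root_lattice[of "w i"] Z.subspace_0[OF root_lattice_subspace] by auto

lemma mon_weight_in_root_lattice:
  assumes "\<mu> \<in> mon_box m"
  shows "mon_weight w \<mu> \<in> \<Lambda>"
proof -
  obtain S a where \<mu>: "\<mu> = (S, a)" by (cases \<mu>)
  have S: "S \<subseteq> {..<m}" "Poly_Mapping.keys a \<subseteq> {..<m}" using assms by (auto simp: \<mu> mon_box_def)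
  have neg: "- w i \<in> \<Lambda>" if "i < m" for i using Z.subspace_neg[OF root_lattice_subspace weight_in_root_lattice[OF that]] .
  have "fun_scale (of_nat n) (- w i) \<in> \<Lambda>" if "i < m" for i n
    using Z.subspace_scale[OF root_lattice_subspace neg[OF that], of "int n"] by simp
  then show ?thesis unfolding \<mu> mon_weight_def prod.case
    using S neg by (intro Z.subspace_add[OF root_lattice_subspace] Z.subspace_sum[OF root_lattice_subspace]) auto
qed

text \<open>
  In particular an element of the root lattice vanishes outside \<open>H\<close> and is determined by its values on
  a basis of \<open>H\<close>.
\<close>

lemma root_lattice_dual_space: "\<Lambda> \<subseteq> dual_space H"
  unfolding root_lattice_def
proof (rule Z.span_minimal)
  show "roots H \<subseteq> dual_space H" by (auto simp: roots_def)
  show "Z.subspace (dual_space H)"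
    by (rule Z.subspaceI) (auto simp: dual_space_def fun_scale_def algebra_simps)
qed

lemma root_lattice_integral: "\<alpha> \<in> \<Lambda> \<Longrightarrow> i < m \<Longrightarrow> e i \<in> H \<Longrightarrow> \<exists>z::int. \<alpha> (e i) = of_int z"
proof -
  assume i: "i < m" "e i \<in> H"
  have "\<Lambda> \<subseteq> {\<alpha>. \<alpha> (e i) \<in> \<int>}"
    unfolding root_lattice_def
  proof (rule Z.span_minimal)
    show "roots H \<subseteq> {\<alpha>. \<alpha> (e i) \<in> \<int>}" using roots_int i by auto
    show "Z.subspace {\<alpha>. \<alpha> (e i) \<in> \<int>}"
      by (rule Z.subspaceI) (auto simp: fun_scale_def)
  qed
  moreover assume "\<alpha> \<in> \<Lambda>"
  ultimately have "\<alpha> (e i) \<in> \<int>" by blast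
  then show ?thesis by (auto elim: Ints_cases)
qed

lemma dual_space_sum:
  assumes \<alpha>: "\<alpha> \<in> dual_space H" and "\<And>i. i \<in> F \<Longrightarrow> x i \<in> H"
  shows "\<alpha> (\<Sum>i\<in>F. scale (a i) (x i)) = (\<Sum>i\<in>F. a i * \<alpha> (x i))"
  using assms(2)
proof (induction F rule: infinite_finite_induct)
  have 0: "\<alpha> (scale 0 0) = 0 * \<alpha> 0"
    using \<alpha> subspace_0[OF H_subspace] unfolding dual_space_def by blast
  { case (infinite A)
    then show ?case using 0 by simp
  next
    case empty
    then show ?case using 0 by simp
  next
    case (insert i F)
    then have "scale (a i) (x i) \<in> H" "(\<Sum>i\<in>F. scale (a i) (x i)) \<in> H"
      by (auto intro!: subspace_scale[OF H_subspace] subspace_sum[OF H_subspace])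
    then show ?case using insert \<alpha> by (auto simp: dual_space_def)
  }
qed

definition "cartan_index = {i. i < m \<and> e i \<in> H}"

lemma finite_cartan_index: "finite cartan_index"
  by (simp add: cartan_index_def)

lemma span_cartan_index: "span (e ` cartan_index) = H"
proof -
  have "e ` cartan_index = {e i | i. i < m \<and> e i \<in> H}" by (auto simp: cartan_index_def)
  then show ?thesis using span_H by simp
qed

lemma basis_cartan_index: "inj_on e cartan_index" "independent (e ` cartan_index)"
proof -
  have "cartan_index \<subseteq> {..<m}" by (auto simp: cartan_index_def)
  then show "inj_on e cartan_index" "independent (e ` cartan_index)"
    using basis inj_on_subset independent_mono[OF _ image_mono] unfolding lie_basis_def by blast+
qed

lemma dim_H: "V.dim H = card cartan_index"
  using V.dim_unique[of "e ` cartan_index" H] basis_cartan_index span_cartan_index span_superset[of "e ` cartan_index"]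
  by (simp add: card_image)

lemma dual_space_eq_zero:
  assumes \<alpha>: "\<alpha> \<in> dual_space H" and 0: "\<And>i. i \<in> cartan_index \<Longrightarrow> \<alpha> (e i) = 0"
  shows "\<alpha> = 0"
proof -
  have "\<alpha> x = 0" if "x \<in> H" for x
  proof -
    have "subspace {x \<in> H. \<alpha> x = 0}"
    proof (rule subspaceI)
      have "\<alpha> (scale 0 0) = 0 * \<alpha> 0"
        using \<alpha> subspace_0[OF H_subspace] unfolding dual_space_def by blast
      then show "0 \<in> {x \<in> H. \<alpha> x = 0}" using subspace_0[OF H_subspace] by simp
    qed (use \<alpha> subspace_add[OF H_subspace] subspace_scale[OF H_subspace] in \<open>auto simp: dual_space_def\<close>)
    then have "span (e ` cartan_index) \<subseteq> {x \<in> H. \<alpha> x = 0}"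
      by (intro span_minimal) (use 0 in \<open>auto simp: cartan_index_def\<close>)
    then show ?thesis using that span_cartan_index by auto
  qed
  moreover have "\<alpha> x = 0" if "x \<notin> H" for x using \<alpha> that by (auto simp: dual_space_def)
  ultimately show ?thesis by (auto simp: fun_eq_iff)
qed

lemma root_lattice_nonzero_value:
  assumes "\<alpha> \<in> \<Lambda>" "\<alpha> \<noteq> 0"
  shows "\<exists>i z. i < m \<and> e i \<in> H \<and> \<alpha> (e i) = of_int z \<and> z \<noteq> 0"
proof -
  have "\<exists>i\<in>cartan_index. \<alpha> (e i) \<noteq> 0"
    using dual_space_eq_zero[OF subsetD[OF root_lattice_dual_space assms(1)]] assms(2) by blast
  then obtain i where i: "i < m" "e i \<in> H" "\<alpha> (e i) \<noteq> 0"
    unfolding cartan_index_def by blast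
  moreover obtain z :: int where z: "\<alpha> (e i) = of_int z" using root_lattice_integral[OF assms(1) i(1,2)] by blast
  moreover have "z \<noteq> 0" using i(3) z by auto
  ultimately show ?thesis by blast
qed

text \<open>
  The values on the basis vectors in \<open>H\<close> embed the root lattice into \<open>\<int>\<^sup>n\<close>, so it has a basis of at most
  \<open>n\<close> elements.  If there were fewer than \<open>n\<close>, they would have a common zero \<open>x \<noteq> 0\<close> in \<open>H\<close>, at which
  all roots vanish, in contradiction to \<open>root_kernel_zero\<close>.
\<close>

theorem root_lattice_free: "free_abelian_of_rank fun_scale \<Lambda> (V.dim H)"
proof -
  define f where "f i \<alpha> = \<lfloor>Re (\<alpha> (e i))\<rfloor>" for i and \<alpha> :: "'g \<Rightarrow> complex"
  have f: "of_int (f i \<alpha>) = \<alpha> (e i)" if i: "i \<in> cartan_index" and \<alpha>: "\<alpha> \<in> \<Lambda>" for i \<alpha>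
  proof -
    obtain z :: int where "\<alpha> (e i) = of_int z" using root_lattice_integral[OF \<alpha>] i by (auto simp: cartan_index_def)
    then show ?thesis by (simp add: f_def)
  qed
  \<comment> \<open>Identities between the integers \<open>f i \<alpha>\<close> are proved in the complex numbers, where \<open>f\<close> applies.\<close>
  have inj: "a = b" if "(of_int a :: complex) = of_int b" for a b :: int using that by simp
  have "\<exists>B. finite B \<and> card B \<le> card cartan_index \<and> \<not> Z.dependent B \<and> Z.span B = \<Lambda>"
  proof (rule subgroup_basis_of_int_coordinates[OF Z.module_axioms finite_cartan_index root_lattice_subspace])
    show "f i (\<alpha> + \<beta>) = f i \<alpha> + f i \<beta>" if "i \<in> cartan_index" "\<alpha> \<in> \<Lambda>" "\<beta> \<in> \<Lambda>" for i \<alpha> \<beta>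
      by (rule inj) (simp add: f that Z.subspace_add[OF root_lattice_subspace])
    show "f i (fun_scale (of_int n) \<alpha>) = n * f i \<alpha>" if "i \<in> cartan_index" "\<alpha> \<in> \<Lambda>" for i n \<alpha>
    proof (rule inj)
      have "of_int (f i (fun_scale (of_int n) \<alpha>)) = fun_scale (of_int n) \<alpha> (e i)"
        by (rule f[OF that(1) Z.subspace_scale[OF root_lattice_subspace that(2)]])
      then show "(of_int (f i (fun_scale (of_int n) \<alpha>)) :: complex) = of_int (n * f i \<alpha>)"
        using f[OF that] by (simp add: fun_scale_def)
    qed
    show "\<alpha> = 0" if "\<alpha> \<in> \<Lambda>" and 0: "\<And>i. i \<in> cartan_index \<Longrightarrow> f i \<alpha> = 0" for \<alpha>
      by (rule dual_space_eq_zero) (use that root_lattice_dual_space f[OF _ that(1)] in auto)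
  qed
  then obtain B where B: "finite B" "card B \<le> card cartan_index" "\<not> Z.dependent B" "Z.span B = \<Lambda>" by blast
  have "\<not> card B < card cartan_index"
  proof
    assume "card B < card cartan_index"
    then obtain a where a: "\<exists>l\<in>cartan_index. a l \<noteq> 0" "\<forall>b\<in>B. (\<Sum>l\<in>cartan_index. a l * b (e l)) = 0"
      using homogeneous_system_nontrivial_solution[OF B(1) finite_cartan_index, of "\<lambda>b l. b (e l)"] by blast
    define x where "x = (\<Sum>l\<in>cartan_index. scale (a l) (e l))"
    have xH: "x \<in> H" unfolding x_def
      by (intro subspace_sum[OF H_subspace] subspace_scale[OF H_subspace]) (auto simp: cartan_index_def)
    have "Z.span B \<subseteq> {\<alpha>. \<alpha> x = 0}"
    proof (rule Z.span_minimal)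
      show "B \<subseteq> {\<alpha>. \<alpha> x = 0}"
      proof
        fix b assume b: "b \<in> B"
        then have "b \<in> dual_space H" using B(4) root_lattice_dual_space Z.span_base by blast
        then have "b x = (\<Sum>l\<in>cartan_index. a l * b (e l))"
          unfolding x_def by (rule dual_space_sum) (auto simp: cartan_index_def)
        then show "b \<in> {\<alpha>. \<alpha> x = 0}" using a(2) b by simp
      qed
      show "Z.subspace {\<alpha>. \<alpha> x = 0}" by (rule Z.subspaceI) (auto simp: fun_scale_def)
    qed
    then have "x \<in> root_kernel" using xH roots_in_root_lattice B(4) by (auto simp: root_kernel_def)
    then have "x = 0" using root_kernel_zero by simp
    have "(\<Sum>v\<in>e ` cartan_index. scale (a (inv_into cartan_index e v)) v) = 0"
      using \<open>x = 0\<close> basis_cartan_index(1) by (simp add: x_def sum.reindex)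
    then have "a (inv_into cartan_index e (e l)) = 0" if "l \<in> cartan_index" for l
      using basis_cartan_index(2)[unfolded independent_explicit_module, rule_format,
          of "e ` cartan_index" "\<lambda>v. a (inv_into cartan_index e v)" "e l"] finite_cartan_index that by simp
    then show False using a(1) basis_cartan_index(1) by auto
  qed
  then show ?thesis
    unfolding free_abelian_of_rank_def dim_H using B by (intro exI[of _ B]) auto
qed

text \<open>
  Comparison of coefficients over the complex numbers.  Bracketing \<open>[e i, e j]\<close> with \<open>y \<in> H\<close> multiplies
  it by \<open>w i y + w j y\<close> and its component at \<open>e k\<close> by \<open>w k y\<close>, so only components with
  \<open>w k = w i + w j\<close> occur.  As the constants are integers, this survives reduction to any ring \<open>k\<close>.
\<close>

lemma integral_structure_constants:
  "\<exists>n :: nat \<Rightarrow> nat \<Rightarrow> nat \<Rightarrow> int.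
    (\<forall>i<m. \<forall>j<m. bracket (e i) (e j) = (\<Sum>k<m. scale (of_int (n i j k)) (e k))) \<and>
    (\<forall>i<m. \<forall>j<m. \<forall>k<m. n i j k \<noteq> 0 \<longrightarrow> w k = w i + w j) \<and>
    (\<forall>l<m. e l \<in> H \<longrightarrow> (\<forall>k<m. \<forall>i<m. of_int (n l k i) = (if k = i then w i (e l) else 0)))"
proof -
  interpret IZ: module "\<lambda>n::int. scale (of_int n)" by (rule module_of_int[OF module_axioms])
  have "\<forall>i j. \<exists>n::nat \<Rightarrow> int. i < m \<and> j < m \<longrightarrow> bracket (e i) (e j) = (\<Sum>k<m. scale (of_int (n k)) (e k))"
    using int_span_image_expand[OF module_axioms bracket_int_span[OF IZ.span_base IZ.span_base]] by blast
  then obtain n :: "nat \<Rightarrow> nat \<Rightarrow> nat \<Rightarrow> int"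
    where n: "\<And>i j. i < m \<Longrightarrow> j < m \<Longrightarrow> bracket (e i) (e j) = (\<Sum>k<m. scale (of_int (n i j k)) (e k))"
    by metis
  have weight: "w k = w i + w j" if i: "i < m" and j: "j < m" and k: "k < m" and nz: "n i j k \<noteq> 0" for i j k
  proof
    fix y
    show "w k y = (w i + w j) y"
    proof (cases "y \<in> H")
      case True
      have "bracket y (bracket (e i) (e j)) = scale (w i y + w j y) (bracket (e i) (e j))"
      proof -
        have 1: "bracket (e i) (bracket (e j) y) = - scale (w j y) (bracket (e i) (e j))"
          by (simp only: bracket_anticommute[of "e j" y] bracket_H_basis True i j bracket_minus bracket_scale_right)
        have 2: "bracket (e j) (bracket y (e i)) = - scale (w i y) (bracket (e i) (e j))"
          by (simp only: bracket_H_basis True i bracket_scale_right bracket_anticommute[of "e j" "e i"] scale_minus_right)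
        have "u = b + a" if "u + - a + - b = 0" for u a b :: 'g
        proof -
          have "u = (u + - a + - b) + (b + a)" by simp
          then show ?thesis unfolding that by simp
        qed
        from this[OF jacobi[of y "e i" "e j", unfolded 1 2]] show ?thesis by (simp only: scale_left_distrib)
      qed
      then have "(\<Sum>k<m. scale (of_int (n i j k) * w k y) (e k)) =
          (\<Sum>k<m. scale ((w i y + w j y) * of_int (n i j k)) (e k))"
        by (simp add: n i j bracket_sum bracket_scale_right bracket_H_basis True scale_sum_right)
      from lie_basis_unique[OF basis this k] show ?thesis using nz by (simp add: mult.commute)
    qed (use weight_outside_cartan i j k in auto)
  qed
  have diag: "of_int (n l k i) = (if k = i then w i (e l) else 0)"
    if l: "l < m" "e l \<in> H" and i: "i < m" and k: "k < m" for l i k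
  proof (rule lie_basis_unique[OF basis _ i])
    have "(\<Sum>i<m. scale (of_int (n l k i)) (e i)) = scale (w k (e l)) (e k)"
      using n[OF l(1) k] bracket_H_basis[OF l(2) k] by simp
    also have "\<dots> = (\<Sum>i<m. if k = i then scale (w k (e l)) (e k) else 0)" using k by simp
    also have "\<dots> = (\<Sum>i<m. scale (if k = i then w i (e l) else 0) (e i))"
      by (intro sum.cong refl) auto
    finally show "(\<Sum>i<m. scale (of_int (n l k i)) (e i)) = (\<Sum>i<m. scale (if k = i then w i (e l) else 0) (e i))" .
  qed
  show ?thesis
    by (intro exI[of _ n] conjI allI impI; (rule n | rule weight | rule diag))
qed

lemma scalar_extension_structure_constants:
  fixes kscale :: "'k::comm_ring_1 \<Rightarrow> 'l::ab_group_add \<Rightarrow> 'l"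
  assumes ext: "scalar_extension scale bracket m e kscale kbracket \<iota>"
    and n: "bracket (e i) (e j) = (\<Sum>k<m. scale (of_int (n k)) (e k))"
    and ijk: "i < m" "j < m" "k < m"
  shows "lie_algebra.structure_constants kscale kbracket m (\<lambda>i. \<iota> (e i)) i j k = of_int (n k)"
proof -
  interpret IZ: module "\<lambda>n::int. scale (of_int n)" by (rule module_of_int[OF module_axioms])
  interpret k: lie_algebra kscale kbracket using ext by (simp add: scalar_extension_def)
  let ?G = "IZ.span (e ` {..<m})"
  have add: "\<iota> (x + y) = \<iota> x + \<iota> y" and br: "\<iota> (bracket x y) = kbracket (\<iota> x) (\<iota> y)"
    if "x \<in> ?G" "y \<in> ?G" for x y
    using ext that by (auto simp: scalar_extension_def)
  have eG: "e i \<in> ?G" if "i < m" for i using that by (intro IZ.span_base) auto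
  have \<iota>0: "\<iota> 0 = 0" using add[OF IZ.span_zero IZ.span_zero] by simp
  have nat: "\<iota> (scale (of_nat a) x) = kscale (of_nat a) (\<iota> x)" if x: "x \<in> ?G" for a x
  proof (induction a)
    case (Suc a)
    have "scale (of_nat a) x \<in> ?G" using IZ.span_scale[OF x, of "int a"] by simp
    then show ?case
      using Suc add[OF x] by (simp add: scale_left_distrib k.scale_left_distrib)
  qed (simp add: \<iota>0)
  have neg: "\<iota> (- x) = - \<iota> x" if "x \<in> ?G" for x
    using add[OF that IZ.span_neg[OF that]] by (simp add: \<iota>0 eq_neg_iff_add_eq_0 add.commute)
  have int: "\<iota> (scale (of_int a) x) = kscale (of_int a) (\<iota> x)" if x: "x \<in> ?G" for a x
  proof (cases a rule: int_cases2)
    case (nonneg b)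
    then show ?thesis using nat[OF x] by simp
  next
    case (nonpos b)
    have "scale (of_nat b) x \<in> ?G" using IZ.span_scale[OF x, of "int b"] by simp
    then show ?thesis using nat[OF x] neg nonpos by simp
  qed
  have sum: "\<iota> (\<Sum>k\<in>A. scale (of_int (n k)) (e k)) = (\<Sum>k\<in>A. kscale (of_int (n k)) (\<iota> (e k)))"
    if "finite A" "A \<subseteq> {..<m}" for A
    using that
  proof (induction A rule: finite_induct)
    case (insert k A)
    have "scale (of_int (n k)) (e k) \<in> ?G" "(\<Sum>k\<in>A. scale (of_int (n k)) (e k)) \<in> ?G"
      using insert.prems by (auto intro!: IZ.span_sum IZ.span_scale eG)
    then show ?case using insert add int[OF eG] by simp
  qed (simp add: \<iota>0)
  have basis: "k.lie_basis m (\<lambda>i. \<iota> (e i))" using ext by (simp add: scalar_extension_def)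
  have "(\<Sum>k<m. kscale (k.structure_constants m (\<lambda>i. \<iota> (e i)) i j k) (\<iota> (e k))) =
      kbracket (\<iota> (e i)) (\<iota> (e j))"
    by (rule k.bracket_basis[OF basis, symmetric])
  also have "\<dots> = \<iota> (bracket (e i) (e j))" by (rule br[OF eG eG, symmetric]) (use ijk in auto)
  also have "\<dots> = (\<Sum>k<m. kscale (of_int (n k)) (\<iota> (e k)))"
    unfolding n by (rule sum) auto
  finally show ?thesis by (rule k.lie_basis_unique[OF basis _ ijk(3)])
qed

end


section \<open>The weight decomposition of the spectral sequence\<close>

theorem theorem1p5:
  fixes scale :: "complex \<Rightarrow> 'g::ab_group_add \<Rightarrow> 'g"
    and bracket :: "'g \<Rightarrow> 'g \<Rightarrow> 'g"
    and H :: "'g set"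
    and m :: nat
    and e :: "nat \<Rightarrow> 'g"
    and w :: "nat \<Rightarrow> 'g \<Rightarrow> complex"
    and kscale :: "'k::idom \<Rightarrow> 'l::ab_group_add \<Rightarrow> 'l"
    and kbracket :: "'l \<Rightarrow> 'l \<Rightarrow> 'l"
    and \<iota> :: "'g \<Rightarrow> 'l"
  assumes "lie_algebra scale bracket"
    and "lie_algebra.semisimple scale bracket"
    and "lie_algebra.cartan_subalgebra scale bracket H"
    and "integral_form scale bracket H m e w"
    and "principal_ideal_domain TYPE('k)"
    and "scalar_extension scale bracket m e kscale kbracket \<iota>"
  defines "\<Lambda> \<equiv> root_lattice scale bracket H"
    and "E \<equiv> lie_complex m (lie_algebra.structure_constants kscale kbracket m (\<lambda>i. \<iota> (e i)))"
  shows "free_abelian_of_rank fun_scale \<Lambda> (vector_space.dim scale H)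
    \<and> ss_decomposition E \<Lambda> (weight_part w E)
    \<and> (is_field TYPE('k) \<and> CHAR('k) = 0 \<longrightarrow>
        (\<forall>\<alpha>\<in>\<Lambda>. \<alpha> \<noteq> 0 \<longrightarrow> (\<forall>r\<ge>1. \<forall>s t.
          ss_page (weight_part w E \<alpha>) r s t = {ss_B (weight_part w E \<alpha>) r s t})))
    \<and> (\<forall>p. prime p \<and> odd p \<and> is_field TYPE('k) \<and> CHAR('k) = p \<longrightarrow>
        (\<forall>\<alpha>\<in>\<Lambda>. \<not> zero_mod p H m e \<alpha> \<longrightarrow> (\<forall>s.
          ss_page (weight_part w E \<alpha>) 1 s 0 = {ss_B (weight_part w E \<alpha>) 1 s 0})))"
proof -
  interpret g: lie_algebra scale bracket by fact
  interpret g: adapted_integral_form scale bracket H m e w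
    using assms(2-4) by unfold_locales
  interpret k: lie_algebra kscale kbracket using assms(6) by (simp add: scalar_extension_def)
  define c where "c = k.structure_constants m (\<lambda>i. \<iota> (e i))"
  obtain n :: "nat \<Rightarrow> nat \<Rightarrow> nat \<Rightarrow> int"
    where n': "\<forall>i<m. \<forall>j<m. bracket (e i) (e j) = (\<Sum>k<m. scale (of_int (n i j k)) (e k))"
    and weight: "\<forall>i<m. \<forall>j<m. \<forall>k<m. n i j k \<noteq> 0 \<longrightarrow> w k = w i + w j"
    and diag': "\<forall>l<m. e l \<in> H \<longrightarrow> (\<forall>k<m. \<forall>i<m. of_int (n l k i) = (if k = i then w i (e l) else 0))"
    using g.integral_structure_constants by (elim exE conjE)
  note n = n'[rule_format] and diag = diag'[rule_format]
  have c: "c i j k = of_int (n i j k)" if "i < m" "j < m" "k < m" for i j k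
    unfolding c_def by (rule g.scalar_extension_structure_constants[OF assms(6) n[OF that(1,2)] that])
  interpret lie_constants m c
    unfolding c_def using assms(6) by (intro k.lie_constants_structure_constants) (simp add: scalar_extension_def)
  interpret weighted_lie_constants m c w
  proof unfold_locales
    show "w k = w i + w j" if "i < m" "j < m" "k < m" "c i j k \<noteq> 0" for i j k
      by (rule weight[rule_format, OF that(1-3)]) (use that(4) c[OF that(1-3)] in auto)
  qed
  interpret graded_filtered_complex "lie_complex m c" \<Lambda> "weight_part w (lie_complex m c)" "weight_proj w"
    unfolding \<Lambda>_def by (rule graded_filtered_complex_pieces[OF g.mon_weight_in_root_lattice])
  have E: "E = lie_complex m c" by (simp add: E_def c_def)
  \<comment> \<open>A weight whose value at some basis vector in \<open>H\<close> is not divisible by the characteristic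
    contributes nothing from \<open>E\<^sub>1\<close> on.  Zero divides only zero, so this covers characteristic zero.\<close>
  have zero: "ss_page (weight_part w E \<alpha>) r s t = {ss_B (weight_part w E \<alpha>) r s t}"
    if "is_field TYPE('k)" "l < m" "e l \<in> H" "\<alpha> (e l) = of_int z" "\<not> int CHAR('k) dvd z" "1 \<le> r"
    for \<alpha> l z r s t
  proof -
    have "(of_int z :: 'k) \<noteq> 0" using that(5) by (simp add: of_int_eq_0_iff_char_dvd)
    then have "(of_int z :: 'k) dvd 1" using that(1) unfolding is_field_def by blast
    then obtain c' :: 'k where c': "of_int z * c' = 1" by (metis dvdE)
    have wl: "w l = 0" by (rule g.weight_cartan_zero[OF that(2,3)])
    show ?thesis unfolding E
    proof (rule page_piece_zero[where \<alpha> = \<alpha> and h = "e l" and z = z and c' = c' and \<zeta> = "\<lambda>i. n l i i",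
          OF that(2) wl _ _ that(4) c' that(6)])
      show "w i (e l) = of_int (n l i i)" if i: "i < m" for i
        using diag[OF \<open>l < m\<close> \<open>e l \<in> H\<close> i i] by simp
      show "c l k i = (if k = i then of_int (n l i i) else 0)" if i: "i < m" and k: "k < m" for i k
      proof (cases "k = i")
        case False
        then have "n l k i = 0" using diag[OF \<open>l < m\<close> \<open>e l \<in> H\<close> k i] by simp
        then show ?thesis using False by (simp add: c[OF \<open>l < m\<close> k i])
      qed (simp add: c[OF \<open>l < m\<close> i i])
    qed
  qed
  show ?thesis
  proof (intro conjI allI impI ballI)
    show "free_abelian_of_rank fun_scale \<Lambda> (g.V.dim H)"
      unfolding \<Lambda>_def by (rule g.root_lattice_free)
    show "ss_decomposition E \<Lambda> (weight_part w E)" unfolding E by (rule decomposition)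
  next
    fix \<alpha> and r :: nat and s t :: int
    assume k: "is_field TYPE('k) \<and> CHAR('k) = 0" and \<alpha>: "\<alpha> \<in> \<Lambda>" "\<alpha> \<noteq> 0" and r: "1 \<le> r"
    obtain i z where i: "i < m" "e i \<in> H" and z: "\<alpha> (e i) = of_int z" "z \<noteq> 0"
      using g.root_lattice_nonzero_value[OF \<alpha>[unfolded \<Lambda>_def]] by blast
    show "ss_page (weight_part w E \<alpha>) r s t = {ss_B (weight_part w E \<alpha>) r s t}"
      by (rule zero[where \<alpha> = \<alpha> and z = z and r = r, OF _ i z(1) _ r]) (use k z(2) in simp_all)
  next
    fix p \<alpha> and s :: int
    assume k: "prime p \<and> odd p \<and> is_field TYPE('k) \<and> CHAR('k) = p" and \<alpha>: "\<alpha> \<in> \<Lambda>" "\<not> zero_mod p H m e \<alpha>"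
    then obtain i where i: "i < m" "e i \<in> H" and ndvd: "\<nexists>z::int. \<alpha> (e i) = of_int z \<and> int p dvd z"
      unfolding zero_mod_def by blast
    obtain z :: int where z: "\<alpha> (e i) = of_int z"
      using g.root_lattice_integral[OF \<alpha>(1)[unfolded \<Lambda>_def] i] by blast
    then have "\<not> int p dvd z" using ndvd by blast
    then show "ss_page (weight_part w E \<alpha>) 1 s 0 = {ss_B (weight_part w E \<alpha>) 1 s 0}"
      using k by (intro zero[where \<alpha> = \<alpha> and z = z and r = 1, OF _ i z]) simp_all
  qed
qed

end
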